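(* Let $I$ be a homogeneous Artinian ideal of $R=k[x_1,x_2,x_3]$. If $A=R/I$ has the weak Lefschetz property, then the graded Betti numbers of $\mathrm{gin}(I)$ are completely determined by the graded Betti numbers of $I$. In particular, if $J$ is a homogeneous ideal of $R$ such that $R/J$ has the weak Lefschetz property and $\beta_{i,j}(I)=\beta_{i,j}(J)$ for all $i,j$, then $\beta_{i,j}(\mathrm{gin}(I))=\beta_{i,j}(\mathrm{gin}(J))$ for all $i,j$.
   Context: $k$ is a field of characteristic $0$, $R=k[x_1,x_2,x_3]$ with the standard grading. A homogeneous ideal $I\subsetneq R$ is called Artinian if $R/I$ is Artinian. $\mathrm{gin}(I)$ denotes the generic initial ideal of $I$ with respect to the reverse lexicographic order (with $x_1>x_2>x_3$): $\mathrm{gin}(I)=\mathrm{in}(gI)$ for $g$ in a nonempty Zariski open subset of $GL_3(k)$. For a homogeneous ideal $K$, the graded Betti numbers are $\beta_{q,i}(K)=\dim_k\mathrm{Tor}^R_q(K,k)_i$. Weak Lefschetz property of $A=R/I$: there is a linear form $L\in R$ such that $\times L:A_d\to A_{d+1}$ has maximal rank (is injective or surjective) for each $d\ge 0$. *)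

theory Defs
  imports "HOL-Analysis.Determinants" "HOL-Library.Poly_Mapping"
begin

section \<open>The polynomial ring in three variables\<close>

text \<open>
  The monomial \<open>x\<^sub>1\<^sup>a x\<^sub>2\<^sup>b x\<^sub>3\<^sup>c\<close> is its exponent vector, with components \<open>$ 1\<close>, \<open>$ 2\<close>, \<open>$ 3\<close>
  (in the index type \<^typ>\<open>3\<close> the numeral 3 denotes the same element as 0). The ring
  \<open>k[x\<^sub>1,x\<^sub>2,x\<^sub>3]\<close> is the monoid algebra over exponent vectors.
\<close>

type_synonym mon = "nat ^ 3"
type_synonym 'k mpoly3 = "(nat ^ 3) \<Rightarrow>\<^sub>0 'k"

definition mdeg :: "mon \<Rightarrow> nat"
  where "mdeg m = (\<Sum>i\<in>UNIV. m $ i)"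

definition Const :: "'k::zero \<Rightarrow> 'k mpoly3"
  where "Const c = Poly_Mapping.single 0 c"

definition Var :: "3 \<Rightarrow> 'k::{zero,one} mpoly3"
  where "Var i = Poly_Mapping.single (axis i 1) 1"

definition homogeneous :: "nat \<Rightarrow> 'k::zero mpoly3 \<Rightarrow> bool"
  where "homogeneous d f \<longleftrightarrow> (\<forall>m\<in>Poly_Mapping.keys f. mdeg m = d)"

text \<open>Ideals are the submodules of a ring over itself; \<open>ideal.span\<close> is the generated ideal.\<close>

global_interpretation ideal: module "(*) :: 'a::comm_ring_1 \<Rightarrow> 'a \<Rightarrow> 'a"
  by (rule module.intro) (rule distrib_left distrib_right mult.assoc[symmetric] mult_1_left)+

definition homogeneous_ideal :: "'k::field mpoly3 set \<Rightarrow> bool"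
  where "homogeneous_ideal I \<longleftrightarrow>
    (\<exists>S. (\<forall>f\<in>S. \<exists>d. homogeneous d f) \<and> I = ideal.span S)"


section \<open>Quotients, Artinian quotients and the weak Lefschetz property\<close>

definition residue_class :: "'k::field mpoly3 set \<Rightarrow> 'k mpoly3 \<Rightarrow> 'k mpoly3 set"
  where "residue_class I f = {g. g - f \<in> I}"

definition quotient_ideal :: "'k::field mpoly3 set \<Rightarrow> 'k mpoly3 set set \<Rightarrow> bool"
  where "quotient_ideal I X \<longleftrightarrow>
    X \<subseteq> range (residue_class I) \<and> residue_class I 0 \<in> X \<and>
    (\<forall>f g. residue_class I f \<in> X \<longrightarrow> residue_class I g \<in> X \<longrightarrow> residue_class I (f + g) \<in> X) \<and>
    (\<forall>r f. residue_class I f \<in> X \<longrightarrow> residue_class I (r * f) \<in> X)"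

definition artinian_quotient :: "'k::field mpoly3 set \<Rightarrow> bool"
  where "artinian_quotient I \<longleftrightarrow>
    (\<forall>C :: nat \<Rightarrow> 'k mpoly3 set set.
      (\<forall>n. quotient_ideal I (C n)) \<and> (\<forall>n. C (Suc n) \<subseteq> C n) \<longrightarrow>
      (\<exists>N. \<forall>n\<ge>N. C n = C N))"

definition artinian_ideal :: "'k::field mpoly3 set \<Rightarrow> bool"
  where "artinian_ideal I \<longleftrightarrow> homogeneous_ideal I \<and> I \<noteq> UNIV \<and> artinian_quotient I"

definition quotient_component :: "'k::field mpoly3 set \<Rightarrow> nat \<Rightarrow> 'k mpoly3 set set"
  where "quotient_component I d = residue_class I ` {f. homogeneous d f}"

definition quotient_mult :: "'k::field mpoly3 set \<Rightarrow> 'k mpoly3 \<Rightarrow> 'k mpoly3 set \<Rightarrow> 'k mpoly3 set"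
  where "quotient_mult I L X = (\<Union>f\<in>X. residue_class I (L * f))"

definition weak_Lefschetz :: "'k::field mpoly3 set \<Rightarrow> bool"
  where "weak_Lefschetz I \<longleftrightarrow>
    (\<exists>L. homogeneous 1 L \<and>
      (\<forall>d. inj_on (quotient_mult I L) (quotient_component I d) \<or>
           quotient_mult I L ` quotient_component I d = quotient_component I (Suc d)))"


section \<open>Initial ideals and generic initial ideals\<close>

text \<open>
  The degree reverse lexicographic order with \<open>x\<^sub>1 > x\<^sub>2 > x\<^sub>3\<close>. In equal degrees, \<open>u < v\<close> iff
  \<open>u\<close> has the larger exponent at the last position where the two differ; that position
  cannot be the first one, as the degrees agree.
\<close>

definition revlex_less :: "mon \<Rightarrow> mon \<Rightarrow> bool"
  where "revlex_less u v \<longleftrightarrow>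
    mdeg u < mdeg v \<or>
    mdeg u = mdeg v \<and> (u $ 3 > v $ 3 \<or> u $ 3 = v $ 3 \<and> u $ 2 > v $ 2)"

definition is_lead_monomial :: "'k::zero mpoly3 \<Rightarrow> mon \<Rightarrow> bool"
  where "is_lead_monomial f m \<longleftrightarrow>
    m \<in> Poly_Mapping.keys f \<and> (\<forall>m'\<in>Poly_Mapping.keys f. m' \<noteq> m \<longrightarrow> revlex_less m' m)"

definition initial_ideal :: "'k::field mpoly3 set \<Rightarrow> 'k mpoly3 set"
  where "initial_ideal I =
    ideal.span {Poly_Mapping.single m 1 | m. \<exists>f\<in>I. is_lead_monomial f m}"

text \<open>\<open>g\<close> acts as the algebra endomorphism with \<open>x\<^sub>j \<mapsto> \<Sum>\<^sub>i g\<^sub>i\<^sub>j x\<^sub>i\<close>.\<close>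

definition linear_subst :: "'k::field ^ 3 ^ 3 \<Rightarrow> 'k mpoly3 \<Rightarrow> 'k mpoly3"
  where "linear_subst g f =
    (\<Sum>m\<in>Poly_Mapping.keys f. Const (Poly_Mapping.lookup f m) *
      (\<Prod>j\<in>UNIV. (\<Sum>i\<in>UNIV. Const (g $ i $ j) * Var i) ^ (m $ j)))"

text \<open>Polynomial functions in the nine entries of a matrix; exponents are indexed like the entries.\<close>

definition eval_entries :: "((nat ^ 3 ^ 3) \<Rightarrow>\<^sub>0 'k::field) \<Rightarrow> 'k ^ 3 ^ 3 \<Rightarrow> 'k"
  where "eval_entries p g =
    (\<Sum>e\<in>Poly_Mapping.keys p. Poly_Mapping.lookup p e * (\<Prod>i\<in>UNIV. \<Prod>j\<in>UNIV. (g $ i $ j) ^ (e $ i $ j)))"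

definition zariski_open_GL3 :: "('k::field ^ 3 ^ 3) set \<Rightarrow> bool"
  where "zariski_open_GL3 U \<longleftrightarrow>
    (\<exists>S. U = {g. invertible g \<and> (\<exists>p\<in>S. eval_entries p g \<noteq> 0)})"

definition gin :: "'k::field mpoly3 set \<Rightarrow> 'k mpoly3 set"
  where "gin I = (THE K. \<exists>U. zariski_open_GL3 U \<and> U \<noteq> {} \<and>
    (\<forall>g\<in>U. initial_ideal (linear_subst g ` I) = K))"


section \<open>Graded free resolutions and graded Betti numbers\<close>

definition smul :: "'a::comm_ring_1 \<Rightarrow> ('i \<Rightarrow>\<^sub>0 'a) \<Rightarrow> ('i \<Rightarrow>\<^sub>0 'a)"
  where "smul c v = Poly_Mapping.map ((*) c) v"

lemma lookup_smul: "Poly_Mapping.lookup (smul c v) i = c * Poly_Mapping.lookup v i"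
  by (simp add: smul_def Poly_Mapping.map.rep_eq when_def)

global_interpretation kvec: vector_space "smul :: 'k::field \<Rightarrow> ('i \<Rightarrow>\<^sub>0 'k) \<Rightarrow> ('i \<Rightarrow>\<^sub>0 'k)"
  by (rule vector_space.intro; rule poly_mapping_eqI; simp only: lookup_smul lookup_add distrib_left distrib_right mult.assoc mult_1_left)

text \<open>
  For \<open>r :: nat \<Rightarrow> nat\<close>, the free module \<open>\<Oplus>\<^sub>j R(-j)\<^bsup>r j\<^esup>\<close> has the basis elements \<open>(j, a)\<close>, \<open>a < r j\<close>,
  where \<open>(j, a)\<close> has degree \<open>j\<close>. Finitely many of them occur in each degree. An element is its
  finitely supported family of coefficients.
\<close>

type_synonym 'k free_elem = "(nat \<times> nat) \<Rightarrow>\<^sub>0 'k mpoly3"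

definition free_module :: "(nat \<Rightarrow> nat) \<Rightarrow> 'k::field free_elem set"
  where "free_module r = {v. \<forall>(j, a)\<in>Poly_Mapping.keys v. a < r j}"

definition free_component :: "(nat \<Rightarrow> nat) \<Rightarrow> nat \<Rightarrow> 'k::field free_elem set"
  where "free_component r d =
    {v \<in> free_module r. \<forall>(j, a)\<in>Poly_Mapping.keys v.
       \<forall>m\<in>Poly_Mapping.keys (Poly_Mapping.lookup v (j, a)). j + mdeg m = d}"

text \<open>The \<open>R\<close>-linear maps to \<open>R\<close> and to a free module that are given by the images of the basis.\<close>

definition lin_poly :: "(nat \<times> nat \<Rightarrow> 'k::field mpoly3) \<Rightarrow> 'k free_elem \<Rightarrow> 'k mpoly3"
  where "lin_poly E v = (\<Sum>b\<in>Poly_Mapping.keys v. Poly_Mapping.lookup v b * E b)"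

definition lin_free :: "(nat \<times> nat \<Rightarrow> 'k::field free_elem) \<Rightarrow> 'k free_elem \<Rightarrow> 'k free_elem"
  where "lin_free D v = (\<Sum>b\<in>Poly_Mapping.keys v. smul (Poly_Mapping.lookup v b) (D b))"

text \<open>
  \<open>\<dots> \<rightarrow> F\<^sub>2 \<rightarrow> F\<^sub>1 \<rightarrow> F\<^sub>0 \<rightarrow> K \<rightarrow> 0\<close> is exact, with \<open>F\<^sub>q\<close> the graded free module given by \<open>r q\<close>, degree
  preserving augmentation \<open>E\<close> and degree preserving differentials \<open>D q : F\<^sub>q\<^sub>+\<^sub>1 \<rightarrow> F\<^sub>q\<close>. The resolution
  need not be minimal.
\<close>

definition graded_free_resolution ::
  "'k::field mpoly3 set \<Rightarrow> (nat \<Rightarrow> nat \<Rightarrow> nat) \<Rightarrow> (nat \<times> nat \<Rightarrow> 'k mpoly3) \<Rightarrow>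
    (nat \<Rightarrow> nat \<times> nat \<Rightarrow> 'k free_elem) \<Rightarrow> bool"
  where "graded_free_resolution K r E D \<longleftrightarrow>
    (\<forall>j a. a < r 0 j \<longrightarrow> homogeneous j (E (j, a))) \<and>
    (\<forall>q j a. a < r (Suc q) j \<longrightarrow> D q (j, a) \<in> free_component (r q) j) \<and>
    lin_poly E ` free_module (r 0) = K \<and>
    {v \<in> free_module (r 0). lin_poly E v = 0} = lin_free (D 0) ` free_module (r 1) \<and>
    (\<forall>q. {v \<in> free_module (r (Suc q)). lin_free (D q) v = 0} =
         lin_free (D (Suc q)) ` free_module (r (Suc (Suc q))))"

text \<open>
  Here \<open>k = R/(x\<^sub>1,x\<^sub>2,x\<^sub>3)\<close> sits in degree 0, so \<open>(R(-j) \<otimes> k)\<^sub>i\<close> is \<open>k\<close> if \<open>i = j\<close> and 0 otherwise: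
  \<open>(F \<otimes> k)\<^sub>i\<close> has the basis \<open>(i, a)\<close>, \<open>a < r i\<close>, and \<open>reduce i\<close> is the degree \<open>i\<close> part of \<open>F \<rightarrow> F \<otimes> k\<close>,
  which takes constant terms of coefficients.
\<close>

definition tensor_component :: "(nat \<Rightarrow> nat) \<Rightarrow> nat \<Rightarrow> (nat \<Rightarrow>\<^sub>0 'k::field) set"
  where "tensor_component r i = {v. \<forall>a\<in>Poly_Mapping.keys v. a < r i}"

definition reduce :: "nat \<Rightarrow> 'k::field free_elem \<Rightarrow> (nat \<Rightarrow>\<^sub>0 'k)"
  where "reduce i v =
    Poly_Mapping.map_key (Pair i) (Poly_Mapping.map (\<lambda>f. Poly_Mapping.lookup f 0) v)"

definition tensor_map ::
  "(nat \<times> nat \<Rightarrow> 'k::field free_elem) \<Rightarrow> nat \<Rightarrow> (nat \<Rightarrow>\<^sub>0 'k) \<Rightarrow> (nat \<Rightarrow>\<^sub>0 'k)"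
  where "tensor_map D i v =
    (\<Sum>a\<in>Poly_Mapping.keys v. smul (Poly_Mapping.lookup v a) (reduce i (D (i, a))))"

fun tor_cycles ::
  "(nat \<Rightarrow> nat \<Rightarrow> nat) \<Rightarrow> (nat \<Rightarrow> nat \<times> nat \<Rightarrow> 'k::field free_elem) \<Rightarrow> nat \<Rightarrow> nat \<Rightarrow> (nat \<Rightarrow>\<^sub>0 'k) set"
  where
    "tor_cycles r D 0 i = tensor_component (r 0) i"
  | "tor_cycles r D (Suc q) i = {v \<in> tensor_component (r (Suc q)) i. tensor_map (D q) i v = 0}"

definition tor_boundaries ::
  "(nat \<Rightarrow> nat \<Rightarrow> nat) \<Rightarrow> (nat \<Rightarrow> nat \<times> nat \<Rightarrow> 'k::field free_elem) \<Rightarrow> nat \<Rightarrow> nat \<Rightarrow> (nat \<Rightarrow>\<^sub>0 'k) set"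
  where "tor_boundaries r D q i = tensor_map (D q) i ` tensor_component (r (Suc q)) i"

text \<open>
  \<open>betti K q i = dim\<^sub>k Tor\<^sub>q(K,k)\<^sub>i\<close>, where \<open>Tor\<^sub>q(K,k)\<close> is the \<open>q\<close>-th homology of \<open>F \<otimes> k\<close> for a graded
  free resolution \<open>F\<close> of \<open>K\<close> (as a module, so \<open>q = 0\<close> counts generators of \<open>K\<close>). Every homogeneous
  ideal has such a resolution and the choice does not affect the dimension.
\<close>

definition betti :: "'k::field mpoly3 set \<Rightarrow> nat \<Rightarrow> nat \<Rightarrow> nat"
  where "betti K q i =
    (let (r, E, D) = (SOME (r, E, D). graded_free_resolution K r E D)
     in kvec.dim (tor_cycles r D q i) - kvec.dim (tor_boundaries r D q i))"

end

theory Submission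
  imports Defs "HOL-Computational_Algebra.Polynomial"
begin

text \<open>
  For any graded free resolution, counting dimensions degree by degree expresses the Betti numbers of a
  homogeneous ideal \<open>K\<close> by the dimensions of the graded pieces of \<open>K\<close>, of \<open>(x\<^sub>1, x\<^sub>2, x\<^sub>3) K\<close> and of the
  socle of \<open>R/K\<close>; this only uses rank-nullity and the exactness of Koszul complexes of free modules. In
  particular the Betti numbers of \<open>I\<close> determine its Hilbert function.

  A generic initial ideal in characteristic 0 is strongly stable, and for a strongly stable monomial
  ideal the three dimensions above are determined by the number of its monomials of each degree and the
  number of those divisible by \<open>x\<^sub>3\<close>. For \<open>gin I\<close> the former is the Hilbert function of \<open>I\<close>; by the choice
  of the reverse lexicographic order, the latter is the dimension of the forms \<open>h\<close> with \<open>L h \<in> I\<close> for a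
  generic linear form \<open>L\<close>, which the weak Lefschetz property makes as small as the Hilbert function allows.
\<close>

section \<open>Finite-dimensional subspaces\<close>

text \<open>The resolution behind \<open>betti\<close> is an arbitrary choice, possibly infinite and
  not minimal, so each count has to be independent of it. From the first syzygies on, every image is
  the kernel of a map into a torsion-free module; such a kernel is its own socle and cancels from
  the counts, so that only data of the ideal itself survive. The alternating sum of the three Betti
  numbers is the third difference of the Hilbert function.

  Genericity is replaced by an extremal condition: \<open>g\<close> is \<open>optimal\<close> if for
  every monomial \<open>u\<close> it maximises the number of leading monomials of the moved ideal
  that have the degree of \<open>u\<close> and are at least \<open>u\<close>. These counts are ranks
  of truncated coefficient matrices, so each maximum is attained on an open set, and only finitely
  many \<open>u\<close> matter because the ideal contains all forms of some degree. Optimality alone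
  gives uniqueness of the initial ideal and strong stability. For u = x_2^d it minimises the leading
  monomials divisible by x_3, and a single Lefschetz form, moved to x_3, bounds their number from
  above.\<close>

locale vec = vector_space scale for scale :: "'a::field \<Rightarrow> 'b::ab_group_add \<Rightarrow> 'b" (infixr "*s" 75)
begin

text \<open>The polynomial ring and the free modules over it are infinite-dimensional, so finite
  dimension is carried as a property of each subspace.\<close>

definition fin_subspace :: "'b set \<Rightarrow> bool"
  where "fin_subspace S \<longleftrightarrow> subspace S \<and> (\<exists>B. finite B \<and> S \<subseteq> span B)"

lemma fin_subspaceI: "subspace S \<Longrightarrow> finite B \<Longrightarrow> S \<subseteq> span B \<Longrightarrow> fin_subspace S"
  by (auto simp: fin_subspace_def)

lemma fin_subspace_subspace: "fin_subspace S \<Longrightarrow> subspace S"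
  by (simp add: fin_subspace_def)

lemma fin_subspace_subset: "fin_subspace T \<Longrightarrow> subspace S \<Longrightarrow> S \<subseteq> T \<Longrightarrow> fin_subspace S"
  by (auto simp: fin_subspace_def)

lemma fin_subspace_independent:
  assumes "fin_subspace S" "independent B" "B \<subseteq> S"
  shows "finite B" "card B \<le> dim S"
proof -
  obtain C where C: "finite C" "S \<subseteq> span C" using assms(1) by (auto simp: fin_subspace_def)
  show "finite B" using independent_span_bound[OF C(1) assms(2)] assms(3) C(2) by auto
  obtain B' where B': "B' \<subseteq> S" "independent B'" "S \<subseteq> span B'" "card B' = dim S"
    using basis_exists by blast
  have "finite B'" using independent_span_bound[OF C(1) B'(2)] B'(1) C(2) by auto
  then show "card B \<le> dim S" using independent_span_bound[of B' B] assms(2,3) B' by auto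
qed

lemma fin_subspace_basis:
  assumes "fin_subspace S"
  obtains B where "finite B" "B \<subseteq> S" "independent B" "span B = S" "card B = dim S"
proof -
  obtain B where B: "B \<subseteq> S" "independent B" "S \<subseteq> span B" "card B = dim S"
    using basis_exists by blast
  then show thesis
    using that[of B] fin_subspace_independent(1)[OF assms B(2,1)]
      span_minimal[of B S] fin_subspace_subspace[OF assms] by blast
qed

lemma fin_subspace_dim_mono:
  assumes "fin_subspace T" "subspace S" "S \<subseteq> T"
  shows "dim S \<le> dim T"
  using fin_subspace_basis[OF fin_subspace_subset[OF assms]] fin_subspace_independent(2)[OF assms(1)] assms(3)
  by (metis dual_order.trans)

lemma fin_subspace_dim_eq:
  assumes "fin_subspace T" "subspace S" "S \<subseteq> T" "dim T \<le> dim S"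
  shows "S = T"
proof (rule ccontr)
  assume "S \<noteq> T"
  then obtain x where x: "x \<in> T" "x \<notin> S" using assms(3) by blast
  obtain B where B: "finite B" "B \<subseteq> S" "independent B" "span B = S" "card B = dim S"
    using fin_subspace_basis[OF fin_subspace_subset[OF assms(1-3)]] by blast
  have "independent (insert x B)" using x B independent_insertI by blast
  then have "card (insert x B) \<le> dim T"
    using fin_subspace_independent(2)[OF assms(1)] x B assms(3) by blast
  moreover have "x \<notin> B" using x B by blast
  ultimately show False using B assms(4) by simp
qed

lemma dim_0: "dim {0} = 0"
  using dim_span_eq_card_independent[of "{}"] independent_empty by simp

end

locale vec_pair = vs1: vec s1 + vs2: vec s2
  for s1 :: "'k::field \<Rightarrow> 'v::ab_group_add \<Rightarrow> 'v" and s2 :: "'k \<Rightarrow> 'w::ab_group_add \<Rightarrow> 'w"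
begin

sublocale vector_space_pair s1 s2 ..

lemma fin_subspace_image:
  assumes "Vector_Spaces.linear s1 s2 f" "vs1.fin_subspace S"
  shows "vs2.fin_subspace (f ` S)"
proof -
  interpret f: Vector_Spaces.linear s1 s2 f by fact
  obtain B where "finite B" "S \<subseteq> vs1.span B" using assms(2) by (auto simp: vs1.fin_subspace_def)
  then have "f ` S \<subseteq> vs2.span (f ` B)" using f.span_image by blast
  then show ?thesis
    using \<open>finite B\<close> f.subspace_image[OF vs1.fin_subspace_subspace[OF assms(2)]]
    by (intro vs2.fin_subspaceI) auto
qed

lemma subspace_kernel_on:
  assumes "Vector_Spaces.linear s1 s2 f" "vs1.subspace S"
  shows "vs1.subspace {x \<in> S. f x = 0}"
proof -
  interpret f: Vector_Spaces.linear s1 s2 f by fact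
  show ?thesis using assms(2)
    by (auto simp: vs1.subspace_def f.add f.scale f.zero)
qed

text \<open>A basis \<open>B\<close> of the kernel inside \<open>S\<close> is extended to a basis
  \<open>C\<close> of \<open>S\<close>; the images of \<open>C - B\<close> form a basis of the
  image.\<close>

lemma rank_nullity:
  assumes lin: "Vector_Spaces.linear s1 s2 f" and S: "vs1.fin_subspace S"
  shows "vs1.dim S = vs1.dim {x \<in> S. f x = 0} + vs2.dim (f ` S)"
proof -
  interpret f: Vector_Spaces.linear s1 s2 f by fact
  let ?N = "{x \<in> S. f x = 0}"
  have subS: "vs1.subspace S" using S by (rule vs1.fin_subspace_subspace)
  have subN: "vs1.subspace ?N" by (rule subspace_kernel_on[OF lin subS])
  have finN: "vs1.fin_subspace ?N" by (rule vs1.fin_subspace_subset[OF S subN]) auto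
  obtain B where B: "finite B" "B \<subseteq> ?N" "vs1.independent B" "vs1.span B = ?N" "card B = vs1.dim ?N"
    using vs1.fin_subspace_basis[OF finN] by blast
  have "B \<subseteq> S" using B by auto
  then obtain C where C: "B \<subseteq> C" "C \<subseteq> S" "vs1.independent C" "S \<subseteq> vs1.span C"
    using vs1.maximal_independent_subset_extend[OF _ B(3)] by metis
  have fC: "finite C" using vs1.fin_subspace_independent(1)[OF S C(3,2)] .
  have spC: "vs1.span C = S" using C vs1.span_minimal[OF C(2) subS] by blast
  have dS: "vs1.dim S = card C" using vs1.dim_span_eq_card_independent[OF C(3)] spC by simp
  have indD: "vs1.independent (C - B)" using C(3) vs1.independent_mono by blast
  have inj: "inj_on f (vs1.span (C - B))"
  proof (rule f.inj_on_iff_eq_0[OF vs1.subspace_span, THEN iffD2], intro ballI impI)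
    fix x assume x: "x \<in> vs1.span (C - B)" "f x = 0"
    have "x \<in> S" using x(1) spC vs1.span_mono[of "C - B" C] by auto
    then have "x \<in> vs1.span B" using B(4) x(2) by auto
    \<comment> \<open>The coordinates of a kernel vector in the span of \<open>C - B\<close> are
      supported both in \<open>B\<close> and in \<open>C - B\<close>, hence vanish.\<close>
    then have rep: "vs1.representation C x = vs1.representation B x"
      "vs1.representation C x = vs1.representation (C - B) x"
      using vs1.representation_extend[OF C(3) _ C(1)] vs1.representation_extend[OF C(3) x(1)]
      by auto
    have "vs1.representation C x v = 0" for v
      using vs1.representation_ne_zero[of B x v] vs1.representation_ne_zero[of "C - B" x v] rep
      by (metis Diff_iff)
    then have "(\<Sum>v\<in>C. s1 (vs1.representation C x v) v) = 0" by simp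
    then show "x = 0" using vs1.sum_representation_eq[OF C(3) _ fC] \<open>x \<in> S\<close> C(4) by auto
  qed
  have ind: "vs2.independent (f ` (C - B))" using f.independent_injective_image[OF indD inj] .
  have "vs2.span (f ` (C - B)) = f ` S"
  proof -
    have "f ` S = vs2.span (f ` C)" using f.span_image spC by metis
    also have "\<dots> = vs2.span (f ` (C - B))"
    proof
      have "f ` C \<subseteq> vs2.span (f ` (C - B))"
      proof
        fix y assume "y \<in> f ` C"
        then obtain x where x: "x \<in> C" "y = f x" by auto
        show "y \<in> vs2.span (f ` (C - B))"
        proof (cases "x \<in> B")
          case True then have "y = 0" using B x by auto
          then show ?thesis using vs2.span_zero by simp
        next
          case False then show ?thesis using x by (auto intro: vs2.span_base)
        qed
      qed
      then show "vs2.span (f ` C) \<subseteq> vs2.span (f ` (C - B))"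
        by (simp add: vs2.span_minimal)
    next
      show "vs2.span (f ` (C - B)) \<subseteq> vs2.span (f ` C)" by (intro vs2.span_mono) auto
    qed
    finally show ?thesis by simp
  qed
  then have "vs2.dim (f ` S) = card (f ` (C - B))"
    using vs2.dim_span_eq_card_independent[OF ind] by simp
  also have "\<dots> = card (C - B)"
    by (intro card_image inj_on_subset[OF inj] vs1.span_superset)
  also have "\<dots> = card C - card B" using card_Diff_subset[OF B(1) C(1)] .
  finally show ?thesis using dS B(5) card_mono[OF fC C(1)] by simp
qed

lemma dim_image_inj:
  assumes "Vector_Spaces.linear s1 s2 f" "vs1.fin_subspace S" "\<And>x. x \<in> S \<Longrightarrow> f x = 0 \<Longrightarrow> x = 0"
  shows "vs2.dim (f ` S) = vs1.dim S"
proof -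
  interpret f: Vector_Spaces.linear s1 s2 f by fact
  have "{x \<in> S. f x = 0} = {0}"
    using assms(3) f.zero vs1.subspace_0[OF vs1.fin_subspace_subspace[OF assms(2)]] by auto
  then show ?thesis using rank_nullity[OF assms(1,2)] vs1.dim_0 by simp
qed

end

text \<open>The spaces below carry different scalar actions of the same field, so a product takes
  the actions as arguments.\<close>

definition prod_scale :: "('k \<Rightarrow> 'v \<Rightarrow> 'v) \<Rightarrow> ('k \<Rightarrow> 'w \<Rightarrow> 'w) \<Rightarrow> 'k \<Rightarrow> 'v \<times> 'w \<Rightarrow> 'v \<times> 'w"
  where "prod_scale s1 s2 c p = (s1 c (fst p), s2 c (snd p))"

lemma prod_scale_Pair [simp]: "prod_scale s1 s2 c (a, b) = (s1 c a, s2 c b)"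
  by (simp add: prod_scale_def)

lemma vec_prod_scale:
  assumes "vec s1" "vec s2"
  shows "vec (prod_scale s1 s2)"
proof -
  interpret a: vec s1 by fact
  interpret b: vec s2 by fact
  show ?thesis
    by unfold_locales
      (auto simp: prod_scale_def a.scale_right_distrib b.scale_right_distrib
        a.scale_left_distrib b.scale_left_distrib)
qed

context vec_pair
begin

text \<open>Rank-nullity for the first projection, whose kernel is a copy of
  \<open>B\<close>.\<close>

lemma dim_prod:
  assumes "vs1.fin_subspace A" "vs2.fin_subspace B"
  shows "vec.fin_subspace (prod_scale s1 s2) (A \<times> B)"
    and "vector_space.dim (prod_scale s1 s2) (A \<times> B) = vs1.dim A + vs2.dim B"
proof -
  interpret p: vec "prod_scale s1 s2"
    by (rule vec_prod_scale) unfold_locales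
  interpret p1: vec_pair "prod_scale s1 s2" s1 ..
  interpret p2: vec_pair s2 "prod_scale s1 s2" ..
  have lin1: "Vector_Spaces.linear (prod_scale s1 s2) s1 fst"
    by (simp add: Vector_Spaces.linear_iff prod_scale_def p.vector_space_axioms vs1.vector_space_axioms vs2.vector_space_axioms)
  have lin2: "Vector_Spaces.linear s2 (prod_scale s1 s2) (Pair 0)"
    by (simp add: Vector_Spaces.linear_iff prod_scale_def p.vector_space_axioms vs1.vector_space_axioms vs2.vector_space_axioms)
  have sub: "vs1.subspace A" "vs2.subspace B"
    using assms vs1.fin_subspace_subspace vs2.fin_subspace_subspace by auto
  have subp: "p.subspace (A \<times> B)"
    using sub by (auto simp: p.subspace_def vs1.subspace_def vs2.subspace_def zero_prod_def)
  obtain C where C: "finite C" "A \<subseteq> vs1.span C" using assms(1) by (auto simp: vs1.fin_subspace_def)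
  obtain D where D: "finite D" "B \<subseteq> vs2.span D" using assms(2) by (auto simp: vs2.fin_subspace_def)
  let ?E = "(\<lambda>x. (x, 0)) ` C \<union> Pair 0 ` D"
  interpret p3: vec_pair s1 "prod_scale s1 s2" ..
  have lin3: "Vector_Spaces.linear s1 (prod_scale s1 s2) (\<lambda>x. (x, 0))"
    by (simp add: Vector_Spaces.linear_iff prod_scale_def p.vector_space_axioms vs1.vector_space_axioms vs2.vector_space_axioms)
  have e1: "(\<lambda>x. (x, 0)) ` vs1.span C \<subseteq> p.span ?E"
    using module_hom.span_image[of s1 "prod_scale s1 s2" "\<lambda>x. (x,0)" C]
    by (metis (no_types, lifting) Un_upper1 module_hom_iff_linear lin3 p.span_mono)
  have e2: "Pair 0 ` vs2.span D \<subseteq> p.span ?E"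
    using module_hom.span_image[of s2 "prod_scale s1 s2" "Pair 0" D]
    by (metis (no_types, lifting) Un_upper2 module_hom_iff_linear lin2 p.span_mono)
  have "A \<times> B \<subseteq> p.span ?E"
  proof
    fix q assume q: "q \<in> A \<times> B"
    have "(fst q, 0) \<in> p.span ?E" "(0, snd q) \<in> p.span ?E"
      using q e1 e2 C(2) D(2) by (auto simp: image_subset_iff subset_iff)
    from p.span_add[OF this] show "q \<in> p.span ?E" by simp
  qed
  then show fin: "p.fin_subspace (A \<times> B)" using C D subp by (intro p.fin_subspaceI[of _ ?E]) auto
  have "{x \<in> A \<times> B. fst x = 0} = Pair 0 ` B" using vs1.subspace_0[OF sub(1)] by auto
  moreover have "fst ` (A \<times> B) = A" using vs2.subspace_0[OF sub(2)] by force
  moreover have "p.dim (Pair 0 ` B) = vs2.dim B"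
    by (rule p2.dim_image_inj[OF lin2 assms(2)]) (auto simp: zero_prod_def)
  ultimately show "p.dim (A \<times> B) = vs1.dim A + vs2.dim B"
    using p1.rank_nullity[OF lin1 fin] by simp
qed

end

section \<open>Koszul complexes in three variables\<close>

text \<open>The differentials of the Koszul complex of three commuting operators. A triple in the
  source of \<open>koszul2\<close> lists the coefficients of e_1 e_2, e_1 e_3 and e_2 e_3, in this
  order; this fixes the signs.\<close>

definition koszul1 :: "(3 \<Rightarrow> 'v::ab_group_add \<Rightarrow> 'v) \<Rightarrow> 'v \<times> 'v \<times> 'v \<Rightarrow> 'v"
  where "koszul1 X t = X 1 (fst t) + X 2 (fst (snd t)) + X 3 (snd (snd t))"

definition koszul2 :: "(3 \<Rightarrow> 'v::ab_group_add \<Rightarrow> 'v) \<Rightarrow> 'v \<times> 'v \<times> 'v \<Rightarrow> 'v \<times> 'v \<times> 'v"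
  where "koszul2 X t =
    (- X 2 (fst t) - X 3 (fst (snd t)), X 1 (fst t) - X 3 (snd (snd t)),
     X 1 (fst (snd t)) + X 2 (snd (snd t)))"

definition koszul3 :: "(3 \<Rightarrow> 'v::ab_group_add \<Rightarrow> 'v) \<Rightarrow> 'v \<Rightarrow> 'v \<times> 'v \<times> 'v"
  where "koszul3 X m = (X 3 m, - X 2 m, X 1 m)"

abbreviation cube :: "'v set \<Rightarrow> ('v \<times> 'v \<times> 'v) set"
  where "cube S \<equiv> S \<times> S \<times> S"

abbreviation cube_scale :: "('k \<Rightarrow> 'v \<Rightarrow> 'v) \<Rightarrow> 'k \<Rightarrow> 'v \<times> 'v \<times> 'v \<Rightarrow> 'v \<times> 'v \<times> 'v"
  where "cube_scale s \<equiv> prod_scale s (prod_scale s s)"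

lemma neq_3 [simp]: "(1::3) \<noteq> 2" "(1::3) \<noteq> 3" "(2::3) \<noteq> 3" "(2::3) \<noteq> 1" "(3::3) \<noteq> 1" "(3::3) \<noteq> 2"
  by simp_all

context vec
begin

lemma vec_cube: "vec (cube_scale scale)"
  by (intro vec_prod_scale) unfold_locales

lemma dim_cube:
  assumes "fin_subspace S"
  shows "vec.fin_subspace (cube_scale scale) (cube S)"
    and "vector_space.dim (cube_scale scale) (cube S) = 3 * dim S"
proof -
  interpret p: vec_pair scale scale ..
  interpret p2: vec "prod_scale scale scale" by (intro vec_prod_scale) unfold_locales
  interpret q: vec_pair scale "prod_scale scale scale" ..
  show "vec.fin_subspace (cube_scale scale) (cube S)"
    by (rule q.dim_prod(1)[OF assms p.dim_prod(1)[OF assms assms]])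
  show "vector_space.dim (cube_scale scale) (cube S) = 3 * dim S"
    using q.dim_prod(2)[OF assms p.dim_prod(1)[OF assms assms]] p.dim_prod(2)[OF assms assms] by simp
qed

end

text \<open>
  \<open>X i\<close> is multiplication by \<open>x\<^sub>i\<close>; \<open>D i\<close> divides the terms divisible by \<open>x\<^sub>i\<close> by \<open>x\<^sub>i\<close> and drops the
  others. All that exactness of the Koszul complex needs is that \<open>D i\<close> is a left inverse of \<open>X i\<close> which
  commutes with the other \<open>X j\<close>.
\<close>

locale koszul = vec scale for scale :: "'k::field \<Rightarrow> 'v::ab_group_add \<Rightarrow> 'v" +
  fixes X D :: "3 \<Rightarrow> 'v \<Rightarrow> 'v" and V :: "int \<Rightarrow> 'v set"
  assumes linear_X: "Vector_Spaces.linear scale scale (X i)"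
    and linear_D: "Vector_Spaces.linear scale scale (D i)"
    and D_X_same: "D i (X i v) = v"
    and D_X: "i \<noteq> j \<Longrightarrow> D i (X j v) = X j (D i v)"
    and X_commute: "X i (X j v) = X j (X i v)"
    and fin_V: "fin_subspace (V d)"
    and X_V: "v \<in> V d \<Longrightarrow> X i v \<in> V (d + 1)"
    and D_V: "v \<in> V d \<Longrightarrow> D i v \<in> V (d - 1)"
begin

text \<open>For a graded submodule \<open>S\<close>, the dimension of the degree \<open>i\<close>
  part of (x_1, x_2, x_3) S. Degrees are integers, so that shifts by up to 3 never truncate.\<close>

definition mu :: "(int \<Rightarrow> 'v set) \<Rightarrow> int \<Rightarrow> nat"
  where "mu S i = dim (koszul1 X ` cube (S (i - 1)))"

text \<open>For a graded submodule \<open>S\<close>, the preimage in \<open>V\<close> of the socle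
  of V/S. It contains \<open>S\<close>, so the dimension of the socle of the quotient is a
  difference.\<close>

definition socle :: "(int \<Rightarrow> 'v set) \<Rightarrow> int \<Rightarrow> 'v set"
  where "socle S d = {m \<in> V d. \<forall>j. X j m \<in> S (d + 1)}"

lemmas X_lin = linear_X[unfolded Vector_Spaces.linear_iff]

lemma X_add: "X i (v + w) = X i v + X i w"
  using X_lin[of i] by blast

lemma X_scale: "X i (scale c v) = scale c (X i v)"
  using X_lin[of i] by blast

lemma X_0: "X i 0 = 0"
  using X_add[of i 0 0] by simp

lemma X_uminus: "X i (- v) = - X i v"
  using X_add[of i v "- v"] X_0 by (simp add: minus_unique)

lemma X_diff: "X i (v - w) = X i v - X i w"
  using X_add[of i v "- w"] X_uminus by simp

lemmas D_lin = linear_D[unfolded Vector_Spaces.linear_iff]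

lemma D_add: "D i (v + w) = D i v + D i w"
  using D_lin[of i] by blast

lemma D_0: "D i 0 = 0"
  using D_add[of i 0 0] by simp

lemma X_inj: "X i v = 0 \<Longrightarrow> v = 0"
  using D_X_same[of i v] D_0 by simp

lemmas X_simps = X_add X_diff X_uminus X_0 X_scale

lemmas V_subspace = fin_subspace_subspace[OF fin_V]

lemma V_closed: "0 \<in> V d" "v \<in> V d \<Longrightarrow> w \<in> V d \<Longrightarrow> v + w \<in> V d" "v \<in> V d \<Longrightarrow> - v \<in> V d"
   "v \<in> V d \<Longrightarrow> w \<in> V d \<Longrightarrow> v - w \<in> V d"
  using V_subspace subspace_0 subspace_add subspace_neg subspace_diff by blast+

lemma X_V': "v \<in> V (d - 1) \<Longrightarrow> X i v \<in> V d"
  using X_V[of v "d - 1"] by simp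

lemma vec_pairs: "vec_pair (cube_scale scale) scale" "vec_pair scale (cube_scale scale)"
  "vec_pair (cube_scale scale) (cube_scale scale)" "vec_pair scale scale"
  by (auto simp: vec_pair_def vec_cube vec_axioms)

lemma linear_koszul1: "Vector_Spaces.linear (cube_scale scale) scale (koszul1 X)"
  using vec_cube vec_axioms
  by (auto simp: Vector_Spaces.linear_iff koszul1_def prod_scale_def X_simps scale_right_distrib vec_def)

lemma linear_koszul2: "Vector_Spaces.linear (cube_scale scale) (cube_scale scale) (koszul2 X)"
  using vec_cube vec_axioms
  by (auto simp: Vector_Spaces.linear_iff koszul2_def prod_scale_def X_simps scale_right_distrib
      scale_right_diff_distrib vec_def)

lemma linear_koszul3: "Vector_Spaces.linear scale (cube_scale scale) (koszul3 X)"
  using vec_cube vec_axioms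
  by (auto simp: Vector_Spaces.linear_iff koszul3_def prod_scale_def X_simps vec_def)

lemma koszul12: "koszul1 X (koszul2 X t) = 0"
  by (simp add: koszul1_def koszul2_def X_simps X_commute[of 1 2] X_commute[of 1 3] X_commute[of 2 3])

lemma koszul23: "koszul2 X (koszul3 X m) = 0"
  by (simp add: koszul2_def koszul3_def X_simps X_commute[of 1 2] X_commute[of 1 3] X_commute[of 2 3]
      zero_prod_def)

lemma koszul1_V: "t \<in> cube (V (d - 1)) \<Longrightarrow> koszul1 X t \<in> V d"
  by (auto simp: koszul1_def intro!: V_closed X_V')

lemma koszul2_V: "t \<in> cube (V (d - 1)) \<Longrightarrow> koszul2 X t \<in> cube (V d)"
  by (auto simp: koszul2_def intro!: V_closed X_V')

lemma koszul3_V: "m \<in> V (d - 1) \<Longrightarrow> koszul3 X m \<in> cube (V d)"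
  by (auto simp: koszul3_def intro!: V_closed X_V')

lemma koszul3_inj: "koszul3 X m = 0 \<Longrightarrow> m = 0"
  using X_inj by (auto simp: koszul3_def zero_prod_def)

text \<open>Apply \<open>D i\<close> to the relation: it undoes \<open>X i\<close> on the left and
  passes \<open>X j\<close> on the right. Then cancel the injective \<open>X j\<close>.\<close>

lemma syzygy_two:
  assumes "X i v = X j w" "i \<noteq> j" "w \<in> V d"
  shows "D i w \<in> V (d - 1)" "v = X j (D i w)" "w = X i (D i w)"
proof -
  show "D i w \<in> V (d - 1)" using D_V assms(3) .
  show v: "v = X j (D i w)" using D_X_same[of i v] assms(1) D_X[OF assms(2), of w] by simp
  have "X j (X i (D i w)) = X j w" using v assms(1) X_commute[of i j] by metis
  then have "X j (X i (D i w) - w) = 0" using X_diff by simp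
  then show "w = X i (D i w)" using X_inj by fastforce
qed

text \<open>The middle equation is a syzygy of x_1 and x_3, which produces \<open>m\<close>; the
  first one then determines \<open>q\<close>, as \<open>X 3\<close> is injective.\<close>

lemma koszul_exact2:
  assumes t: "t \<in> cube (V d)" and z: "koszul2 X t = 0"
  obtains m where "m \<in> V (d - 1)" "t = koszul3 X m"
proof -
  obtain p q r where pqr: "t = (p, q, r)" by (metis prod_cases3)
  have z': "- X 2 p - X 3 q = 0" "X 1 p = X 3 r" "X 1 q + X 2 r = 0"
    using z by (auto simp: pqr koszul2_def zero_prod_def)
  have V: "p \<in> V d" "r \<in> V d" using t pqr by auto
  let ?m = "D 1 r"
  note m = syzygy_two[OF z'(2) neq_3(2) V(2)]
  have "X 2 p = X 3 (X 2 ?m)" using arg_cong[OF m(2), of "X 2"] X_commute[of 2 3 ?m] by (rule trans)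
  then have "X 3 (X 2 ?m + q) = - (- X 2 p - X 3 q)" by (simp add: X_add)
  also have "\<dots> = 0" using z'(1) by simp
  finally have "X 2 ?m + q = 0" by (rule X_inj)
  then have "q = - X 2 ?m" by (simp add: eq_neg_iff_add_eq_0 add.commute)
  then have "t = koszul3 X ?m" using pqr m(2,3) by (simp add: koszul3_def)
  then show thesis using that m(1) by blast
qed

text \<open>Reducing the relation modulo x_1 and x_2 puts the last entry into (x_1, x_2);
  subtracting the corresponding Koszul relations leaves a syzygy of x_1 and x_2 only.\<close>

lemma koszul_exact1:
  assumes t: "t \<in> cube (V d)" and z: "koszul1 X t = 0"
  obtains u where "u \<in> cube (V (d - 1))" "t = koszul2 X u"
proof -
  obtain a b c where abc: "t = (a, b, c)" by (metis prod_cases3)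
  have V: "a \<in> V d" "b \<in> V d" "c \<in> V d" using t abc by auto
  have z': "X 1 a + X 2 b + X 3 c = 0"
    using z by (simp add: abc koszul1_def)
  \<comment> \<open>\<open>E i\<close> keeps the terms free of x_i: it kills multiples of x_i and
    commutes with the other variables.\<close>
  define E where "E i v = v - X i (D i v)" for i v
  have E_add: "E i (v + w) = E i v + E i w" for i v w
    by (simp add: E_def D_add X_add)
  have E_same: "E i (X i v) = 0" for i v by (simp add: E_def D_X_same)
  have E_X: "i \<noteq> j \<Longrightarrow> E i (X j v) = X j (E i v)" for i j v
    by (simp add: E_def D_X X_diff X_commute[of i j])
  have E0: "E i 0 = 0" for i by (simp add: E_def X_0 D_0)
  have "E 2 (E 1 (X 1 a + X 2 b + X 3 c)) = X 3 (E 2 (E 1 c))"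
    by (simp add: E_add E_same E_X E0 X_0)
  then have "E 2 (E 1 c) = 0" using z' X_inj by (simp add: E0)
  define q where "q = D 1 c"
  define r where "r = D 2 (E 1 c)"
  have c: "c = X 1 q + X 2 r"
    using \<open>E 2 (E 1 c) = 0\<close> by (simp add: E_def q_def r_def algebra_simps)
  have qr: "q \<in> V (d - 1)" "r \<in> V (d - 1)"
    using V(3) by (auto simp: q_def r_def E_def intro!: D_V V_closed X_V')
  have "X 1 (a + X 3 q) = X 2 (- (b + X 3 r))"
  proof -
    have "X 3 c = X 1 (X 3 q) + X 2 (X 3 r)"
      by (subst c) (simp add: X_add X_commute[of 3])
    then have "X 1 (a + X 3 q) + X 2 (b + X 3 r) = 0"
      using z' by (simp add: X_add add_ac)
    then show ?thesis by (simp only: X_uminus eq_neg_iff_add_eq_0)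
  qed
  from syzygy_two[OF this, of d] have
    p: "D 1 (- (b + X 3 r)) \<in> V (d - 1)" "a + X 3 q = X 2 (D 1 (- (b + X 3 r)))"
       "- (b + X 3 r) = X 1 (D 1 (- (b + X 3 r)))"
    using V qr by (auto intro!: V_closed X_V')
  define p where "p = - D 1 (- (b + X 3 r))"
  have "a = - X 2 p - X 3 q" using p(2) by (simp add: p_def X_uminus algebra_simps)
  moreover have "b = X 1 p - X 3 r" using p(3) by (simp add: p_def X_uminus eq_diff_eq equation_minus_iff)
  ultimately have "t = koszul2 X (p, q, r)" using c abc by (simp add: koszul2_def)
  moreover have "p \<in> V (d - 1)" using V_closed(3)[OF p(1)] by (simp only: p_def)
  ultimately show thesis using that[of "(p, q, r)"] qr by auto
qed

end

locale koszul_hom = A: koszul s1 X1 D1 V1 + B: koszul s2 X2 D2 V2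
  for s1 :: "'k::field \<Rightarrow> 'v::ab_group_add \<Rightarrow> 'v" and X1 D1 V1
  and s2 :: "'k \<Rightarrow> 'w::ab_group_add \<Rightarrow> 'w" and X2 D2 V2 +
  fixes \<phi> :: "'v \<Rightarrow> 'w"
  assumes linear_\<phi>: "Vector_Spaces.linear s1 s2 \<phi>"
    and \<phi>_X: "\<phi> (X1 i v) = X2 i (\<phi> v)"
    and \<phi>_V: "v \<in> V1 d \<Longrightarrow> \<phi> v \<in> V2 d"
begin

sublocale vec_pair s1 s2 ..

definition ker :: "int \<Rightarrow> 'v set"
  where "ker d = {v \<in> V1 d. \<phi> v = 0}"

definition im :: "int \<Rightarrow> 'w set"
  where "im d = \<phi> ` V1 d"

lemma \<phi>_add: "\<phi> (v + w) = \<phi> v + \<phi> w" and \<phi>_scale: "\<phi> (s1 c v) = s2 c (\<phi> v)"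
  using linear_\<phi> by (auto simp: Vector_Spaces.linear_iff)

lemma \<phi>_0: "\<phi> 0 = 0"
  using \<phi>_add[of 0 0] by simp

lemma \<phi>_uminus: "\<phi> (- v) = - \<phi> v"
  using \<phi>_add[of v "- v"] \<phi>_0 by (simp add: minus_unique)

lemma \<phi>_diff: "\<phi> (v - w) = \<phi> v - \<phi> w"
  using \<phi>_add[of v "- w"] \<phi>_uminus by simp

lemma fin_ker: "A.fin_subspace (ker d)"
  using A.fin_subspace_subset[OF A.fin_V[of d] subspace_kernel_on[OF linear_\<phi> A.V_subspace[of d]]]
  by (auto simp: ker_def)

lemma fin_im: "B.fin_subspace (im d)"
  using fin_subspace_image[OF linear_\<phi> A.fin_V] by (simp add: im_def)

lemma dim_ker_im: "A.dim (V1 d) = A.dim (ker d) + B.dim (im d)"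
  using rank_nullity[OF linear_\<phi> A.fin_V] by (simp add: im_def ker_def)

definition \<phi>3 :: "'v \<times> 'v \<times> 'v \<Rightarrow> 'w \<times> 'w \<times> 'w"
  where "\<phi>3 = map_prod \<phi> (map_prod \<phi> \<phi>)"

lemma linear_\<phi>3: "Vector_Spaces.linear (cube_scale s1) (cube_scale s2) \<phi>3"
  using A.vec_cube B.vec_cube
  by (auto simp: Vector_Spaces.linear_iff \<phi>3_def prod_scale_def \<phi>_add \<phi>_scale vec_def map_prod_def split: prod.splits)

lemma \<phi>3_koszul1: "\<phi> (koszul1 X1 t) = koszul1 X2 (\<phi>3 t)"
  by (simp add: koszul1_def \<phi>3_def \<phi>_add \<phi>_X)

lemma \<phi>3_koszul2: "\<phi>3 (koszul2 X1 t) = koszul2 X2 (\<phi>3 t)"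
  by (simp add: koszul2_def \<phi>3_def \<phi>_add \<phi>_diff \<phi>_uminus \<phi>_X)

lemma \<phi>3_koszul3: "\<phi>3 (koszul3 X1 m) = koszul3 X2 (\<phi> m)"
  by (simp add: koszul3_def \<phi>3_def \<phi>_uminus \<phi>_X)

text \<open>
  The Koszul 1-cycles of the kernel of \<open>\<phi>\<close> are the \<open>koszul2\<close>-images of the triples that \<open>\<phi>\<close> maps to Koszul
  2-cycles; these are mapped onto the \<open>koszul3\<close>-images of the socle of the cokernel of \<open>\<phi>\<close>.
\<close>

lemma mu_ker:
  "int (A.mu ker i) = 3 * int (A.dim (ker (i - 1))) - 3 * int (A.dim (ker (i - 2)))
     - int (B.dim (B.socle im (i - 3))) + int (A.dim (V1 (i - 3)))"
proof -
  interpret A3: vec "cube_scale s1" by (rule A.vec_cube)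
  interpret B3: vec "cube_scale s2" by (rule B.vec_cube)
  interpret A31: vec_pair "cube_scale s1" s1 by (rule A.vec_pairs)
  interpret A13: vec_pair s1 "cube_scale s1" by (rule A.vec_pairs)
  interpret A33: vec_pair "cube_scale s1" "cube_scale s1" by (rule A.vec_pairs)
  interpret B13: vec_pair s2 "cube_scale s2" by (rule B.vec_pairs)
  interpret AB: vec_pair "cube_scale s1" "cube_scale s2" ..
  let ?C = "{t \<in> cube (ker (i - 1)). koszul1 X1 t = 0}"
  let ?W = "{w \<in> cube (V1 (i - 2)). koszul2 X2 (\<phi>3 w) = 0}"
  \<comment> \<open>The space \<open>?W\<close> is counted in two ways. Under \<open>koszul2\<close>
    its kernel is a copy of the component of degree i - 3 and its image is \<open>?C\<close>; under
    the cubed homomorphism its kernel is the cube of \<open>ker (i - 2)\<close> and its image a copy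
    of the socle. Eliminating \<open>?W\<close> and \<open>?C\<close> gives the formula.\<close>
  have 1: "A3.dim (cube (ker (i - 1))) = A3.dim ?C + A.mu ker i"
    using A31.rank_nullity[OF A.linear_koszul1 A.dim_cube(1)[OF fin_ker]] by (simp add: A.mu_def)
  have linc: "Vector_Spaces.linear (cube_scale s1) (cube_scale s2) (\<lambda>w. koszul2 X2 (\<phi>3 w))"
    using Vector_Spaces.linear_compose[OF linear_\<phi>3 B.linear_koszul2] by (simp add: o_def)
  have finW: "A3.fin_subspace ?W"
    by (rule A3.fin_subspace_subset[OF A.dim_cube(1)[OF A.fin_V]
          AB.subspace_kernel_on[OF linc A3.fin_subspace_subspace[OF A.dim_cube(1)[OF A.fin_V]]]]) auto
  have C: "?C = koszul2 X1 ` ?W"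
  proof (intro equalityI subsetI)
    fix t assume t: "t \<in> ?C"
    then have "t \<in> cube (V1 (i - 1))" "koszul1 X1 t = 0" by (auto simp: ker_def)
    then obtain u where u: "u \<in> cube (V1 (i - 1 - 1))" "t = koszul2 X1 u"
      by (rule A.koszul_exact1)
    have "\<phi>3 t = 0" using t by (auto simp: ker_def \<phi>3_def zero_prod_def)
    then have "koszul2 X2 (\<phi>3 u) = 0" using u \<phi>3_koszul2 by simp
    then show "t \<in> koszul2 X1 ` ?W" using u by auto
  next
    fix t assume "t \<in> koszul2 X1 ` ?W"
    then obtain w where w: "w \<in> cube (V1 (i - 1 - 1))" "koszul2 X2 (\<phi>3 w) = 0" "t = koszul2 X1 w"
      by auto
    have "t \<in> cube (V1 (i - 1))" using A.koszul2_V[OF w(1)] w(3) by simp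
    moreover have "\<phi>3 t = 0" using w \<phi>3_koszul2 by simp
    moreover have "koszul1 X1 t = 0" using w A.koszul12 by simp
    ultimately show "t \<in> ?C" by (auto simp: ker_def \<phi>3_def zero_prod_def)
  qed
  have 2: "A3.dim ?W = A3.dim {w \<in> ?W. koszul2 X1 w = 0} + A3.dim ?C"
    unfolding C by (rule A33.rank_nullity[OF A.linear_koszul2 finW])
  have "{w \<in> ?W. koszul2 X1 w = 0} = koszul3 X1 ` V1 (i - 3)"
  proof (intro equalityI subsetI)
    fix w assume "w \<in> {w \<in> ?W. koszul2 X1 w = 0}"
    then have "w \<in> cube (V1 (i - 2))" "koszul2 X1 w = 0" by auto
    then obtain m where "m \<in> V1 (i - 2 - 1)" "w = koszul3 X1 m" by (rule A.koszul_exact2)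
    then show "w \<in> koszul3 X1 ` V1 (i - 3)" by (auto simp: image_iff)
  next
    fix w assume "w \<in> koszul3 X1 ` V1 (i - 3)"
    then obtain m where m: "m \<in> V1 (i - 2 - 1)" "w = koszul3 X1 m" by auto
    then show "w \<in> {w \<in> ?W. koszul2 X1 w = 0}"
      using A.koszul3_V[OF m(1)] A.koszul23 B.koszul23 \<phi>3_koszul3 by simp
  qed
  then have 3: "A3.dim {w \<in> ?W. koszul2 X1 w = 0} = A.dim (V1 (i - 3))"
    using A13.dim_image_inj[OF A.linear_koszul3 A.fin_V A.koszul3_inj] by simp
  have 4: "A3.dim ?W = A3.dim {w \<in> ?W. \<phi>3 w = 0} + B3.dim (\<phi>3 ` ?W)"
    by (rule AB.rank_nullity[OF linear_\<phi>3 finW])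
  have "{w \<in> ?W. \<phi>3 w = 0} = cube (ker (i - 2))"
    using B.linear_koszul2
    by (auto simp: ker_def \<phi>3_def zero_prod_def koszul2_def B.X_0)
  then have 5: "A3.dim {w \<in> ?W. \<phi>3 w = 0} = 3 * A.dim (ker (i - 2))"
    using A.dim_cube(2)[OF fin_ker] by simp
  have "\<phi>3 ` ?W = koszul3 X2 ` B.socle im (i - 3)"
  proof (intro equalityI subsetI)
    fix t assume "t \<in> \<phi>3 ` ?W"
    then obtain w where w: "w \<in> cube (V1 (i - 2))" "koszul2 X2 (\<phi>3 w) = 0" "t = \<phi>3 w" by auto
    have "t \<in> cube (V2 (i - 2))" using w(1,3) \<phi>_V by (auto simp: \<phi>3_def)
    moreover have "koszul2 X2 t = 0" using w by simp
    ultimately obtain m where m: "m \<in> V2 (i - 2 - 1)" "t = koszul3 X2 m" by (rule B.koszul_exact2)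
    have "t \<in> cube (im (i - 2))" using w(1,3) by (auto simp: \<phi>3_def im_def)
    then have "X2 3 m \<in> im (i - 2)" "- X2 2 m \<in> im (i - 2)" "X2 1 m \<in> im (i - 2)"
      using m by (auto simp: koszul3_def)
    then have "\<forall>j. X2 j m \<in> im (i - 2)"
      using B.subspace_neg[OF B.fin_subspace_subspace[OF fin_im]]
      by (metis exhaust_3 minus_minus)
    then show "t \<in> koszul3 X2 ` B.socle im (i - 3)" using m by (auto simp: B.socle_def)
  next
    fix t assume "t \<in> koszul3 X2 ` B.socle im (i - 3)"
    then obtain m where m: "m \<in> V2 (i - 3)" "\<forall>j. X2 j m \<in> im (i - 2)" "t = koszul3 X2 m"
      by (auto simp: B.socle_def)
    have "- X2 2 m \<in> im (i - 2)"
      using B.subspace_neg[OF B.fin_subspace_subspace[OF fin_im]] m(2) by blast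
    then obtain q where q: "q \<in> V1 (i - 2)" "- X2 2 m = \<phi> q" by (auto simp: im_def)
    obtain p where p: "p \<in> V1 (i - 2)" "X2 3 m = \<phi> p"
      using m(2)[rule_format, of 3] by (auto simp: im_def)
    obtain r where r: "r \<in> V1 (i - 2)" "X2 1 m = \<phi> r"
      using m(2)[rule_format, of 1] by (auto simp: im_def)
    note w = p(1) q(1) r(1) p(2) q(2) r(2)
    then have "t = \<phi>3 (p, q, r)" using m(3) by (simp add: koszul3_def \<phi>3_def)
    moreover have "koszul2 X2 t = 0" using m(3) B.koszul23 by simp
    ultimately show "t \<in> \<phi>3 ` ?W" using w by auto
  qed
  moreover have "B.fin_subspace (B.socle im (i - 3))"
  proof (rule B.fin_subspace_subset[OF B.fin_V])
    show "B.subspace (B.socle im (i - 3))"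
      using B.V_subspace[of "i - 3"] B.fin_subspace_subspace[OF fin_im[of "i - 3 + 1"]]
      by (auto simp: B.socle_def B.subspace_def B.X_simps)
  qed (auto simp: B.socle_def)
  ultimately have 6: "B3.dim (\<phi>3 ` ?W) = B.dim (B.socle im (i - 3))"
    using B13.dim_image_inj[OF B.linear_koszul3 _ B.koszul3_inj] by simp
  have 7: "A3.dim (cube (ker (i - 1))) = 3 * A.dim (ker (i - 1))"
    using A.dim_cube(2)[OF fin_ker] .
  show ?thesis using 1 2 3 4 5 6 7 by linarith
qed

text \<open>Rank-nullity for the homomorphism on the multiples of the variables. The first summand
  is the part of the kernel that tensoring with k sends to 0.\<close>

lemma mu_V_im:
  "A.dim {v \<in> ker i. v \<in> koszul1 X1 ` cube (V1 (i - 1))} + B.mu im i = A.mu V1 i"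
proof -
  interpret A31: vec_pair "cube_scale s1" s1 by (rule A.vec_pairs)
  let ?M = "koszul1 X1 ` cube (V1 (i - 1))"
  have fin: "A.fin_subspace ?M"
    by (rule A31.fin_subspace_image[OF A.linear_koszul1 A.dim_cube(1)[OF A.fin_V]])
  have "{v \<in> ?M. \<phi> v = 0} = {v \<in> ker i. v \<in> ?M}"
    using A.koszul1_V[of _ i] unfolding ker_def by blast
  moreover have "\<phi> ` ?M = koszul1 X2 ` cube (im (i - 1))"
  proof -
    have "\<phi>3 ` cube (V1 (i - 1)) = cube (im (i - 1))"
      by (simp add: \<phi>3_def im_def map_prod_surj_on)
    then show ?thesis by (simp add: image_image \<phi>3_koszul1 flip: \<open>\<phi>3 ` cube (V1 (i - 1)) = cube (im (i - 1))\<close>)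
  qed
  ultimately show ?thesis
    using rank_nullity[OF linear_\<phi> fin] by (simp add: A.mu_def B.mu_def)
qed

text \<open>The variables act injectively on the target, so the quotient by the kernel, which embeds
  there, has no socle.\<close>

lemma socle_ker: "A.socle ker d = ker d"
proof -
  have "X1 j m \<in> ker (d + 1)" if "m \<in> ker d" for j m
    using that A.X_V \<phi>_X B.X_0 by (simp add: ker_def)
  moreover have "m \<in> ker d" if "m \<in> V1 d" "X1 1 m \<in> ker (d + 1)" for m
    using that B.X_inj[of 1 "\<phi> m"] by (simp add: ker_def \<phi>_X)
  ultimately show ?thesis by (auto simp: A.socle_def ker_def)
qed

end

text \<open>\<open>mu_ker\<close> for the zero map: its kernel is all of \<open>V\<close>, and its
  image has trivial socle.\<close>

lemma (in koszul) mu_V: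
  "int (mu V i) = 3 * int (dim (V (i - 1))) - 3 * int (dim (V (i - 2))) + int (dim (V (i - 3)))"
proof -
  interpret z: koszul_hom scale X D V scale X D V "\<lambda>_. 0"
    by unfold_locales (auto simp: Vector_Spaces.linear_iff vector_space_axioms X_0 V_closed)
  have ker: "z.ker = V" by (auto simp: z.ker_def fun_eq_iff)
  have "socle z.im (i - 3) = {0}"
  proof -
    have "z.im d = {0}" for d using V_closed(1)[of d] by (auto simp: z.im_def)
    then show ?thesis using X_inj[of 1] V_closed(1)[of "i - 3"] by (auto simp: socle_def X_0)
  qed
  then show ?thesis using z.mu_ker[of i] dim_0 by (simp add: ker)
qed

section \<open>The polynomial ring and its free modules as graded modules\<close>

abbreviation lk :: "('a \<Rightarrow>\<^sub>0 'b::zero) \<Rightarrow> 'a \<Rightarrow> 'b" where "lk \<equiv> Poly_Mapping.lookup"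

lemma mdeg_add: "mdeg (u + v) = mdeg u + mdeg v"
  by (simp add: mdeg_def sum.distrib)

lemma mdeg_axis [simp]: "mdeg (axis i n) = n"
  by (simp add: mdeg_def axis_def if_distrib sum.delta cong: if_cong)

lemma mdeg_0 [simp]: "mdeg 0 = 0"
  by (simp add: mdeg_def)

lemma mdeg_sum3: "mdeg m = m $ 1 + m $ 2 + m $ 3"
  by (simp add: mdeg_def sum_3)

lemma finite_mdeg: "finite {m. mdeg m = n}"
proof (rule finite_subset)
  show "{m. mdeg m = n} \<subseteq> (\<lambda>(a, b, c). vector [a, b, c]) ` ({..n} \<times> {..n} \<times> {..n})"
  proof
    fix m :: mon assume "m \<in> {m. mdeg m = n}"
    then have "(m $ 1, m $ 2, m $ 3) \<in> {..n} \<times> {..n} \<times> {..n}" by (auto simp: mdeg_sum3)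
    moreover have "m = (\<lambda>(a, b, c). vector [a, b, c]) (m $ 1, m $ 2, m $ 3)"
      by (simp add: vec_eq_iff forall_3)
    ultimately show "m \<in> (\<lambda>(a, b, c). vector [a, b, c]) ` ({..n} \<times> {..n} \<times> {..n})" by blast
  qed
qed auto

lemma sum_single_lookup: "f = (\<Sum>m\<in>Poly_Mapping.keys f. Poly_Mapping.single m (lk f m))"
  by (rule poly_mapping_eqI) (auto simp: lookup_sum lookup_single when_def in_keys_iff)

lemma lookup_single_mult:
  fixes f :: "'a::cancel_comm_monoid_add \<Rightarrow>\<^sub>0 'b::comm_ring_1"
  shows "lk (Poly_Mapping.single a c * f) k = (\<Sum>m\<in>Poly_Mapping.keys f. c * lk f m when a + m = k)"
proof -
  have "Poly_Mapping.single a c * f =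
      (\<Sum>m\<in>Poly_Mapping.keys f. Poly_Mapping.single (a + m) (c * lk f m))"
    by (subst (1) sum_single_lookup[of f]) (simp add: sum_distrib_left mult_single)
  then show ?thesis by (simp add: lookup_sum lookup_single)
qed

lemma lookup_single_mult_add [simp]:
  fixes f :: "'a::cancel_comm_monoid_add \<Rightarrow>\<^sub>0 'b::comm_ring_1"
  shows "lk (Poly_Mapping.single a c * f) (a + k) = c * lk f k"
  by (auto simp: lookup_single_mult when_def in_keys_iff)

lemma lookup_Const_mult [simp]: "lk (Const c * f) m = c * lk f m"
  for c :: "'k::comm_ring_1"
  using lookup_single_mult_add[of "0::mon" c f m] by (simp add: Const_def)

lemma lookup_Var_mult:
  fixes f :: "'k::comm_ring_1 mpoly3"
  shows "lk (Var i * f) m = (if m $ i = 0 then 0 else lk f (m - axis i 1))"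
proof (cases "m $ i = 0")
  case True
  then have "axis i 1 + m' \<noteq> m" for m' :: mon
    by (metis axis_nth add_is_0 vector_add_component zero_neq_one)
  then show ?thesis using True by (simp add: Var_def lookup_single_mult)
next
  case False
  then have "m = axis i 1 + (m - axis i 1)" by (auto simp: vec_eq_iff axis_def)
  then show ?thesis using False lookup_single_mult_add[of "axis i (1::nat)" "1::'k" f "m - axis i 1"]
    by (simp add: Var_def)
qed

lemma lookup_Var_mult_add [simp]:
  fixes f :: "'k::comm_ring_1 mpoly3"
  shows "lk (Var i * f) (m + axis i 1) = lk f m"
  using lookup_single_mult_add[of "axis i (1::nat)" "1::'k" f m] by (simp add: Var_def add.commute)

lemmas lookup_Var_mult_add' [simp] = lookup_Var_mult_add[unfolded One_nat_def]

lemma Const_add: "Const (a + b) = Const a + Const b"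
  by (simp add: Const_def single_add)

lemma Const_mult: "Const (a * b) = Const a * Const b" for a :: "'k::comm_ring_1"
  by (simp add: Const_def mult_single)

lemma Const_0 [simp]: "Const 0 = 0" and Const_1 [simp]: "Const 1 = 1"
  by (simp_all add: Const_def)

lemma lookup_mult_0:
  fixes f g :: "'k::comm_ring_1 mpoly3"
  shows "lk (f * g) 0 = lk f 0 * lk g 0"
proof -
  have "lk (Poly_Mapping.single m c * g) 0 = (if m = 0 then c * lk g 0 else 0)" for m :: mon and c
    using lookup_Const_mult[of c g 0]
    by (auto simp: Const_def) (auto simp: lookup_single_mult when_def vec_eq_iff intro!: sum.neutral)
  then have "lk (f * g) 0 = (\<Sum>m\<in>Poly_Mapping.keys f. if m = 0 then lk f m * lk g 0 else 0)"
    by (subst (1) sum_single_lookup[of f]) (simp add: sum_distrib_right lookup_sum)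
  then show ?thesis by (auto simp: in_keys_iff)
qed

text \<open>Integer degrees, with zero components in the negative ones, match the indexing in
  \<open>koszul\<close>.\<close>

definition rcomp :: "int \<Rightarrow> 'k::zero mpoly3 set"
  where "rcomp d = {f. \<forall>m. lk f m \<noteq> 0 \<longrightarrow> int (mdeg m) = d}"

lemma homogeneous_iff_rcomp: "homogeneous d f \<longleftrightarrow> f \<in> rcomp (int d)"
  by (auto simp: homogeneous_def rcomp_def in_keys_iff)

definition rpart :: "int \<Rightarrow> 'k::zero mpoly3 \<Rightarrow> 'k mpoly3"
  where "rpart d f = Poly_Mapping.mapp (\<lambda>m c. c when int (mdeg m) = d) f"

lemma lookup_rpart [simp]: "lk (rpart d f) m = (lk f m when int (mdeg m) = d)"
  by (simp add: rpart_def lookup_mapp when_def in_keys_iff)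

definition divide_Var :: "3 \<Rightarrow> 'k::zero mpoly3 \<Rightarrow> 'k mpoly3"
  where "divide_Var i f = Poly_Mapping.map_key (\<lambda>m. m + axis i 1) f"

lemma lookup_divide_Var [simp]: "lk (divide_Var i f) m = lk f (m + axis i 1)"
  unfolding divide_Var_def by (subst map_key.rep_eq) (simp_all add: inj_def)

lemma divide_Var_0 [simp]: "divide_Var i 0 = 0"
  by (rule poly_mapping_eqI) simp

definition rscale :: "'k::comm_ring_1 \<Rightarrow> 'k mpoly3 \<Rightarrow> 'k mpoly3"
  where "rscale c f = Const c * f"

lemma lookup_rscale [simp]: "lk (rscale c f) m = c * lk f m"
  by (simp add: rscale_def)

lemma rscale_single: "rscale c (Poly_Mapping.single m d) = Poly_Mapping.single m (c * d)"
  by (simp add: rscale_def Const_def mult_single)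

lemma rcomp_mult: "f \<in> rcomp d \<Longrightarrow> g \<in> rcomp e \<Longrightarrow> f * g \<in> rcomp (d + e)"
  for f g :: "'k::comm_ring_1 mpoly3"
proof -
  assume f: "f \<in> rcomp d" and g: "g \<in> rcomp e"
  have "int (mdeg m) = d + e" if m: "lk (f * g) m \<noteq> 0" for m
  proof -
    obtain a b where "m = a + b" "a \<in> Poly_Mapping.keys f" "b \<in> Poly_Mapping.keys g"
      using m keys_mult[of f g] by (auto simp: in_keys_iff[symmetric])
    then show ?thesis using f g by (auto simp: rcomp_def in_keys_iff mdeg_add)
  qed
  then show ?thesis by (simp add: rcomp_def)
qed

lemma Var_rcomp: "Var i \<in> rcomp 1"
  by (auto simp: rcomp_def Var_def lookup_single when_def split: if_splits)

global_interpretation rvec: vec "rscale :: 'k::field \<Rightarrow> 'k mpoly3 \<Rightarrow> 'k mpoly3"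
  by (intro vec.intro vector_space.intro; rule poly_mapping_eqI;
      simp only: lookup_rscale lookup_add distrib_left distrib_right mult.assoc mult_1_left)

lemma subspace_rcomp: "rvec.subspace (rcomp d)"
  by (auto simp: rvec.subspace_def rcomp_def lookup_add) (metis add_0)

lemma fin_rcomp: "rvec.fin_subspace (rcomp d)"
proof (rule rvec.fin_subspaceI[OF subspace_rcomp])
  let ?B = "(\<lambda>m. Poly_Mapping.single m (1::'a)) ` {m. mdeg m = nat d}"
  show "finite ?B" using finite_mdeg by auto
  show "rcomp d \<subseteq> rvec.span ?B"
  proof
    fix f :: "'a mpoly3" assume f: "f \<in> rcomp d"
    have "(\<Sum>m\<in>Poly_Mapping.keys f. rscale (lk f m) (Poly_Mapping.single m 1)) \<in> rvec.span ?B"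
    proof (intro rvec.span_sum rvec.span_scale rvec.span_base imageI)
      fix m assume "m \<in> Poly_Mapping.keys f"
      then show "m \<in> {m. mdeg m = nat d}" using f by (auto simp: rcomp_def in_keys_iff)
    qed
    also have "(\<Sum>m\<in>Poly_Mapping.keys f. rscale (lk f m) (Poly_Mapping.single m 1)) =
        (\<Sum>m\<in>Poly_Mapping.keys f. Poly_Mapping.single m (lk f m))"
      by (simp add: rscale_single)
    also have "\<dots> = f" by (rule sum_single_lookup[symmetric])
    finally show "f \<in> rvec.span ?B" .
  qed
qed

global_interpretation R: koszul rscale "\<lambda>i f. Var i * f" divide_Var "rcomp :: int \<Rightarrow> 'k::field mpoly3 set"
proof (intro koszul.intro koszul_axioms.intro)
  show "vec (rscale :: 'k \<Rightarrow> 'k mpoly3 \<Rightarrow> _)" by (rule rvec.vec_axioms)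
  fix i j :: 3 and v :: "'k mpoly3" and d
  show "Vector_Spaces.linear rscale rscale (\<lambda>f::'k mpoly3. Var i * f)"
    unfolding Vector_Spaces.linear_iff
    by (auto simp: rscale_def distrib_left mult.left_commute intro: rvec.vector_space_axioms)
  show "Vector_Spaces.linear rscale rscale (divide_Var i :: 'k mpoly3 \<Rightarrow> _)"
    unfolding Vector_Spaces.linear_iff
    by (auto simp: lookup_add intro!: poly_mapping_eqI rvec.vector_space_axioms)
  show "divide_Var i (Var i * v) = v" by (rule poly_mapping_eqI) simp
  show "divide_Var i (Var j * v) = Var j * divide_Var i v" if "i \<noteq> j"
  proof (rule poly_mapping_eqI)
    fix m :: mon
    have "(m + axis i 1) $ j = m $ j" using that by (simp add: axis_def)
    moreover have "m + axis i 1 - axis j 1 = m - axis j 1 + axis i 1" if "m $ j \<noteq> 0"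
      using that by (auto simp: vec_eq_iff axis_def)
    ultimately show "lk (divide_Var i (Var j * v)) m = lk (Var j * divide_Var i v) m"
      by (simp add: lookup_Var_mult)
  qed
  show "Var i * (Var j * v) = Var j * (Var i * v)" by (rule mult.left_commute)
  show "rvec.fin_subspace (rcomp d)" by (rule fin_rcomp)
  show "Var i * v \<in> rcomp (d + 1)" if "v \<in> rcomp d"
    using rcomp_mult[OF Var_rcomp that] by (simp add: add.commute)
  show "divide_Var i v \<in> rcomp (d - 1)" if "v \<in> rcomp d"
    using that by (auto simp: rcomp_def mdeg_add)
qed

text \<open>The common source of \<open>lin_poly\<close>, where the ring acts on itself, and
  \<open>lin_free\<close>, where it acts on families of coefficients.\<close>

locale rmodule = module act for act :: "'a::comm_ring_1 \<Rightarrow> 'v::ab_group_add \<Rightarrow> 'v"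
begin

definition lin :: "('i \<Rightarrow> 'v) \<Rightarrow> ('i \<Rightarrow>\<^sub>0 'a) \<Rightarrow> 'v"
  where "lin E v = (\<Sum>b\<in>Poly_Mapping.keys v. act (lk v b) (E b))"

lemma lin_superset: "finite A \<Longrightarrow> Poly_Mapping.keys v \<subseteq> A \<Longrightarrow> lin E v = (\<Sum>b\<in>A. act (lk v b) (E b))"
  unfolding lin_def by (intro sum.mono_neutral_left) (auto simp: in_keys_iff)

lemma lin_add: "lin E (v + w) = lin E v + lin E w"
proof -
  let ?A = "Poly_Mapping.keys v \<union> Poly_Mapping.keys w"
  have "lin E (v + w) = (\<Sum>b\<in>?A. act (lk (v + w) b) (E b))"
    by (intro lin_superset keys_add) auto
  also have "\<dots> = (\<Sum>b\<in>?A. act (lk v b) (E b)) + (\<Sum>b\<in>?A. act (lk w b) (E b))"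
    by (simp add: lookup_add scale_left_distrib sum.distrib)
  also have "\<dots> = lin E v + lin E w"
    by (intro arg_cong2[where f = "(+)"] lin_superset[symmetric]) auto
  finally show ?thesis .
qed

lemma lin_smul: "lin E (smul c v) = act c (lin E v)"
proof -
  have "lin E (smul c v) = (\<Sum>b\<in>Poly_Mapping.keys v. act (lk (smul c v) b) (E b))"
    by (intro lin_superset) (auto simp: in_keys_iff lookup_smul)
  then show ?thesis by (simp add: lookup_smul lin_def scale_sum_right)
qed

lemma lin_0: "lin E 0 = 0"
  by (simp add: lin_def)

lemma lin_single: "lin E (Poly_Mapping.single b c) = act c (E b)"
  by (cases "c = 0") (auto simp: lin_def)

end

lemma rmodule_mult: "rmodule ((*) :: 'a::comm_ring_1 \<Rightarrow> 'a \<Rightarrow> 'a)"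
  unfolding rmodule_def by (rule ideal.module_axioms)

lemma rmodule_smul: "rmodule (smul :: 'a::comm_ring_1 \<Rightarrow> ('i \<Rightarrow>\<^sub>0 'a) \<Rightarrow> _)"
  unfolding rmodule_def
  by (intro module.intro; rule poly_mapping_eqI;
      simp only: lookup_smul lookup_add distrib_left distrib_right mult.assoc mult_1_left)

text \<open>\<open>W\<close> is the whole module, \<open>V d\<close> its component of degree \<open>d\<close> and \<open>part d\<close> the projection to it.\<close>

locale graded_module = md: rmodule act + koszul "\<lambda>c. act (Const c)" "\<lambda>i. act (Var i)" D V
  for act :: "'k::field mpoly3 \<Rightarrow> 'v::ab_group_add \<Rightarrow> 'v" and D V +
  fixes W :: "'v set" and part :: "int \<Rightarrow> 'v \<Rightarrow> 'v"
  assumes W_add: "v \<in> W \<Longrightarrow> w \<in> W \<Longrightarrow> v + w \<in> W"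
    and W_act: "v \<in> W \<Longrightarrow> act f v \<in> W"
    and V_W: "v \<in> V d \<Longrightarrow> v \<in> W"
    and act_V: "f \<in> rcomp i \<Longrightarrow> v \<in> V j \<Longrightarrow> act f v \<in> V (i + j)"
    and part_add: "part d (v + w) = part d v + part d w"
    and part_V: "v \<in> W \<Longrightarrow> part d v \<in> V d"
    and part_id: "v \<in> V d \<Longrightarrow> part d v = v"
    and part_act: "v \<in> V j \<Longrightarrow> part d (act f v) = act (rpart (d - j) f) v"
    and part_sum: "v \<in> W \<Longrightarrow> \<exists>A. finite A \<and> v = (\<Sum>d\<in>A. part d v)"
begin

lemma part_0: "part d 0 = 0"
  using part_add[of d 0 0] by simp

lemma part_sum_distrib: "part d (sum f A) = (\<Sum>x\<in>A. part d (f x))"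
  by (induction A rule: infinite_finite_induct) (auto simp: part_0 part_add)

end

lemma rpart_V: "rpart d f \<in> rcomp d"
  by (auto simp: rcomp_def)

lemma rpart_add: "rpart d (f + g) = rpart d f + rpart d g" for f g :: "'k::comm_ring_1 mpoly3"
  by (rule poly_mapping_eqI) (simp add: lookup_add when_add_distrib)

lemma rpart_id: "f \<in> rcomp d \<Longrightarrow> rpart d f = f"
  by (rule poly_mapping_eqI) (auto simp: rcomp_def when_def)

lemma rpart_other: "f \<in> rcomp e \<Longrightarrow> d \<noteq> e \<Longrightarrow> rpart d f = 0"
  by (rule poly_mapping_eqI) (auto simp: rcomp_def when_def)

lemma rpart_sum_eq:
  fixes f :: "'k::comm_ring_1 mpoly3"
  assumes "finite A" "(\<lambda>m. int (mdeg m)) ` Poly_Mapping.keys f \<subseteq> A"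
  shows "(\<Sum>d\<in>A. rpart d f) = f"
  using assms by (intro poly_mapping_eqI) (auto simp: lookup_sum when_def in_keys_iff image_subset_iff)

lemma rpart_sum_distrib: "rpart d (sum f A) = (\<Sum>x\<in>A. rpart d (f x))" for f :: "'x \<Rightarrow> 'k::comm_ring_1 mpoly3"
proof (induction A rule: infinite_finite_induct)
  case (insert x F) then show ?case by (simp add: rpart_add)
qed (auto intro!: poly_mapping_eqI)

lemma rpart_mult:
  fixes f g :: "'k::comm_ring_1 mpoly3"
  assumes g: "g \<in> rcomp j"
  shows "rpart d (f * g) = rpart (d - j) f * g"
proof -
  \<comment> \<open>The degree d - j is added by hand, so that the final sum has a term to pick even
    if \<open>f\<close> has none in that degree.\<close>
  let ?A = "insert (d - j) ((\<lambda>m. int (mdeg m)) ` Poly_Mapping.keys f)"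
  have "rpart d (f * g) = rpart d ((\<Sum>e\<in>?A. rpart e f) * g)"
    by (subst rpart_sum_eq) auto
  also have "\<dots> = (\<Sum>e\<in>?A. rpart d (rpart e f * g))"
    by (simp add: sum_distrib_right rpart_sum_distrib del: sum.insert)
  also have "\<dots> = (\<Sum>e\<in>?A. if e = d - j then rpart e f * g else 0)"
  proof (intro sum.cong refl)
    fix e
    have "rpart e f * g \<in> rcomp (e + j)" by (intro rcomp_mult rpart_V g)
    then show "rpart d (rpart e f * g) = (if e = d - j then rpart e f * g else 0)"
      using rpart_id rpart_other by (cases "e = d - j") fastforce+
  qed
  also have "\<dots> = rpart (d - j) f * g" by (subst sum.delta) auto
  finally show ?thesis .
qed

global_interpretation RG: graded_module "(*) :: 'k::field mpoly3 \<Rightarrow> 'k mpoly3 \<Rightarrow> 'k mpoly3" divide_Var rcomp UNIV rpart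
proof -
  interpret m: rmodule "(*) :: 'k mpoly3 \<Rightarrow> 'k mpoly3 \<Rightarrow> 'k mpoly3" by (rule rmodule_mult)
  interpret k: koszul "\<lambda>c. (*) (Const c)" "\<lambda>i. (*) (Var i)" divide_Var "rcomp :: int \<Rightarrow> 'k mpoly3 set"
    using R.koszul_axioms unfolding rscale_def .
  show "graded_module ((*) :: 'k mpoly3 \<Rightarrow> 'k mpoly3 \<Rightarrow> 'k mpoly3) divide_Var rcomp UNIV rpart"
  proof unfold_locales
    fix v w :: "'k mpoly3" and d j
    show "\<exists>A. finite A \<and> v = (\<Sum>d\<in>A. rpart d v)"
      by (rule exI[of _ "(\<lambda>m. int (mdeg m)) ` Poly_Mapping.keys v"]) (auto simp: rpart_sum_eq)
  qed (simp_all add: rcomp_mult rpart_add rpart_V rpart_id rpart_mult)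
qed

section \<open>Graded free modules\<close>

definition fcomp :: "(nat \<Rightarrow> nat) \<Rightarrow> int \<Rightarrow> 'k::field free_elem set"
  where "fcomp r d = {v. \<forall>j a. (lk v (j, a) \<noteq> 0 \<longrightarrow> a < r j) \<and> lk v (j, a) \<in> rcomp (d - int j)}"

lemma free_module_iff: "v \<in> free_module r \<longleftrightarrow> (\<forall>j a. lk v (j, a) \<noteq> 0 \<longrightarrow> a < r j)"
  by (auto simp: free_module_def in_keys_iff)

lemma free_component_eq: "free_component r d = fcomp r (int d)"
proof (intro set_eqI iffI)
  fix v :: "'a free_elem"
  assume "v \<in> free_component r d"
  then have v: "v \<in> free_module r"
    and deg: "\<And>j a m. (j, a) \<in> Poly_Mapping.keys v \<Longrightarrow> m \<in> Poly_Mapping.keys (lk v (j, a)) \<Longrightarrow> j + mdeg m = d"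
    unfolding free_component_def by blast+
  have "int (mdeg m) = int d - int j" if "lk (lk v (j, a)) m \<noteq> 0" for j a m
  proof -
    have "lk v (j, a) \<noteq> 0" using that by auto
    then have "j + mdeg m = d" using deg that by (simp add: in_keys_iff)
    then show ?thesis by linarith
  qed
  then show "v \<in> fcomp r (int d)" using v by (simp add: fcomp_def free_module_iff rcomp_def)
next
  fix v :: "'a free_elem"
  assume v: "v \<in> fcomp r (int d)"
  have "j + mdeg m = d" if "lk (lk v (j, a)) m \<noteq> 0" for j a m
  proof -
    have "int (mdeg m) = int d - int j" using v that by (simp add: fcomp_def rcomp_def)
    then show ?thesis by linarith
  qed
  then show "v \<in> free_component r d"
    using v by (auto simp: fcomp_def free_component_def free_module_iff in_keys_iff)
qed

lemma fcomp_free_module: "v \<in> fcomp r d \<Longrightarrow> v \<in> free_module r"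
  by (auto simp: fcomp_def free_module_iff)

definition fpart :: "int \<Rightarrow> 'k::field free_elem \<Rightarrow> 'k free_elem"
  where "fpart d v = Poly_Mapping.mapp (\<lambda>b. rpart (d - int (fst b))) v"

lemma rpart_0 [simp]: "rpart d 0 = 0"
  by (rule poly_mapping_eqI) simp

lemma lookup_fpart [simp]: "lk (fpart d v) b = rpart (d - int (fst b)) (lk v b)"
  by (auto simp: fpart_def lookup_mapp when_def in_keys_iff)

definition fdivide :: "3 \<Rightarrow> 'k::field free_elem \<Rightarrow> 'k free_elem"
  where "fdivide i v = Poly_Mapping.map (divide_Var i) v"

lemma lookup_fdivide [simp]: "lk (fdivide i v) b = divide_Var i (lk v b)"
  using R.D_0 by (auto simp: fdivide_def Poly_Mapping.map.rep_eq when_def)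

abbreviation fscale :: "'k::field \<Rightarrow> 'k free_elem \<Rightarrow> 'k free_elem"
  where "fscale c \<equiv> smul (Const c)"

global_interpretation fvec: vec "fscale :: 'k::field \<Rightarrow> _"
  by (intro vec.intro vector_space.intro; rule poly_mapping_eqI;
      simp only: lookup_smul lookup_add Const_add Const_mult Const_1 distrib_left distrib_right mult.assoc mult_1_left)

lemma smul_single: "smul c (Poly_Mapping.single b d) = Poly_Mapping.single b (c * d)"
  by (rule poly_mapping_eqI) (simp add: lookup_smul lookup_single when_def)

lemma subspace_fcomp: "fvec.subspace (fcomp r d)"
  unfolding fvec.subspace_def
proof (intro conjI allI ballI)
  show "0 \<in> fcomp r d" using rvec.subspace_0[OF subspace_rcomp] by (auto simp: fcomp_def)
  show "v + w \<in> fcomp r d" if "v \<in> fcomp r d" "w \<in> fcomp r d" for v w :: "'a free_elem"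
  proof -
    have "lk v b \<noteq> 0 \<or> lk w b \<noteq> 0" if "lk v b + lk w b \<noteq> 0" for b using that by auto
    then show ?thesis
      using that rvec.subspace_add[OF subspace_rcomp]
      unfolding fcomp_def mem_Collect_eq lookup_add by blast
  qed
  show "fscale c v \<in> fcomp r d" if "v \<in> fcomp r d" for c and v :: "'a free_elem"
  proof -
    have "lk v b \<noteq> 0" if "Const c * lk v b \<noteq> 0" for b using that by auto
    moreover have "Const c * lk v (j, a) \<in> rcomp (d - int j)" for j a
      using that rvec.subspace_scale[OF subspace_rcomp, of "lk v (j, a)" _ c]
      by (simp add: fcomp_def rscale_def)
    ultimately show ?thesis using that unfolding fcomp_def mem_Collect_eq lookup_smul by blast
  qed
qed

lemma fin_fcomp: "fvec.fin_subspace (fcomp r d :: 'k::field free_elem set)"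
proof (rule fvec.fin_subspaceI[OF subspace_fcomp])
  let ?A = "SIGMA j:{..nat d}. {..<r j} \<times> {m. mdeg m \<le> nat d}"
  let ?B = "(\<lambda>(j, a, m). Poly_Mapping.single (j, a) (Poly_Mapping.single m (1::'k))) ` ?A"
  have "{m. mdeg m \<le> nat d} = (\<Union>n\<le>nat d. {m. mdeg m = n})" by auto
  then have "finite {m. mdeg m \<le> nat d}" using finite_mdeg by simp
  then show "finite ?B" by auto
  show "fcomp r d \<subseteq> fvec.span ?B"
  proof
    fix v :: "'k free_elem" assume v: "v \<in> fcomp r d"
    have "(\<Sum>b\<in>Poly_Mapping.keys v. \<Sum>m\<in>Poly_Mapping.keys (lk v b).
        fscale (lk (lk v b) m) (Poly_Mapping.single b (Poly_Mapping.single m 1))) \<in> fvec.span ?B"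
    proof (intro fvec.span_sum fvec.span_scale fvec.span_base)
      fix b m assume bm: "b \<in> Poly_Mapping.keys v" "m \<in> Poly_Mapping.keys (lk v b)"
      obtain j a where b: "b = (j, a)" by fastforce
      have "a < r j" "int (mdeg m) = d - int j"
        using v bm by (auto simp: b fcomp_def rcomp_def in_keys_iff)
      then have "(j, a, m) \<in> ?A" by auto
      then show "Poly_Mapping.single b (Poly_Mapping.single m 1) \<in> ?B"
        unfolding b by (intro image_eqI[where x = "(j, a, m)"]) auto
    qed
    also have "(\<Sum>b\<in>Poly_Mapping.keys v. \<Sum>m\<in>Poly_Mapping.keys (lk v b).
        fscale (lk (lk v b) m) (Poly_Mapping.single b (Poly_Mapping.single m 1))) =
        (\<Sum>b\<in>Poly_Mapping.keys v. Poly_Mapping.single b (lk v b))"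
    proof (intro sum.cong refl)
      fix b
      have "(\<Sum>m\<in>Poly_Mapping.keys (lk v b).
        fscale (lk (lk v b) m) (Poly_Mapping.single b (Poly_Mapping.single m 1))) =
        (\<Sum>m\<in>Poly_Mapping.keys (lk v b). Poly_Mapping.single b (Poly_Mapping.single m (lk (lk v b) m)))"
        by (simp add: smul_single Const_def mult_single)
      also have "\<dots> = Poly_Mapping.single b (\<Sum>m\<in>Poly_Mapping.keys (lk v b). Poly_Mapping.single m (lk (lk v b) m))"
        by (induction rule: infinite_finite_induct) (auto simp: single_add)
      finally show "(\<Sum>m\<in>Poly_Mapping.keys (lk v b).
        fscale (lk (lk v b) m) (Poly_Mapping.single b (Poly_Mapping.single m 1))) = Poly_Mapping.single b (lk v b)"
        by (simp only: sum_single_lookup[of "lk v b", symmetric])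
    qed
    also have "\<dots> = v" by (rule sum_single_lookup[symmetric])
    finally show "v \<in> fvec.span ?B" .
  qed
qed

global_interpretation F: graded_module "smul :: 'k::field mpoly3 \<Rightarrow> 'k free_elem \<Rightarrow> _" fdivide
  "fcomp r" "free_module r" fpart for r
proof -
  interpret m: rmodule "smul :: 'k mpoly3 \<Rightarrow> 'k free_elem \<Rightarrow> _" by (rule rmodule_smul)
  show "graded_module (smul :: 'k::field mpoly3 \<Rightarrow> 'k free_elem \<Rightarrow> _) fdivide (fcomp r) (free_module r) fpart"
  proof (intro graded_module.intro koszul.intro koszul_axioms.intro graded_module_axioms.intro)
    show "rmodule (smul :: 'k mpoly3 \<Rightarrow> 'k free_elem \<Rightarrow> _)" by (rule rmodule_smul)
    show "vec (fscale :: 'k \<Rightarrow> 'k free_elem \<Rightarrow> _)" by (rule fvec.vec_axioms)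
    fix i j :: 3 and v w :: "'k free_elem" and d e
    show "Vector_Spaces.linear fscale fscale (smul (Var i :: 'k mpoly3) :: 'k free_elem \<Rightarrow> _)"
      unfolding Vector_Spaces.linear_iff
      by (auto intro!: poly_mapping_eqI fvec.vector_space_axioms
          simp: lookup_smul lookup_add distrib_left mult_ac)
    show "Vector_Spaces.linear fscale fscale (fdivide i :: 'k free_elem \<Rightarrow> _)"
      unfolding Vector_Spaces.linear_iff
      by (auto intro!: poly_mapping_eqI fvec.vector_space_axioms simp: lookup_smul lookup_add)
    show "fdivide i (smul (Var i) v) = v"
      by (rule poly_mapping_eqI) (simp add: lookup_smul R.D_X_same)
    show "fdivide i (smul (Var j) v) = smul (Var j) (fdivide i v)" if "i \<noteq> j"
      using that by (intro poly_mapping_eqI) (simp add: lookup_smul R.D_X)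
    show "smul (Var i) (smul (Var j) v) = smul (Var j) (smul (Var i) v)"
      by (rule poly_mapping_eqI) (simp add: lookup_smul R.X_commute)
    show "fvec.fin_subspace (fcomp r d :: 'k free_elem set)" by (rule fin_fcomp)
    show act: "smul f v \<in> fcomp r (d + e)" if "f \<in> rcomp d" "v \<in> fcomp r e" for f d e
    proof -
      have "f * lk v (j, a) \<in> rcomp (d + e - int j)" for j a
        using rcomp_mult[OF that(1), of "lk v (j, a)" "e - int j"] that(2)
        by (simp add: fcomp_def add_diff_eq)
      moreover have "lk v b \<noteq> 0" if "f * lk v b \<noteq> 0" for b using that by auto
      ultimately show ?thesis using that(2) unfolding fcomp_def mem_Collect_eq lookup_smul by blast
    qed
    show "smul (Var i) v \<in> fcomp r (d + 1)" if "v \<in> fcomp r d"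
      using act[OF Var_rcomp that] by (simp add: add.commute)
    show "fdivide i v \<in> fcomp r (d - 1)" if "v \<in> fcomp r d"
    proof -
      have "divide_Var i (lk v (j, a)) \<in> rcomp (d - 1 - int j)" for j a
        using R.D_V[of "lk v (j, a)" "d - int j" i] that
        by (simp add: fcomp_def algebra_simps)
      moreover have "lk v b \<noteq> 0" if "divide_Var i (lk v b) \<noteq> 0" for b
        using that by auto
      ultimately show ?thesis using that unfolding fcomp_def mem_Collect_eq lookup_fdivide by blast
    qed
    show "v + w \<in> free_module r" if "v \<in> free_module r" "w \<in> free_module r"
    proof -
      have "lk v b \<noteq> 0 \<or> lk w b \<noteq> 0" if "lk v b + lk w b \<noteq> 0" for b using that by auto
      then show ?thesis using that unfolding free_module_iff lookup_add by blast
    qed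
    show "smul f v \<in> free_module r" if "v \<in> free_module r" for f
    proof -
      have "lk v b \<noteq> 0" if "f * lk v b \<noteq> 0" for b using that by auto
      then show ?thesis using that unfolding free_module_iff lookup_smul by blast
    qed
    show "v \<in> free_module r" if "v \<in> fcomp r d" using fcomp_free_module[OF that] .
    show "fpart d (v + w) = fpart d v + fpart d w"
      by (rule poly_mapping_eqI) (simp add: lookup_add rpart_add)
    show "fpart d v \<in> fcomp r d" if "v \<in> free_module r"
    proof -
      have "lk v b \<noteq> 0" if "rpart e (lk v b) \<noteq> 0" for b e using that by auto
      then show ?thesis using that by (simp add: free_module_iff fcomp_def rpart_V)
    qed
    show "fpart d v = v" if "v \<in> fcomp r d"
    proof (rule poly_mapping_eqI)
      fix b
      show "lk (fpart d v) b = lk v b"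
        using that rpart_id[of "lk v b" "d - int (fst b)"] by (cases b) (simp add: fcomp_def)
    qed
    show "fpart d (smul f v) = smul (rpart (d - e) f) v" if "v \<in> fcomp r e" for d f
    proof (rule poly_mapping_eqI)
      fix b
      have "lk v b \<in> rcomp (e - int (fst b))" using that by (cases b) (simp add: fcomp_def)
      from rpart_mult[OF this, of "d - int (fst b)" f]
      show "lk (fpart d (smul f v)) b = lk (smul (rpart (d - e) f) v) b"
        by (simp add: lookup_smul)
    qed
    show "\<exists>A. finite A \<and> v = (\<Sum>d\<in>A. fpart d v)" if "v \<in> free_module r"
    proof -
      let ?A = "\<Union>b\<in>Poly_Mapping.keys v. (\<lambda>m. int (mdeg m) + int (fst b)) ` Poly_Mapping.keys (lk v b)"
      have "v = (\<Sum>d\<in>?A. fpart d v)"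
      proof (rule poly_mapping_eqI)
        fix b
        show "lk v b = lk (\<Sum>d\<in>?A. fpart d v) b"
        proof (cases "b \<in> Poly_Mapping.keys v")
          case True
          have "(\<Sum>d\<in>?A. rpart (d - int (fst b)) (lk v b)) =
              (\<Sum>d\<in>(\<lambda>d. d - int (fst b)) ` ?A. rpart d (lk v b))"
            by (subst sum.reindex) (auto simp: inj_on_def)
          also have "\<dots> = lk v b"
            by (rule rpart_sum_eq) (use True in \<open>force simp: image_image\<close>)+
          finally show ?thesis by (simp add: lookup_sum)
        next
          case False then show ?thesis by (simp add: lookup_sum in_keys_iff)
        qed
      qed
      moreover have "finite ?A" by auto
      ultimately show ?thesis by blast
    qed
  qed
qed

section \<open>Betti numbers as dimensions of graded pieces of the ideal\<close>

lemma lin_poly_eq: "lin_poly E = rmodule.lin (*) E"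
  by (simp add: fun_eq_iff lin_poly_def RG.md.lin_def)

lemma lin_free_eq: "lin_free E = rmodule.lin smul E"
  by (simp add: fun_eq_iff lin_free_def F.md.lin_def)

context graded_module
begin

lemma sum_V: "(\<And>x. x \<in> A \<Longrightarrow> f x \<in> V d) \<Longrightarrow> sum f A \<in> V d"
  by (induction A rule: infinite_finite_induct) (auto simp: V_closed)

lemma lin_V:
  assumes E: "\<And>j a. a < r j \<Longrightarrow> E (j, a) \<in> V (int j)" and v: "v \<in> fcomp r d"
  shows "md.lin E v \<in> V d"
  unfolding md.lin_def
proof (rule sum_V)
  fix b assume "b \<in> Poly_Mapping.keys v"
  moreover obtain j a where b: "b = (j, a)" by fastforce
  ultimately have "a < r j" "lk v b \<in> rcomp (d - int j)" using v by (auto simp: fcomp_def in_keys_iff)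
  then show "act (lk v b) (E b) \<in> V d"
    using act_V[of "lk v b" "d - int j" "E b" "int j"] E[of a j] b by simp
qed

lemma koszul_hom_lin:
  assumes E: "\<And>j a. a < r j \<Longrightarrow> E (j, a) \<in> V (int j)"
  shows "koszul_hom fscale (\<lambda>i. smul (Var i)) fdivide (fcomp r)
    (\<lambda>c. act (Const c)) (\<lambda>i. act (Var i)) D V (md.lin E)"
proof (intro koszul_hom.intro koszul_hom_axioms.intro)
  show "koszul fscale (\<lambda>i. smul (Var i)) fdivide (fcomp r)" by (rule F.koszul_axioms)
  show "koszul (\<lambda>c. act (Const c)) (\<lambda>i. act (Var i)) D V" by (rule koszul_axioms)
  show "Vector_Spaces.linear fscale (\<lambda>c. act (Const c)) (md.lin E)"
    unfolding Vector_Spaces.linear_iff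
    using fvec.vector_space_axioms vector_space_axioms by (auto simp: md.lin_add md.lin_smul)
  show "md.lin E (smul (Var i) v) = act (Var i) (md.lin E v)" for i v by (rule md.lin_smul)
  show "md.lin E v \<in> V d" if "v \<in> fcomp r d" for v d using lin_V[OF E that] .
qed

lemma part_lin:
  assumes E: "\<And>j a. a < r j \<Longrightarrow> E (j, a) \<in> V (int j)" and v: "v \<in> free_module r"
  shows "part d (md.lin E v) = md.lin E (fpart d v)"
proof -
  have "part d (md.lin E v) = (\<Sum>b\<in>Poly_Mapping.keys v. part d (act (lk v b) (E b)))"
    by (simp add: md.lin_def part_sum_distrib)
  also have "\<dots> = (\<Sum>b\<in>Poly_Mapping.keys v. act (lk (fpart d v) b) (E b))"
  proof (intro sum.cong refl)
    fix b assume "b \<in> Poly_Mapping.keys v"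
    moreover obtain j a where b: "b = (j, a)" by fastforce
    ultimately have "a < r j" using v by (auto simp: free_module_iff in_keys_iff)
    then show "part d (act (lk v b) (E b)) = act (lk (fpart d v) b) (E b)"
      using part_act[of "E b" "int j"] E b by simp
  qed
  also have "\<dots> = md.lin E (fpart d v)"
    by (intro md.lin_superset[symmetric]) (auto simp: in_keys_iff)
  finally show ?thesis .
qed

text \<open>Exactness of a resolution is stated for whole modules. Projecting a preimage to degree
  \<open>d\<close> transfers it to the graded pieces.\<close>

lemma lin_image_V:
  assumes E: "\<And>j a. a < r j \<Longrightarrow> E (j, a) \<in> V (int j)"
  shows "md.lin E ` free_module r \<inter> V d = md.lin E ` fcomp r d"
proof (intro equalityI subsetI)
  fix y assume "y \<in> md.lin E ` free_module r \<inter> V d"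
  then obtain v where v: "v \<in> free_module r" "y = md.lin E v" "y \<in> V d" by auto
  then have "y = md.lin E (fpart d v)" using part_lin[where E = E and r = r, OF E v(1)] part_id by metis
  then show "y \<in> md.lin E ` fcomp r d" using F.part_V[OF v(1)] by blast
next
  fix y assume "y \<in> md.lin E ` fcomp r d"
  then show "y \<in> md.lin E ` free_module r \<inter> V d" using lin_V[OF E] fcomp_free_module by blast
qed

end

section \<open>Tensoring free modules with the residue field\<close>

lemma lookup_reduce [simp]: "lk (reduce i v) a = lk (lk v (i, a)) 0"
  unfolding reduce_def
  by (subst map_key.rep_eq) (auto simp: inj_def Poly_Mapping.map.rep_eq when_def)

global_interpretation nvec: vec "smul :: 'k::field \<Rightarrow> ('i \<Rightarrow>\<^sub>0 'k) \<Rightarrow> _" ..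

lemma tensor_component_iff: "v \<in> tensor_component r i \<longleftrightarrow> (\<forall>a. lk v a \<noteq> 0 \<longrightarrow> a < r i)"
  by (auto simp: tensor_component_def in_keys_iff)

lemma tensor_component_dim:
  "nvec.fin_subspace (tensor_component r i :: (nat \<Rightarrow>\<^sub>0 'k::field) set)"
  "kvec.dim (tensor_component r i :: (nat \<Rightarrow>\<^sub>0 'k) set) = r i"
proof -
  let ?B = "(\<lambda>a. Poly_Mapping.single a (1::'k)) ` {..<r i}"
  have sub: "kvec.subspace (tensor_component r i :: (nat \<Rightarrow>\<^sub>0 'k) set)"
  proof (rule kvec.subspaceI)
    show "0 \<in> tensor_component r i" by (simp add: tensor_component_iff)
    show "smul c v \<in> tensor_component r i" if "v \<in> tensor_component r i" for c and v :: "nat \<Rightarrow>\<^sub>0 'k"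
      using that by (simp add: tensor_component_iff lookup_smul)
    show "v + w \<in> tensor_component r i" if vw: "v \<in> tensor_component r i" "w \<in> tensor_component r i"
      for v w :: "nat \<Rightarrow>\<^sub>0 'k"
      unfolding tensor_component_iff
    proof (intro allI impI)
      fix a assume "lk (v + w) a \<noteq> 0"
      then show "a < r i" using vw by (cases "lk v a = 0") (simp_all add: tensor_component_iff lookup_add)
    qed
  qed
  have "tensor_component r i \<subseteq> kvec.span ?B"
  proof
    fix v :: "nat \<Rightarrow>\<^sub>0 'k" assume v: "v \<in> tensor_component r i"
    have "(\<Sum>a\<in>Poly_Mapping.keys v. smul (lk v a) (Poly_Mapping.single a 1)) \<in> kvec.span ?B"
      by (intro kvec.span_sum kvec.span_scale kvec.span_base imageI)
        (use v in \<open>auto simp: tensor_component_def\<close>)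
    also have "(\<Sum>a\<in>Poly_Mapping.keys v. smul (lk v a) (Poly_Mapping.single a 1)) =
        (\<Sum>a\<in>Poly_Mapping.keys v. Poly_Mapping.single a (lk v a))"
      by (simp add: smul_single)
    also have "\<dots> = v" by (rule sum_single_lookup[symmetric])
    finally show "v \<in> kvec.span ?B" .
  qed
  then show fin: "nvec.fin_subspace (tensor_component r i :: (nat \<Rightarrow>\<^sub>0 'k) set)"
    using sub by (intro nvec.fin_subspaceI[of _ ?B]) auto
  have inj: "inj_on (\<lambda>a. Poly_Mapping.single a (1::'k)) {..<r i}"
    by (auto simp: inj_on_def) (metis lookup_single_eq lookup_single_not_eq zero_neq_one)
  have "kvec.independent ?B"
  proof (rule kvec.independent_if_scalars_zero)
    fix f x assume s: "(\<Sum>x\<in>?B. smul (f x) x) = 0" and x: "x \<in> ?B"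
    then obtain a where a: "a < r i" "x = Poly_Mapping.single a 1" by auto
    have "0 = lk (\<Sum>x\<in>?B. smul (f x) x) a" using s by simp
    also have "\<dots> = (\<Sum>b<r i. f (Poly_Mapping.single b 1) * (1 when b = a))"
      by (simp add: sum.reindex[OF inj] lookup_sum lookup_smul lookup_single)
    also have "\<dots> = f x" using a by (simp add: when_def if_distrib sum.delta cong: if_cong)
    finally show "f x = 0" by simp
  qed auto
  moreover have "?B \<subseteq> tensor_component r i"
    by (auto simp: tensor_component_iff lookup_single when_def)
  ultimately have "kvec.dim (tensor_component r i :: (nat \<Rightarrow>\<^sub>0 'k) set) = card ?B"
    using \<open>tensor_component r i \<subseteq> kvec.span ?B\<close> kvec.basis_card_eq_dim by metis
  also have "\<dots> = r i" using card_image[OF inj] by simp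
  finally show "kvec.dim (tensor_component r i :: (nat \<Rightarrow>\<^sub>0 'k) set) = r i" .
qed

lemma linear_reduce: "Vector_Spaces.linear fscale (smul :: 'k::field \<Rightarrow> _) (reduce i)"
  unfolding Vector_Spaces.linear_iff
  by (auto intro!: poly_mapping_eqI fvec.vector_space_axioms kvec.vector_space_axioms
      simp: lookup_add lookup_smul)

lemma reduce_smul: "reduce i (smul f v) = smul (lk f 0) (reduce i v)"
  by (rule poly_mapping_eqI) (simp add: lookup_smul lookup_mult_0)

lemma reduce_sum: "reduce i (sum f A) = (\<Sum>x\<in>A. reduce i (f x))"
  by (rule poly_mapping_eqI) (simp add: lookup_sum)

lemma tensor_map_superset:
  "finite A \<Longrightarrow> Poly_Mapping.keys v \<subseteq> A \<Longrightarrow>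
    tensor_map D i v = (\<Sum>a\<in>A. smul (lk v a) (reduce i (D (i, a))))"
  unfolding tensor_map_def
  by (intro sum.mono_neutral_left) (auto simp: in_keys_iff)

lemma linear_tensor_map: "Vector_Spaces.linear smul (smul :: 'k::field \<Rightarrow> _) (tensor_map D i)"
  unfolding Vector_Spaces.linear_iff
proof (intro conjI allI)
  fix v w :: "nat \<Rightarrow>\<^sub>0 'k" and c :: 'k
  let ?A = "Poly_Mapping.keys v \<union> Poly_Mapping.keys w"
  have "tensor_map D i (v + w) = (\<Sum>a\<in>?A. smul (lk (v + w) a) (reduce i (D (i, a))))"
    by (intro tensor_map_superset keys_add) auto
  also have "\<dots> = (\<Sum>a\<in>?A. smul (lk v a) (reduce i (D (i, a)))) + (\<Sum>a\<in>?A. smul (lk w a) (reduce i (D (i, a))))"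
    by (simp add: lookup_add kvec.scale_left_distrib sum.distrib)
  also have "\<dots> = tensor_map D i v + tensor_map D i w"
    by (simp add: tensor_map_superset[of ?A])
  finally show "tensor_map D i (v + w) = tensor_map D i v + tensor_map D i w" .
  have "tensor_map D i (smul c v) = (\<Sum>a\<in>Poly_Mapping.keys v. smul (lk (smul c v) a) (reduce i (D (i, a))))"
    by (intro tensor_map_superset) (auto simp: in_keys_iff lookup_smul)
  then show "tensor_map D i (smul c v) = smul c (tensor_map D i v)"
    by (simp add: lookup_smul tensor_map_def kvec.scale_sum_right)
qed (rule kvec.vector_space_axioms)+

text \<open>\<open>tensor_map\<close> is the map induced by \<open>lin_free\<close> on the tensor
  products. Only basis elements of degree \<open>i\<close> contribute: the coefficient of any other
  one is homogeneous of nonzero degree and has no constant term.\<close>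

lemma tensor_map_reduce:
  assumes v: "v \<in> fcomp r (int i)"
  shows "tensor_map D i (reduce i v) = reduce i (lin_free D v)"
proof -
  let ?I = "snd ` {b \<in> Poly_Mapping.keys v. fst b = i}"
  have "reduce i (lin_free D v) = (\<Sum>b\<in>Poly_Mapping.keys v. smul (lk (lk v b) 0) (reduce i (D b)))"
    by (simp add: lin_free_def reduce_sum reduce_smul)
  also have "\<dots> = (\<Sum>b\<in>{b \<in> Poly_Mapping.keys v. fst b = i}. smul (lk (lk v b) 0) (reduce i (D b)))"
  proof (intro sum.mono_neutral_right ballI)
    fix b assume b: "b \<in> Poly_Mapping.keys v - {b \<in> Poly_Mapping.keys v. fst b = i}"
    then have "lk v b \<in> rcomp (int i - int (fst b))" "fst b \<noteq> i" using v
      by (cases b, auto simp: fcomp_def)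
    then have "lk (lk v b) 0 = 0" by (force simp: rcomp_def)
    then show "smul (lk (lk v b) 0) (reduce i (D b)) = 0" by simp
  qed auto
  also have "\<dots> = (\<Sum>a\<in>?I. smul (lk (lk v (i, a)) 0) (reduce i (D (i, a))))"
    by (subst sum.reindex) (auto simp: inj_on_def intro!: sum.cong)
  also have "\<dots> = tensor_map D i (reduce i v)"
  proof -
    have "Poly_Mapping.keys (reduce i v) \<subseteq> ?I"
    proof
      fix a assume "a \<in> Poly_Mapping.keys (reduce i v)"
      then have "lk v (i, a) \<noteq> 0" by (auto simp: in_keys_iff)
      then have "(i, a) \<in> {b \<in> Poly_Mapping.keys v. fst b = i}" by (simp add: in_keys_iff)
      then show "a \<in> ?I" by force
    qed
    then show ?thesis by (subst tensor_map_superset[of ?I]) auto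
  qed
  finally show ?thesis by simp
qed

lemma reduce_image: "reduce i ` fcomp r (int i) = (tensor_component r i :: (nat \<Rightarrow>\<^sub>0 'k::field) set)"
proof (intro equalityI subsetI)
  fix w :: "nat \<Rightarrow>\<^sub>0 'k" assume "w \<in> reduce i ` fcomp r (int i)"
  then obtain v where v: "v \<in> fcomp r (int i)" "w = reduce i v" by auto
  have "lk v (i, a) \<noteq> 0" if "lk (lk v (i, a)) 0 \<noteq> 0" for a using that by auto
  then show "w \<in> tensor_component r i" using v by (auto simp: tensor_component_iff fcomp_def)
next
  fix w :: "nat \<Rightarrow>\<^sub>0 'k" assume w: "w \<in> tensor_component r i"
  define v where "v = (\<Sum>a\<in>Poly_Mapping.keys w. Poly_Mapping.single (i, a) (Const (lk w a)))"
  have lv: "lk v (j, a) = (if j = i then Const (lk w a) else 0)" for j a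
    by (auto simp: v_def lookup_sum lookup_single when_def in_keys_iff)
  have "lk (reduce i v) a = lk w a" for a by (simp add: lv Const_def)
  then have "w = reduce i v" by (intro poly_mapping_eqI) simp
  moreover have "v \<in> fcomp r (int i)"
  proof -
    have "lk w a \<noteq> 0" if "Const (lk w a) \<noteq> 0" for a using that by (cases "lk w a = 0") auto
    then show ?thesis
      using w by (auto simp: fcomp_def lv tensor_component_iff rcomp_def Const_def lookup_single when_def split: if_splits)
  qed
  ultimately show "w \<in> reduce i ` fcomp r (int i)" by blast
qed

lemma lookup_Var_free_part:
  "lk (f - Var i * divide_Var i f) m = (if m $ i = 0 then lk f m else 0)" for f :: "'k::comm_ring_1 mpoly3"
proof -
  have "m - axis i (Suc 0) + axis i (Suc 0) = m" if "m $ i \<noteq> 0"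
    using that by (auto simp: vec_eq_iff axis_def)
  then show ?thesis by (simp add: lookup_minus lookup_Var_mult)
qed

text \<open>Together with \<open>reduce_image\<close> this identifies the degree \<open>i\<close>
  part of the tensor product of F and k with the quotient of F_i by the multiples of the
  variables.\<close>

lemma reduce_kernel:
  "{v \<in> fcomp r (int i). reduce i v = 0} =
    koszul1 (\<lambda>i. smul (Var i)) ` cube (fcomp r (int i - 1) :: 'k::field free_elem set)"
proof (intro equalityI subsetI)
  fix v :: "'k free_elem"
  assume "v \<in> koszul1 (\<lambda>i. smul (Var i)) ` cube (fcomp r (int i - 1))"
  then obtain t where t: "t \<in> cube (fcomp r (int i - 1))" "v = koszul1 (\<lambda>i. smul (Var i)) t" by blast
  have "lk (Var j * f) 0 = 0" for j and f :: "'k mpoly3" by (simp add: lookup_Var_mult)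
  then have "reduce i v = 0"
    by (intro poly_mapping_eqI) (simp add: t(2) koszul1_def lookup_add lookup_smul)
  then show "v \<in> {v \<in> fcomp r (int i). reduce i v = 0}"
    using F.koszul1_V[OF t(1)] t(2) by simp
next
  fix v :: "'k free_elem" assume "v \<in> {v \<in> fcomp r (int i). reduce i v = 0}"
  then have v: "v \<in> fcomp r (int i)" "reduce i v = 0" by auto
  \<comment> \<open>Removing the terms divisible by x_1, then x_2, then x_3 leaves only the constant
    terms of the coefficients, which vanish here.\<close>
  define E where "E j w = w - smul (Var j) (fdivide j w)" for j and w :: "'k free_elem"
  have lE: "lk (lk (E j w) b) m = (if m $ j = 0 then lk (lk w b) m else 0)" for j w b m
    using lookup_Var_free_part[of "lk w b" j m] by (simp add: E_def lookup_minus lookup_smul)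
  have const: "lk (lk v b) 0 = 0" for b
  proof (cases "fst b = i")
    case True
    then show ?thesis using arg_cong[OF v(2), of "\<lambda>w. lk w (snd b)"] by (cases b) simp
  next
    case False
    have "lk v b \<in> rcomp (int i - int (fst b))" using v(1) by (cases b) (simp add: fcomp_def)
    then show ?thesis using False by (force simp: rcomp_def)
  qed
  have "lk (lk (E 3 (E 2 (E 1 v))) b) m = 0" for b m
  proof (cases "m = 0")
    case False
    then have "m $ 1 \<noteq> 0 \<or> m $ 2 \<noteq> 0 \<or> m $ 3 \<noteq> 0" by (simp add: vec_eq_iff forall_3)
    then show ?thesis by (auto simp: lE)
  qed (simp add: lE const)
  then have "E 3 (E 2 (E 1 v)) = 0" by (intro poly_mapping_eqI) simp
  then have "v = koszul1 (\<lambda>i. smul (Var i)) (fdivide 1 v, fdivide 2 (E 1 v), fdivide 3 (E 2 (E 1 v)))"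
    by (simp add: koszul1_def E_def algebra_simps)
  moreover have "(fdivide 1 v, fdivide 2 (E 1 v), fdivide 3 (E 2 (E 1 v))) \<in> cube (fcomp r (int i - 1))"
    using v(1) by (auto simp: E_def intro!: F.D_V F.V_closed F.X_V')
  ultimately show "v \<in> koszul1 (\<lambda>i. smul (Var i)) ` cube (fcomp r (int i - 1))" by blast
qed

abbreviation (input) fdim :: "'k::field itself \<Rightarrow> (nat \<Rightarrow> nat) \<Rightarrow> int \<Rightarrow> int"
  where "fdim t r i \<equiv> int (fvec.dim (fcomp r i :: 'k free_elem set))"

abbreviation (input) mu' :: "(int \<Rightarrow> 'k::field free_elem set) \<Rightarrow> int \<Rightarrow> int"
  where "mu' S i \<equiv> int (koszul.mu fscale (\<lambda>i. smul (Var i)) S i)"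

abbreviation (input) fmu :: "'k::field itself \<Rightarrow> (nat \<Rightarrow> nat) \<Rightarrow> int \<Rightarrow> int"
  where "fmu t r i \<equiv> mu' (fcomp r :: int \<Rightarrow> 'k free_elem set) i"

section \<open>Homology of a resolution tensored with the residue field\<close>

locale resolution =
  fixes K :: "'k::field mpoly3 set" and r E D
  assumes res: "graded_free_resolution K r E D"
begin

lemma E_comp: "a < r 0 j \<Longrightarrow> E (j, a) \<in> rcomp (int j)"
  using res by (auto simp: graded_free_resolution_def homogeneous_iff_rcomp)

lemma D_comp: "a < r (Suc q) j \<Longrightarrow> D q (j, a) \<in> fcomp (r q) (int j)"
  using res by (auto simp: graded_free_resolution_def free_component_eq)

sublocale h0: koszul_hom fscale "\<lambda>i. smul (Var i)" fdivide "fcomp (r 0)" rscale "\<lambda>i f. Var i * f"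
  divide_Var rcomp "lin_poly E"
  using RG.koszul_hom_lin[of "r 0" E, OF E_comp] unfolding lin_poly_eq rscale_def .

lemma hom: "koszul_hom fscale (\<lambda>i. smul (Var i)) fdivide (fcomp (r (Suc q)))
    fscale (\<lambda>i. smul (Var i)) fdivide (fcomp (r q)) (lin_free (D q))"
  using F.koszul_hom_lin[of "r (Suc q)" "D q" "r q", OF D_comp] unfolding lin_free_eq .

sublocale h: koszul_hom fscale "\<lambda>i. smul (Var i)" fdivide "fcomp (r (Suc q))"
  fscale "\<lambda>i. smul (Var i)" fdivide "fcomp (r q)" "lin_free (D q)" for q
  by (rule hom)

lemma h0_im: "h0.im d = K \<inter> rcomp d"
  using res RG.lin_image_V[of "r 0" E, OF E_comp] unfolding lin_poly_eq[symmetric]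
  by (simp add: graded_free_resolution_def h0.im_def)

lemma h_im: "h.im q d = lin_free (D q) ` free_module (r (Suc q)) \<inter> fcomp (r q) d"
  using F.lin_image_V[of "r (Suc q)" "D q" "r q", OF D_comp] unfolding lin_free_eq[symmetric]
  by (simp add: h.im_def)

lemma h0_ker: "h0.ker d = h.im 0 d"
proof -
  have "lin_free (D 0) ` free_module (r (Suc 0)) = {v \<in> free_module (r 0). lin_poly E v = 0}"
    using res by (simp add: graded_free_resolution_def)
  then show ?thesis using fcomp_free_module by (auto simp: h_im h0.ker_def)
qed

lemma h_ker: "h.ker q d = h.im (Suc q) d"
proof -
  have "lin_free (D (Suc q)) ` free_module (r (Suc (Suc q))) =
      {v \<in> free_module (r (Suc q)). lin_free (D q) v = 0}"
    using res by (simp add: graded_free_resolution_def)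
  then show ?thesis using fcomp_free_module by (auto simp: h_im h.ker_def)
qed

text \<open>Rank-nullity for \<open>reduce i\<close>. It replaces the ranks, on which nothing is
  known, by dimensions that the exact sequences relate to each other.\<close>

lemma dim_tensor: "int (r q i) = fdim TYPE('k) (r q) (int i) - fmu TYPE('k) (r q) (int i)"
proof -
  interpret p: vec_pair fscale "smul :: 'k \<Rightarrow> (nat \<Rightarrow>\<^sub>0 'k) \<Rightarrow> _" ..
  have "fvec.dim (fcomp (r q) (int i) :: 'k free_elem set) =
    fvec.dim {v \<in> fcomp (r q) (int i). reduce i (v :: 'k free_elem) = 0} + r q i"
    using p.rank_nullity[OF linear_reduce[of i] fin_fcomp[of "r q" "int i"]]
      tensor_component_dim(2)[of "r q" i, where ?'k = 'k] unfolding reduce_image by simp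
  then show ?thesis unfolding reduce_kernel by (simp add: F.mu_def)
qed

lemma dim_tensor_image:
  fixes S :: "'k free_elem set"
  assumes "S \<subseteq> fcomp (r q) (int i)" "fvec.subspace S"
  shows "int (kvec.dim (reduce i ` S)) =
    int (fvec.dim S) - int (fvec.dim {v \<in> S. v \<in> koszul1 (\<lambda>i. smul (Var i)) ` cube (fcomp (r q) (int i - 1))})"
proof -
  interpret p: vec_pair fscale "smul :: 'k \<Rightarrow> (nat \<Rightarrow>\<^sub>0 'k) \<Rightarrow> _" ..
  have "{v \<in> S. reduce i v = 0} = {v \<in> S. v \<in> koszul1 (\<lambda>i. smul (Var i)) ` cube (fcomp (r q) (int i - 1))}"
    using assms(1) reduce_kernel[of "r q" i] by blast
  then show ?thesis
    using p.rank_nullity[OF linear_reduce[of i] fvec.fin_subspace_subset[OF fin_fcomp assms(2,1)]]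
    by simp
qed

text \<open>\<open>reduce\<close> commutes with the differentials and is onto, so boundaries after
  tensoring are reductions of boundaries. Their dimension then follows from
  \<open>mu_V_im\<close>.\<close>

lemma boundaries: "tor_boundaries r D q i = reduce i ` h.im q (int i)"
proof -
  have "tor_boundaries r D q i = tensor_map (D q) i ` reduce i ` fcomp (r (Suc q)) (int i)"
    by (simp add: tor_boundaries_def reduce_image)
  also have "\<dots> = reduce i ` lin_free (D q) ` fcomp (r (Suc q)) (int i)"
    unfolding image_image by (intro image_cong refl tensor_map_reduce)
  finally show ?thesis by (simp add: h.im_def)
qed

lemma dim_boundaries_0:
  "int (kvec.dim (tor_boundaries r D 0 i)) =
     int (fvec.dim (h0.ker (int i))) - fmu TYPE('k) (r 0) (int i) + int (R.mu h0.im (int i))"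
proof -
  have "int (kvec.dim (tor_boundaries r D 0 i)) = int (fvec.dim (h0.ker (int i)))
    - int (fvec.dim {v \<in> h0.ker (int i). v \<in> koszul1 (\<lambda>i. smul (Var i)) ` cube (fcomp (r 0) (int i - 1))})"
    unfolding boundaries h0_ker[symmetric]
    by (intro dim_tensor_image fvec.fin_subspace_subspace[OF h0.fin_ker]) (auto simp: h0.ker_def)
  then show ?thesis using h0.mu_V_im[of "int i"] by linarith
qed

lemma dim_boundaries_Suc:
  "int (kvec.dim (tor_boundaries r D (Suc q) i)) =
     int (fvec.dim (h.ker q (int i))) - fmu TYPE('k) (r (Suc q)) (int i) + mu' (h.im q) (int i)"
proof -
  have "int (kvec.dim (tor_boundaries r D (Suc q) i)) = int (fvec.dim (h.ker q (int i)))
    - int (fvec.dim {v \<in> h.ker q (int i). v \<in> koszul1 (\<lambda>i. smul (Var i)) ` cube (fcomp (r (Suc q)) (int i - 1))})"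
    unfolding boundaries h_ker[symmetric]
    by (intro dim_tensor_image fvec.fin_subspace_subspace[OF h.fin_ker]) (auto simp: h.ker_def)
  then show ?thesis using h.mu_V_im[of q "int i"] by linarith
qed

lemma dim_cycles_Suc:
  "int (kvec.dim (tor_cycles r D (Suc q) i)) = int (r (Suc q) i) - int (kvec.dim (tor_boundaries r D q i))"
proof -
  interpret p: vec_pair "smul :: 'k \<Rightarrow> (nat \<Rightarrow>\<^sub>0 'k) \<Rightarrow> _" "smul :: 'k \<Rightarrow> (nat \<Rightarrow>\<^sub>0 'k) \<Rightarrow> _" ..
  show ?thesis
    using p.rank_nullity[OF linear_tensor_map[of "D q" i] tensor_component_dim(1)[of "r (Suc q)" i]]
      tensor_component_dim(2)[of "r (Suc q)" i, where ?'k = 'k]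
    by (simp add: tor_boundaries_def)
qed

definition tor :: "nat \<Rightarrow> nat \<Rightarrow> nat"
  where "tor q i = kvec.dim (tor_cycles r D q i) - kvec.dim (tor_boundaries r D q i)"

lemma boundaries_subset: "tor_boundaries r D q i \<subseteq> tor_cycles r D q i"
proof
  fix y assume "y \<in> tor_boundaries r D q i"
  then obtain v where v: "v \<in> h.im q (int i)" "y = reduce i v" by (auto simp: boundaries)
  have v': "v \<in> fcomp (r q) (int i)" using v(1) by (simp add: h_im)
  then have y: "y \<in> tensor_component (r q) i" using v(2) reduce_image by blast
  show "y \<in> tor_cycles r D q i"
  proof (cases q)
    case (Suc p)
    have "lin_free (D p) v = 0" using v(1) h_ker[of p] by (auto simp: Suc h.ker_def)
    then have "tensor_map (D p) i y = 0"
      using tensor_map_reduce[of v "r q" i "D p"] v' v(2) reduce_smul[of i 0 0] by simp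
    then show ?thesis using y Suc by simp
  qed (use y in simp)
qed

lemma subspace_boundaries: "kvec.subspace (tor_boundaries r D q i)"
proof -
  interpret p: vec_pair fscale "smul :: 'k \<Rightarrow> (nat \<Rightarrow>\<^sub>0 'k) \<Rightarrow> _" ..
  show ?thesis
    unfolding boundaries
    by (intro nvec.fin_subspace_subspace p.fin_subspace_image linear_reduce h.fin_im)
qed

lemma fin_cycles: "nvec.fin_subspace (tor_cycles r D q i)"
proof (cases q)
  case 0 then show ?thesis using tensor_component_dim(1) by simp
next
  case (Suc p)
  interpret p: vec_pair "smul :: 'k \<Rightarrow> (nat \<Rightarrow>\<^sub>0 'k) \<Rightarrow> _" "smul :: 'k \<Rightarrow> (nat \<Rightarrow>\<^sub>0 'k) \<Rightarrow> _" ..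
  have "kvec.subspace {v \<in> tensor_component (r (Suc p)) i. tensor_map (D p) i v = 0}"
    by (intro p.subspace_kernel_on linear_tensor_map nvec.fin_subspace_subspace tensor_component_dim(1))
  then show ?thesis
    unfolding Suc tor_cycles.simps
    by (rule nvec.fin_subspace_subset[OF tensor_component_dim(1)]) auto
qed

text \<open>The subtraction in \<open>tor\<close> is one of natural numbers; it does not truncate,
  as the boundaries lie in the finite-dimensional space of cycles.\<close>

lemma tor_int: "int (tor q i) = int (kvec.dim (tor_cycles r D q i)) - int (kvec.dim (tor_boundaries r D q i))"
  using nvec.fin_subspace_dim_mono[OF fin_cycles subspace_boundaries boundaries_subset, of q i]
  by (simp add: tor_def)

text \<open>The value is the dimension in degree \<open>i\<close> of K/(x_1, x_2, x_3)K, the space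
  of minimal generators.\<close>

lemma tor_0: "int (tor 0 i) = int (rvec.dim (h0.im (int i))) - int (R.mu h0.im (int i))"
  using dim_boundaries_0[of i] tensor_component_dim(2)[of "r 0" i, where ?'k = 'k] dim_tensor[of 0 i]
    h0.dim_ker_im[of "int i"] by (simp add: tor_int)

text \<open>By exactness all dimensions of plain components in degree \<open>i\<close> cancel; only
  those of multiples of the variables remain.\<close>

lemma tor_Suc_aux:
  "int (tor (Suc 0) i) =
     fmu TYPE('k) (r 0) (int i) - int (R.mu h0.im (int i)) - mu' h0.ker (int i)" (is ?A)
  "int (tor (Suc (Suc q)) i) =
     fmu TYPE('k) (r (Suc q)) (int i) - mu' (h.im q) (int i) - mu' (h.ker q) (int i)" (is ?B)
proof -
  have 0: "h0.ker = h.im 0" using h0_ker by blast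
  show ?A
    using dim_cycles_Suc[of 0 i] dim_tensor[of "Suc 0" i] dim_boundaries_0[of i] dim_boundaries_Suc[of 0 i]
      h.dim_ker_im[of 0 "int i"] by (simp add: 0 tor_int)
  have 1: "h.ker q = h.im (Suc q)" using h_ker by blast
  show ?B
    using dim_cycles_Suc[of "Suc q" i] dim_tensor[of "Suc (Suc q)" i] dim_boundaries_Suc[of q i]
      dim_boundaries_Suc[of "Suc q" i] h.dim_ker_im[of "Suc q" "int i"] by (simp add: 1 tor_int)
qed

abbreviation n where "n d \<equiv> int (rvec.dim (h0.im d))"
abbreviation s where "s d \<equiv> int (rvec.dim (R.socle h0.im d))"

text \<open>\<open>mu_V\<close> evaluates the terms of the free modules and \<open>mu_ker\<close>
  those of the kernels. The dimensions of the free modules and of all higher syzygies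
  cancel.\<close>

lemma tor_values:
  "int (tor (Suc 0) i) =
     3 * n (int i - 1) - 3 * n (int i - 2) + s (int i - 3) - int (R.mu h0.im (int i))" (is ?A)
  "int (tor (Suc (Suc 0)) i) =
     s (int i - 3) - n (int i - 3)" (is ?B)
  "int (tor (Suc (Suc (Suc q))) i) = 0"
  (is ?C)
proof -
  have 0: "h0.ker = h.im 0" using h0_ker by blast
  have 1: "h.ker q = h.im (Suc q)" for q using h_ker by blast
  have f0: "fmu TYPE('k) (r 0) i = 3 * fdim TYPE('k) (r 0) (i - 1) - 3 * fdim TYPE('k) (r 0) (i - 2) + fdim TYPE('k) (r 0) (i - 3)" for i
    by (rule F.mu_V)
  have f: "fmu TYPE('k) (r (Suc q)) i = 3 * fdim TYPE('k) (r (Suc q)) (i - 1) - 3 * fdim TYPE('k) (r (Suc q)) (i - 2) + fdim TYPE('k) (r (Suc q)) (i - 3)" for q i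
    by (rule F.mu_V)
  have d0: "fdim TYPE('k) (r 0) i = int (fvec.dim (h0.ker i)) + n i" for i using h0.dim_ker_im[of i] by simp
  have d: "fdim TYPE('k) (r (Suc q)) i = int (fvec.dim (h.ker q i)) + int (fvec.dim (h.im q i))" for q i
    using h.dim_ker_im[of q i] by simp
  have m0: "mu' h0.ker i = 3 * int (fvec.dim (h0.ker (i - 1))) - 3 * int (fvec.dim (h0.ker (i - 2)))
      - s (i - 3) + fdim TYPE('k) (r 0) (i - 3)" for i
    by (rule h0.mu_ker)
  \<comment> \<open>Every image from the first syzygies on is a kernel and hence its own socle. The
    socle of R/K is therefore the only one left, entering through \<open>m0\<close>.\<close>
  have s0: "koszul.socle (\<lambda>i. smul (Var i)) (fcomp (r 0)) (h.im 0) = h.im 0"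
    using h0.socle_ker by (auto simp: 0)
  have s1: "koszul.socle (\<lambda>i. smul (Var i)) (fcomp (r (Suc q))) (h.im (Suc q)) = h.im (Suc q)" for q
    using h.socle_ker[of q] by (auto simp: 1)
  have m1: "mu' (h.ker q) i = 3 * int (fvec.dim (h.ker q (i - 1))) - 3 * int (fvec.dim (h.ker q (i - 2)))
      - int (fvec.dim (h.im q (i - 3))) + fdim TYPE('k) (r (Suc q)) (i - 3)" for q i
    using h.mu_ker[of q i] s0 s1[of "q - 1"] by (cases q) simp_all
  show ?A using tor_Suc_aux(1)[of i] f0[of "int i"] m0[of "int i"] d0[of "int i - 1"] d0[of "int i - 2"]
      d0[of "int i - 3"] by linarith
  show ?B using tor_Suc_aux(2)[of 0 i] f[of 0 "int i"] m1[of 0 "int i"] m0[of "int i"]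
      d[of 0 "int i - 1"] d[of 0 "int i - 2"] d[of 0 "int i - 3"] d0[of "int i - 3"] by (simp add: 0)
  show ?C using tor_Suc_aux(2)[of "Suc q" i] f[of "Suc q" "int i"] m1[of "Suc q" "int i"] m1[of q "int i"]
      d[of "Suc q" "int i - 1"] d[of "Suc q" "int i - 2"] d[of "Suc q" "int i - 3"] d[of q "int i - 3"]
    by (simp add: 1)
qed

end

section \<open>Existence of graded free resolutions\<close>

context graded_module
begin

definition graded_submodule :: "'v set \<Rightarrow> bool"
  where "graded_submodule Z \<longleftrightarrow> Z \<subseteq> W \<and> 0 \<in> Z \<and> (\<forall>v\<in>Z. \<forall>w\<in>Z. v + w \<in> Z) \<and>
    (\<forall>f. \<forall>v\<in>Z. act f v \<in> Z) \<and> (\<forall>d. \<forall>v\<in>Z. part d v \<in> Z)"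

lemma graded_submodule_sum:
  assumes "graded_submodule Z" "\<And>x. x \<in> A \<Longrightarrow> f x \<in> Z"
  shows "sum f A \<in> Z"
  using assms(2) assms(1)
  by (induction A rule: infinite_finite_induct) (auto simp: graded_submodule_def)

text \<open>Vector space bases of all graded pieces are taken together as generators. This is
  wasteful, but it needs no Noetherian argument, and there are finitely many generators in each
  degree.\<close>

lemma graded_submodule_generators:
  assumes Z: "graded_submodule Z" and neg: "\<And>d. d < 0 \<Longrightarrow> V d = {0}"
  obtains r E where "\<And>j a. a < r j \<Longrightarrow> E (j, a) \<in> V (int j)" "md.lin E ` free_module r = Z"
proof -
  have "\<exists>e r. e ` {..<r} \<subseteq> Z \<inter> V (int j) \<and> Z \<inter> V (int j) \<subseteq> span (e ` {..<r :: nat})" for j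
  proof -
    have "subspace (Z \<inter> V (int j))"
      using Z V_subspace[of "int j"] unfolding graded_submodule_def subspace_def by auto
    then have "fin_subspace (Z \<inter> V (int j))"
      by (rule fin_subspace_subset[OF fin_V[of "int j"]]) auto
    then obtain B where B: "finite B" "B \<subseteq> Z \<inter> V (int j)" "independent B" "span B = Z \<inter> V (int j)"
        "card B = dim (Z \<inter> V (int j))"
      by (rule fin_subspace_basis)
    obtain e where "bij_betw e {0..<card B} B" using ex_bij_betw_nat_finite[OF B(1)] by blast
    then have "e ` {..<card B} = B" by (simp add: bij_betw_def atLeast0LessThan)
    then show ?thesis using B by (intro exI[of _ e] exI[of _ "card B"]) simp
  qed
  then obtain e r where er: "\<And>j. e j ` {..<r j} \<subseteq> Z \<inter> V (int j)"
    "\<And>j. Z \<inter> V (int j) \<subseteq> span (e j ` {..<r j :: nat})" by metis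
  define E where "E = (\<lambda>(j, a). e j a)"
  have EZ: "E (j, a) \<in> Z \<inter> V (int j)" if "a < r j" for j a using er(1)[of j] that by (auto simp: E_def)
  have sub: "subspace (md.lin E ` free_module r)"
  proof (rule subspaceI)
    show "0 \<in> md.lin E ` free_module r"
      using md.lin_0 by (intro image_eqI[of _ _ 0]) (auto simp: free_module_iff)
    show "x + y \<in> md.lin E ` free_module r"
      if "x \<in> md.lin E ` free_module r" "y \<in> md.lin E ` free_module r" for x y
      using that by (auto intro!: imageI F.W_add simp flip: md.lin_add)
    show "act (Const c) x \<in> md.lin E ` free_module r"
      if "x \<in> md.lin E ` free_module r" for c x
      using that by (auto intro!: imageI F.W_act simp flip: md.lin_smul)
  qed
  have "md.lin E ` free_module r = Z"
  proof (intro equalityI subsetI)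
    fix y assume "y \<in> md.lin E ` free_module r"
    then obtain v where v: "v \<in> free_module r" "y = md.lin E v" by auto
    have "act (lk v b) (E b) \<in> Z" if "b \<in> Poly_Mapping.keys v" for b
      using v(1) that EZ[of "snd b" "fst b"] Z
      by (cases b) (auto simp: graded_submodule_def free_module_iff in_keys_iff)
    then show "y \<in> Z" unfolding v(2) md.lin_def by (rule graded_submodule_sum[OF Z])
  next
    fix z assume z: "z \<in> Z"
    have zW: "z \<in> W" and zp: "part d z \<in> Z" for d using z Z by (auto simp: graded_submodule_def)
    from part_sum[OF zW] obtain A where A: "z = (\<Sum>d\<in>A. part d z)" by blast
    have "part d z \<in> md.lin E ` free_module r" for d
    proof (cases "d < 0")
      case True
      then have "part d z = 0"
        using neg[of d] part_V[OF zW, of d] by simp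
      then show ?thesis using subspace_0[OF sub] by simp
    next
      case False
      then have d: "d = int (nat d)" by simp
      have "part d z \<in> Z \<inter> V (int (nat d))"
        using zp[of d] part_V[OF zW, of d] d by auto
      then have "part d z \<in> span (e (nat d) ` {..<r (nat d)})" using er(2) by blast
      moreover have "e (nat d) ` {..<r (nat d)} \<subseteq> md.lin E ` free_module r"
      proof
        fix y assume "y \<in> e (nat d) ` {..<r (nat d)}"
        then obtain a where a: "a < r (nat d)" "y = E (nat d, a)" by (auto simp: E_def)
        then have "y = md.lin E (Poly_Mapping.single (nat d, a) 1)" by (simp add: md.lin_single)
        moreover have "Poly_Mapping.single (nat d, a) 1 \<in> free_module r"
          using a by (auto simp: free_module_iff lookup_single when_def)
        ultimately show "y \<in> md.lin E ` free_module r" by blast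
      qed
      ultimately show ?thesis using span_minimal[OF _ sub] by blast
    qed
    then show "z \<in> md.lin E ` free_module r" by (subst A) (rule subspace_sum[OF sub])
  qed
  then show thesis using that[of r E] EZ by blast
qed

lemma graded_submodule_kernel:
  assumes E: "\<And>j a. a < r j \<Longrightarrow> E (j, a) \<in> V (int j)"
  shows "graded_module.graded_submodule smul (free_module r) fpart {v \<in> free_module r. md.lin E v = 0}"
  unfolding F.graded_submodule_def
proof (intro conjI ballI allI)
  show "0 \<in> {v \<in> free_module r. md.lin E v = 0}" by (simp add: free_module_iff md.lin_0)
  fix v assume v: "v \<in> {v \<in> free_module r. md.lin E v = 0}"
  show "v + w \<in> {v \<in> free_module r. md.lin E v = 0}" if "w \<in> {v \<in> free_module r. md.lin E v = 0}" for w
    using v that F.W_add[of v r w] by (simp add: md.lin_add)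
  show "smul f v \<in> {v \<in> free_module r. md.lin E v = 0}" for f
    using v F.W_act[of v r f] by (simp add: md.lin_smul)
  show "fpart d v \<in> {v \<in> free_module r. md.lin E v = 0}" for d
    using v part_lin[where E = E and r = r and d = d, OF E, of v] F.V_W[OF F.part_V, of v r d] part_0 by simp
qed auto

end

lemma homogeneous_ideal_subspace: "homogeneous_ideal K \<Longrightarrow> ideal.subspace K"
  using ideal.subspace_span by (auto simp: homogeneous_ideal_def)

lemma homogeneous_ideal_rpart:
  fixes K :: "'k::field mpoly3 set"
  assumes K: "homogeneous_ideal K" and f: "f \<in> K"
  shows "rpart d f \<in> K"
proof -
  obtain S where S: "\<And>f. f \<in> S \<Longrightarrow> \<exists>d. homogeneous d f" "K = ideal.span S"
    using K by (auto simp: homogeneous_ideal_def)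
  have sub: "ideal.subspace K" by (rule homogeneous_ideal_subspace[OF K])
  have "\<forall>d. rpart d f \<in> K" using f unfolding S(2)
  proof (induction rule: ideal.span_induct_alt)
    case base then show ?case using ideal.span_zero by simp
  next
    case (step c x y)
    obtain e where "x \<in> rcomp (int e)" using S(1)[OF step(1)] by (auto simp: homogeneous_iff_rcomp)
    then have "rpart d (c * x + y) = rpart (d - int e) c * x + rpart d y" for d
      by (simp add: rpart_add rpart_mult)
    then show ?case using step by (simp add: ideal.span_add ideal.span_scale ideal.span_base)
  qed
  then show ?thesis by simp
qed

lemma homogeneous_ideal_graded: "homogeneous_ideal K \<Longrightarrow> RG.graded_submodule K"
  using homogeneous_ideal_subspace[of K] homogeneous_ideal_rpart[of K]
  by (simp add: RG.graded_submodule_def ideal.subspace_def)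

lemma rcomp_neg: "d < 0 \<Longrightarrow> rcomp d = {0}"
proof -
  assume "d < 0"
  then have "int n \<noteq> d" for n by linarith
  then show ?thesis by (auto simp: rcomp_def intro!: poly_mapping_eqI)
qed

lemma fcomp_neg: "d < 0 \<Longrightarrow> fcomp r d = {0}"
proof -
  assume "d < 0"
  then have "rcomp (d - int j) = ({0} :: 'a mpoly3 set)" for j by (intro rcomp_neg) linarith
  then have "v = 0" if "v \<in> fcomp r d" for v :: "'a free_elem"
    using that by (intro poly_mapping_eqI) (auto simp: fcomp_def)
  then show ?thesis using F.V_closed(1) by blast
qed

lemma graded_free_resolution_exists:
  assumes K: "homogeneous_ideal (K :: 'k::field mpoly3 set)"
  obtains r E D where "graded_free_resolution K r E D"
proof -
  obtain r0 E where E: "\<And>j a. a < r0 j \<Longrightarrow> E (j, a) \<in> rcomp (int j)" "lin_poly E ` free_module r0 = K"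
    using RG.graded_submodule_generators[OF homogeneous_ideal_graded[OF K] rcomp_neg]
    unfolding lin_poly_eq by metis
  define ker where "ker r f = {v \<in> free_module r. f v = 0}" for r and f :: "'k free_elem \<Rightarrow> 'k free_elem"
  define Z0 where "Z0 = {v \<in> free_module r0. lin_poly E v = 0}"
  \<comment> \<open>State \<open>n\<close> of the recursion consists of the ranks of the
    \<open>n\<close>-th free module, the differential leaving it (arbitrary for n = 0) and the
    kernel \<open>Z\<close> to be covered next. The differential from module n + 1 is thus stored in
    state n + 1.\<close>
  define P where "P n x = (case x of (r, D :: nat \<times> nat \<Rightarrow> 'k free_elem, Z) \<Rightarrow>
      F.graded_submodule r Z \<and> (n = (0::nat) \<longrightarrow> r = r0 \<and> Z = Z0))" for n x
  define Q where "Q n x y = (case (x, y) of ((r, D :: nat \<times> nat \<Rightarrow> 'k free_elem, Z :: 'k free_elem set),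
        (r', D' :: nat \<times> nat \<Rightarrow> 'k free_elem, Z' :: 'k free_elem set)) \<Rightarrow>
      (\<forall>j a. a < r' j \<longrightarrow> D' (j, a) \<in> fcomp r (int j)) \<and> lin_free D' ` free_module r' = Z \<and>
      Z' = {v \<in> free_module r'. lin_free D' v = 0})" for n :: nat and x y
  have "\<exists>f. \<forall>n. P n (f n) \<and> Q n (f n) (f (Suc n))"
  proof (rule dependent_nat_choice)
    have "F.graded_submodule r0 Z0"
      unfolding Z0_def lin_poly_eq by (rule RG.graded_submodule_kernel[OF E(1)])
    then show "\<exists>x. P 0 x" by (auto simp: P_def)
  next
    fix x n assume "P n x"
    obtain r D Z where x: "x = (r, D, Z)" by (metis prod_cases3)
    then have Z: "F.graded_submodule r Z" using \<open>P n x\<close> by (simp add: P_def)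
    obtain r' D' where D': "\<And>j a. a < r' j \<Longrightarrow> D' (j, a) \<in> fcomp r (int j)" "lin_free D' ` free_module r' = Z"
      using F.graded_submodule_generators[OF Z fcomp_neg] unfolding lin_free_eq by metis
    have "F.graded_submodule r' {v \<in> free_module r'. lin_free D' v = 0}"
      unfolding lin_free_eq by (rule F.graded_submodule_kernel[OF D'(1)])
    then show "\<exists>y. P (Suc n) y \<and> Q n x y"
      using D' x by (intro exI[of _ "(r', D', {v \<in> free_module r'. lin_free D' v = 0})"]) (simp add: P_def Q_def)
  qed
  then obtain f where f: "\<And>n. P n (f n)" "\<And>n. Q n (f n) (f (Suc n))" by blast
  define r where "r n = fst (f n)" for n
  define D where "D n = fst (snd (f (Suc n)))" for n
  define Z where "Z n = snd (snd (f n))" for n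
  have r0: "r 0 = r0" "Z 0 = Z0" using f(1)[of 0] by (auto simp: P_def r_def Z_def split_beta)
  have Q: "\<And>j a. a < r (Suc n) j \<Longrightarrow> D n (j, a) \<in> fcomp (r n) (int j)"
    "lin_free (D n) ` free_module (r (Suc n)) = Z n"
    "Z (Suc n) = {v \<in> free_module (r (Suc n)). lin_free (D n) v = 0}" for n
    using f(2)[of n] by (auto simp: Q_def r_def Z_def D_def split_beta)
  have "graded_free_resolution K r E D"
    unfolding graded_free_resolution_def
    using E Q(1) by (auto simp: r0 homogeneous_iff_rcomp free_component_eq Q(2) Q(3)[symmetric] Z0_def[symmetric])
  then show thesis by (rule that)
qed

section \<open>Betti numbers of a homogeneous ideal\<close>

abbreviation hdim :: "'k::field mpoly3 set \<Rightarrow> int \<Rightarrow> int"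
  where "hdim K d \<equiv> int (rvec.dim (K \<inter> rcomp d))"

abbreviation gmu :: "'k::field mpoly3 set \<Rightarrow> int \<Rightarrow> int"
  where "gmu K d \<equiv> int (R.mu (\<lambda>d. K \<inter> rcomp d) d)"

abbreviation gsocle :: "'k::field mpoly3 set \<Rightarrow> int \<Rightarrow> int"
  where "gsocle K d \<equiv> int (rvec.dim (R.socle (\<lambda>d. K \<inter> rcomp d) d))"

text \<open>The last nonzero Tor is the socle of R/K shifted by 3, the degree of the top class of
  the Koszul complex; the middle one is what the Euler characteristic leaves.\<close>

theorem betti_values:
  assumes "homogeneous_ideal (K :: 'k::field mpoly3 set)"
  shows "int (betti K 0 i) = hdim K (int i) - gmu K (int i)"
    and "int (betti K (Suc 0) i) =
      3 * hdim K (int i - 1) - 3 * hdim K (int i - 2) + gsocle K (int i - 3) - gmu K (int i)"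
    and "int (betti K (Suc (Suc 0)) i) = gsocle K (int i - 3) - hdim K (int i - 3)"
    and "betti K (Suc (Suc (Suc q))) i = 0"
proof -
  \<comment> \<open>The triple selected inside \<open>betti\<close> is a resolution because some
    resolution exists; the values of \<open>tor\<close> are the same for each.\<close>
  obtain r E D where x: "(SOME (r, E, D). graded_free_resolution K r E D) = (r, E, D)"
    by (metis prod_cases3)
  have "\<exists>x. case x of (r, E, D) \<Rightarrow> graded_free_resolution K r E D"
    using graded_free_resolution_exists[OF assms] by (metis case_prod_conv)
  from someI_ex[OF this] have "graded_free_resolution K r E D" unfolding x by simp
  then interpret resolution K r E D by unfold_locales
  have b: "betti K q i = tor q i" for q i unfolding betti_def x tor_def by simp
  have im: "h0.im = (\<lambda>d. K \<inter> rcomp d)" using h0_im by blast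
  show "int (betti K 0 i) = hdim K (int i) - gmu K (int i)"
    using tor_0[of i] by (simp add: b im)
  show "int (betti K (Suc 0) i) =
      3 * hdim K (int i - 1) - 3 * hdim K (int i - 2) + gsocle K (int i - 3) - gmu K (int i)"
    using tor_values(1)[of i] by (simp add: b im)
  show "int (betti K (Suc (Suc 0)) i) = gsocle K (int i - 3) - hdim K (int i - 3)"
    using tor_values(2)[of i] by (simp add: b im)
  show "betti K (Suc (Suc (Suc q))) i = 0"
    using tor_values(3)[of q i] by (simp add: b)
qed

text \<open>The generator and socle terms cancel in b_0 - b_1 + b_2, which equals h(i) - 3 h(i-1) +
  3 h(i-2) - h(i-3) for the Hilbert function h of the ideal. Since h vanishes in negative degrees,
  this recursion determines it.\<close>

corollary hdim_eq_if_betti_eq: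
  assumes "homogeneous_ideal (I :: 'k::field mpoly3 set)" "homogeneous_ideal (J :: 'k mpoly3 set)"
    and eq: "betti I = betti J"
  shows "hdim I d = hdim J d"
proof (cases "d < 0")
  case True then show ?thesis by (simp add: rcomp_neg homogeneous_ideal_subspace[OF assms(1), THEN ideal.subspace_0]
      homogeneous_ideal_subspace[OF assms(2), THEN ideal.subspace_0])
next
  case False
  have neg: "hdim I e = hdim J e" if "e < 0" for e
    using that by (simp add: rcomp_neg homogeneous_ideal_subspace[OF assms(1), THEN ideal.subspace_0]
      homogeneous_ideal_subspace[OF assms(2), THEN ideal.subspace_0])
  have "hdim I (int i) = hdim J (int i)" for i
  proof (induction i rule: less_induct)
    case (less i)
    have IH: "hdim I (int i - int m) = hdim J (int i - int m)" if "m > 0" for m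
    proof (cases "int i - int m < 0")
      case False
      then show ?thesis using less[of "i - m"] that by (simp add: of_nat_diff)
    qed (rule neg)
    show ?case
      using betti_values(1-3)[OF assms(1), of i] betti_values(1-3)[OF assms(2), of i] eq
        IH[of 1] IH[of 2] IH[of 3] by simp
  qed
  from this[of "nat d"] False show ?thesis by simp
qed

section \<open>Linear independence depending on parameters\<close>

text \<open>Independence of the rows of a matrix, restricted to the columns in \<open>S\<close>.
  Rows are an indexed family rather than a set, since they will vary with parameters and might
  coincide for some values.\<close>

definition indep_on :: "'m set \<Rightarrow> 'i set \<Rightarrow> ('i \<Rightarrow> 'm \<Rightarrow> 'k::field) \<Rightarrow> bool"
  where "indep_on S A w \<longleftrightarrow> (\<forall>c. (\<forall>m\<in>S. (\<Sum>i\<in>A. c i * w i m) = 0) \<longrightarrow> (\<forall>i\<in>A. c i = 0))"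

lemma indep_onD:
  "indep_on S A w \<Longrightarrow> (\<And>m. m \<in> S \<Longrightarrow> (\<Sum>i\<in>A. c i * w i m) = 0) \<Longrightarrow> i \<in> A \<Longrightarrow> c i = 0"
  by (auto simp: indep_on_def)

text \<open>One step of Gaussian elimination with pivot row \<open>a\<close> and pivot column
  \<open>m0\<close>. It is free of divisions, so polynomial entries stay polynomial.\<close>

lemma indep_on_eliminate:
  assumes "finite A" "a \<notin> A" and ind: "indep_on S (insert a A) w"
  obtains m0 where "m0 \<in> S" "w a m0 \<noteq> 0"
    "indep_on (S - {m0}) A (\<lambda>i m. w a m0 * w i m - w i m0 * w a m)"
proof -
  have "\<exists>m0\<in>S. w a m0 \<noteq> 0"
  proof (rule ccontr)
    assume "\<not> (\<exists>m0\<in>S. w a m0 \<noteq> 0)"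
    then have "(\<Sum>i\<in>insert a A. (if i = a then 1 else 0) * w i m) = 0" if "m \<in> S" for m
      using that by (intro sum.neutral) auto
    from indep_onD[OF ind this, of a] show False by simp
  qed
  then obtain m0 where m0: "m0 \<in> S" "w a m0 \<noteq> 0" by blast
  have "indep_on (S - {m0}) A (\<lambda>i m. w a m0 * w i m - w i m0 * w a m)"
    unfolding indep_on_def
  proof (intro allI impI ballI)
    fix c i
    assume c: "\<forall>m\<in>S - {m0}. (\<Sum>i\<in>A. c i * (w a m0 * w i m - w i m0 * w a m)) = 0" and i: "i \<in> A"
    \<comment> \<open>The coefficient of row \<open>a\<close> is chosen such that the combination of
      the old rows equals the given combination of the eliminated ones; in column \<open>m0\<close>
      the latter vanish anyway.\<close>
    define c' where "c' i = (if i = a then - (\<Sum>i\<in>A. c i * w i m0) else c i * w a m0)" for i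
    have "(\<Sum>i\<in>insert a A. c' i * w i m) = 0" if "m \<in> S" for m
    proof -
      have "(\<Sum>i\<in>A. c' i * w i m) = (\<Sum>i\<in>A. c i * w a m0 * w i m)"
        using assms(2) by (intro sum.cong) (auto simp: c'_def)
      then have "(\<Sum>i\<in>insert a A. c' i * w i m) =
          (\<Sum>i\<in>A. c i * w a m0 * w i m) - (\<Sum>i\<in>A. c i * w i m0) * w a m"
        using assms(1,2) by (simp add: c'_def)
      also have "\<dots> = (\<Sum>i\<in>A. c i * (w a m0 * w i m - w i m0 * w a m))"
        by (simp only: right_diff_distrib sum_subtractf sum_distrib_right mult.assoc)
      also have "\<dots> = 0"
      proof (cases "m = m0")
        case True then show ?thesis by (simp add: mult.commute)
      next
        case False then show ?thesis using c that by blast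
      qed
      finally show ?thesis .
    qed
    from indep_onD[OF ind this, of i] show "c i = 0" using i m0(2) assms(2) by (auto simp: c'_def split: if_splits)
  qed
  then show thesis using that m0 by blast
qed

text \<open>Elimination reversed: it suffices that the pivot is nonzero and the eliminated rows are
  independent.\<close>

lemma indep_on_insert:
  assumes "finite A" "a \<notin> A" "m0 \<in> S" "w a m0 \<noteq> 0"
    and ind: "indep_on S A (\<lambda>i m. w a m0 * w i m - w i m0 * w a m)"
  shows "indep_on S (insert a A) w"
  unfolding indep_on_def
proof (intro allI impI ballI)
  fix c i
  assume c: "\<forall>m\<in>S. (\<Sum>i\<in>insert a A. c i * w i m) = 0" and i: "i \<in> insert a A"
  have c': "(\<Sum>i\<in>A. c i * w i m) = - (c a * w a m)" if "m \<in> S" for m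
    using c that assms(1,2) by (simp add: add_eq_0_iff)
  have "(\<Sum>i\<in>A. c i * (w a m0 * w i m - w i m0 * w a m)) = 0" if "m \<in> S" for m
  proof -
    have "(\<Sum>i\<in>A. c i * (w a m0 * w i m - w i m0 * w a m)) =
      w a m0 * (\<Sum>i\<in>A. c i * w i m) - w a m * (\<Sum>i\<in>A. c i * w i m0)"
      by (simp only: right_diff_distrib sum_subtractf sum_distrib_left mult_ac)
    also have "\<dots> = 0" unfolding c'[OF that] c'[OF assms(3)] by algebra
    finally show ?thesis .
  qed
  then have A: "c i = 0" if "i \<in> A" for i using indep_onD[OF ind] that by blast
  then have "(\<Sum>i\<in>A. c i * w i m0) = 0" by simp
  then have "c a = 0" using c'[OF assms(3)] assms(4) by simp
  then show "c i = 0" using A i by blast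
qed

text \<open>Each elimination step removes one row and one column.\<close>

lemma indep_on_card_le:
  assumes "finite A" "finite S" "indep_on S A w"
  shows "card A \<le> card S"
  using assms
proof (induction A arbitrary: S w rule: finite_induct)
  case (insert a A)
  obtain m0 where m0: "m0 \<in> S" "w a m0 \<noteq> 0"
      "indep_on (S - {m0}) A (\<lambda>i m. w a m0 * w i m - w i m0 * w a m)"
    by (rule indep_on_eliminate[OF insert.hyps(1,2) insert.prems(2)])
  have "card A \<le> card (S - {m0})" using insert.IH[OF _ m0(3)] insert.prems by simp
  then show ?case using insert m0(1) card_gt_0_iff[of S] by (auto simp: card_Diff_singleton)
qed simp

lemma indep_on_mono: "indep_on S A w \<Longrightarrow> S \<subseteq> T \<Longrightarrow> indep_on T A w"
  by (auto simp: indep_on_def)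

text \<open>Independence is an open condition: \<open>p\<close> is the product of the pivots met
  while eliminating at \<open>x0\<close>. Closure of \<open>P\<close> under products and differences
  keeps all entries in \<open>P\<close>. It is applied both to polynomial functions of matrices and
  to polynomials in the parameter of a shear.\<close>

lemma indep_on_open:
  fixes w :: "'i \<Rightarrow> 'm \<Rightarrow> 'x \<Rightarrow> 'k::field"
  assumes P: "(\<lambda>_. 1) \<in> P" "\<And>f g. f \<in> P \<Longrightarrow> g \<in> P \<Longrightarrow> (\<lambda>x. f x * g x) \<in> P"
      "\<And>f g. f \<in> P \<Longrightarrow> g \<in> P \<Longrightarrow> (\<lambda>x. f x - g x) \<in> P"
    and "finite A" "\<And>i m. i \<in> A \<Longrightarrow> m \<in> S \<Longrightarrow> w i m \<in> P" "indep_on S A (\<lambda>i m. w i m x0)"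
  shows "\<exists>p\<in>P. p x0 \<noteq> 0 \<and> (\<forall>x. p x \<noteq> 0 \<longrightarrow> indep_on S A (\<lambda>i m. w i m x))"
  using assms(4-6)
proof (induction A arbitrary: w rule: finite_induct)
  case empty
  show ?case by (intro bexI[OF _ P(1)]) (auto simp: indep_on_def)
next
  case (insert a A)
  obtain m0 where m0: "m0 \<in> S" "w a m0 x0 \<noteq> 0"
    "indep_on (S - {m0}) A (\<lambda>i m. w a m0 x0 * w i m x0 - w i m0 x0 * w a m x0)"
    by (rule indep_on_eliminate[OF insert.hyps(1,2) insert.prems(2)])
  let ?w = "\<lambda>i m x. w a m0 x * w i m x - w i m0 x * w a m x"
  have "?w i m \<in> P" if "i \<in> A" "m \<in> S" for i m
    using that m0(1) insert.prems(1) by (intro P(2,3)) auto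
  moreover have "indep_on S A (\<lambda>i m. ?w i m x0)"
    using indep_on_mono[OF m0(3)] by blast
  ultimately obtain p where p: "p \<in> P" "p x0 \<noteq> 0" "\<And>x. p x \<noteq> 0 \<Longrightarrow> indep_on S A (\<lambda>i m. ?w i m x)"
    using insert.IH[of ?w] by blast
  have "indep_on S (insert a A) (\<lambda>i m. w i m x)" if "p x * w a m0 x \<noteq> 0" for x
    using indep_on_insert[of A a m0 S "\<lambda>i m. w i m x"] insert.hyps m0(1) p(3)[of x] that by simp
  then show ?case
    using P(2)[OF p(1) insert.prems(1)[of a m0]] m0(1,2) p(2) by (intro bexI[of _ "\<lambda>x. p x * w a m0 x"]) auto
qed

text \<open>In a vanishing combination, the largest leading position among the rows with nonzero
  coefficient receives a contribution from one row only.\<close>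

lemma indep_on_triangular:
  assumes "finite A" and L: "inj_on L A" "L ` A \<subseteq> S"
    and "transp lt" "asymp lt"
    and lead: "\<And>i. i \<in> A \<Longrightarrow> w i (L i) \<noteq> 0"
    and less: "\<And>i m. i \<in> A \<Longrightarrow> m \<in> S \<Longrightarrow> w i m \<noteq> 0 \<Longrightarrow> m = L i \<or> lt m (L i)"
  shows "indep_on S A w"
  unfolding indep_on_def
proof (intro allI impI, rule ccontr)
  fix c assume c: "\<forall>m\<in>S. (\<Sum>i\<in>A. c i * w i m) = 0" and "\<not> (\<forall>i\<in>A. c i = 0)"
  then have ne: "L ` {i \<in> A. c i \<noteq> 0} \<noteq> {}" by auto
  obtain m where m: "m \<in> L ` {i \<in> A. c i \<noteq> 0}" "\<forall>x\<in>L ` {i \<in> A. c i \<noteq> 0}. x \<noteq> m \<longrightarrow> \<not> lt m x"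
    using Finite_Set.bex_max_element[OF _ asymp_on_subset[OF assms(5) subset_UNIV]
        transp_on_subset[OF assms(4) subset_UNIV] ne] assms(1) by auto
  then obtain i where i: "i \<in> A" "c i \<noteq> 0" "m = L i" by auto
  have "c j * w j (L i) = 0" if "j \<in> A - {i}" for j
  proof (rule ccontr)
    assume j: "c j * w j (L i) \<noteq> 0"
    then have "L i = L j \<or> lt (L i) (L j)" using less[of j "L i"] that i L(2) by auto
    moreover have "L i \<noteq> L j" using L(1) that i by (auto simp: inj_on_def)
    ultimately show False using m(2) j that i(3) by auto
  qed
  then have "(\<Sum>j\<in>A - {i}. c j * w j (L i)) = 0" by (rule sum.neutral[OF ballI])
  then have "(\<Sum>j\<in>A. c j * w j (L i)) = c i * w i (L i)"
    using sum.remove[OF assms(1) i(1), of "\<lambda>j. c j * w j (L i)"] by simp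
  moreover have "L i \<in> S" using L(2) i(1) by auto
  ultimately show False using c lead[OF i(1)] i(2) by simp
qed

section \<open>Polynomial functions on matrices\<close>

text \<open>The functions \<open>eval_entries p\<close>, described by closure properties that suit
  induction; the inclusions are \<open>polyfun_eval_entries\<close> and
  \<open>polyfun_imp_eval_entries\<close>.\<close>

inductive_set polyfun :: "('k::field ^ 3 ^ 3 \<Rightarrow> 'k) set" where
  const: "(\<lambda>_. c) \<in> polyfun"
| entry: "(\<lambda>g. g $ i $ j) \<in> polyfun"
| add: "f \<in> polyfun \<Longrightarrow> h \<in> polyfun \<Longrightarrow> (\<lambda>g. f g + h g) \<in> polyfun"
| mult: "f \<in> polyfun \<Longrightarrow> h \<in> polyfun \<Longrightarrow> (\<lambda>g. f g * h g) \<in> polyfun"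

lemma polyfun_diff: "f \<in> polyfun \<Longrightarrow> h \<in> polyfun \<Longrightarrow> (\<lambda>g. f g - h g) \<in> polyfun"
  using polyfun.add[OF _ polyfun.mult[OF polyfun.const[of "-1"]], of f h] by simp

lemma polyfun_sum: "(\<And>x. x \<in> A \<Longrightarrow> f x \<in> polyfun) \<Longrightarrow> (\<lambda>g. \<Sum>x\<in>A. f x g) \<in> polyfun"
  by (induction A rule: infinite_finite_induct) (auto intro: polyfun.intros)

lemma polyfun_prod: "(\<And>x. x \<in> A \<Longrightarrow> f x \<in> polyfun) \<Longrightarrow> (\<lambda>g. \<Prod>x\<in>A. f x g) \<in> polyfun"
  by (induction A rule: infinite_finite_induct) (auto intro: polyfun.intros)

lemma polyfun_power: "f \<in> polyfun \<Longrightarrow> (\<lambda>g. f g ^ n) \<in> polyfun"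
  by (induction n) (auto intro: polyfun.intros)

lemma polyfun_eval_entries: "eval_entries p \<in> polyfun"
  unfolding eval_entries_def[abs_def]
  by (intro polyfun_sum polyfun.mult polyfun_prod polyfun_power polyfun.entry polyfun.const)

lemma eval_entries_superset:
  "finite A \<Longrightarrow> Poly_Mapping.keys p \<subseteq> A \<Longrightarrow>
    eval_entries p g = (\<Sum>e\<in>A. lk p e * (\<Prod>i\<in>UNIV. \<Prod>j\<in>UNIV. (g $ i $ j) ^ (e $ i $ j)))"
  unfolding eval_entries_def by (intro sum.mono_neutral_left) (auto simp: in_keys_iff)

lemma eval_entries_add: "eval_entries (p + q) g = eval_entries p g + eval_entries q g"
  by (simp add: eval_entries_superset[OF finite_UnI[OF finite_keys finite_keys] keys_add]
      eval_entries_superset[of "Poly_Mapping.keys p \<union> Poly_Mapping.keys q" p]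
      eval_entries_superset[of "Poly_Mapping.keys p \<union> Poly_Mapping.keys q" q]
      lookup_add distrib_right sum.distrib)

lemma eval_entries_0 [simp]: "eval_entries 0 g = 0"
  by (simp add: eval_entries_def)

lemma eval_entries_sum: "eval_entries (sum p A) g = (\<Sum>x\<in>A. eval_entries (p x) g)"
  by (induction A rule: infinite_finite_induct) (auto simp: eval_entries_add)

lemma eval_entries_single:
  "eval_entries (Poly_Mapping.single e c) g = c * (\<Prod>i\<in>UNIV. \<Prod>j\<in>UNIV. (g $ i $ j) ^ (e $ i $ j))"
  using eval_entries_superset[of "{e}" "Poly_Mapping.single e c" g] by simp

lemma eval_entries_mult: "eval_entries (p * q) g = eval_entries p g * eval_entries q g"
proof -
  have 1: "eval_entries (Poly_Mapping.single e c * Poly_Mapping.single e' c') g =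
      eval_entries (Poly_Mapping.single e c) g * eval_entries (Poly_Mapping.single e' c') g" for e c e' c'
    by (simp add: mult_single eval_entries_single power_add prod.distrib)
  have "eval_entries (p * q) g = eval_entries ((\<Sum>e\<in>Poly_Mapping.keys p. Poly_Mapping.single e (lk p e)) *
      (\<Sum>e\<in>Poly_Mapping.keys q. Poly_Mapping.single e (lk q e))) g"
    by (simp only: sum_single_lookup[symmetric])
  also have "\<dots> = eval_entries (\<Sum>e\<in>Poly_Mapping.keys p. Poly_Mapping.single e (lk p e)) g *
      eval_entries (\<Sum>e\<in>Poly_Mapping.keys q. Poly_Mapping.single e (lk q e)) g"
    by (simp only: sum_product eval_entries_sum 1)
  finally show ?thesis by (simp only: sum_single_lookup[symmetric])
qed

lemma polyfun_imp_eval_entries: "f \<in> polyfun \<Longrightarrow> \<exists>p. f = eval_entries p"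
proof (induction rule: polyfun.induct)
  case (const c)
  show ?case by (rule exI[of _ "Poly_Mapping.single 0 c"]) (simp add: fun_eq_iff eval_entries_single)
next
  case (entry i j)
  have "(\<Prod>a\<in>UNIV. \<Prod>b\<in>UNIV. (g $ a $ b) ^ (axis i (axis j 1) $ a $ b)) = g $ i $ j" for g :: "'a ^ 3 ^ 3"
  proof -
    have "(\<Prod>b\<in>UNIV. (g $ a $ b) ^ (axis i (axis j 1) $ a $ b)) = (if a = i then g $ i $ j else 1)" for a
      by (simp add: axis_def if_distrib[of "\<lambda>x. x $ _"] if_distrib[of "\<lambda>x. _ ^ x"] prod.delta cong: if_cong)
    then show ?thesis by (simp add: prod.delta)
  qed
  then show ?case
    by (intro exI[of _ "Poly_Mapping.single (axis i (axis j 1)) 1"]) (simp add: fun_eq_iff eval_entries_single)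
next
  case (add f h)
  then obtain p q where "f = eval_entries p" "h = eval_entries q" by blast
  then show ?case by (intro exI[of _ "p + q"]) (simp add: fun_eq_iff eval_entries_add)
next
  case (mult f h)
  then obtain p q where "f = eval_entries p" "h = eval_entries q" by blast
  then show ?case by (intro exI[of _ "p * q"]) (simp add: fun_eq_iff eval_entries_mult)
qed

lemma polyfun_line:
  assumes "f \<in> polyfun"
  shows "\<exists>q. \<forall>t. f (\<chi> i j. a $ i $ j + t * b $ i $ j) = poly q t"
  using assms
  proof (induction rule: polyfun.induct)
    case (const c) show ?case by (rule exI[of _ "[:c:]"]) simp
  next
    case (entry i j) show ?case by (rule exI[of _ "[:a $ i $ j, b $ i $ j:]"]) (simp add: mult.commute)
  next
    case (add f h)
    then obtain p q where "\<forall>t. f (\<chi> i j. a $ i $ j + t * b $ i $ j) = poly p t"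
      "\<forall>t. h (\<chi> i j. a $ i $ j + t * b $ i $ j) = poly q t" by blast
    then show ?case by (intro exI[of _ "p + q"]) simp
  next
    case (mult f h)
    then obtain p q where "\<forall>t. f (\<chi> i j. a $ i $ j + t * b $ i $ j) = poly p t"
      "\<forall>t. h (\<chi> i j. a $ i $ j + t * b $ i $ j) = poly q t" by blast
    then show ?case by (intro exI[of _ "p * q"]) simp
qed

lemma poly_nonzero_point:
  fixes q :: "'k::field_char_0 poly"
  assumes "q \<noteq> 0" "finite B"
  obtains t where "poly q t \<noteq> 0" "t \<notin> B"
proof -
  have "infinite (UNIV - ({t. poly q t = 0} \<union> B))"
    using poly_roots_finite[OF assms(1)] assms(2) infinite_UNIV_char_0 by (intro Diff_infinite_finite) auto
  then obtain t where "t \<in> UNIV - ({t. poly q t = 0} \<union> B)" by (metis ex_in_conv finite.emptyI)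
  then show thesis using that by blast
qed

text \<open>On the line through \<open>a\<close> and \<open>b\<close> both functions become nonzero
  polynomials in one variable, and their product has a non-root because the field is infinite. This
  is the irreducibility that makes nonempty open sets meet.\<close>

lemma polyfun_common_nonzero:
  fixes f h :: "'k::field_char_0 ^ 3 ^ 3 \<Rightarrow> 'k"
  assumes "f \<in> polyfun" "h \<in> polyfun" "f a \<noteq> 0" "h b \<noteq> 0"
  obtains g where "f g \<noteq> 0" "h g \<noteq> 0"
proof -
  let ?l = "\<lambda>t. \<chi> i j. a $ i $ j + t * (b - a) $ i $ j"
  obtain q where q: "\<forall>t. f (?l t) = poly q t" using polyfun_line[OF assms(1)] by blast
  obtain r where r: "\<forall>t. h (?l t) = poly r t" using polyfun_line[OF assms(2)] by blast
  have "?l 0 = a" "?l 1 = b" by (simp_all add: vec_eq_iff)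
  then have "poly q 0 \<noteq> 0" "poly r 1 \<noteq> 0" using q[rule_format, of 0] r[rule_format, of 1] assms(3,4) by auto
  then have "q * r \<noteq> 0" by auto
  then obtain t where "poly (q * r) t \<noteq> 0" using poly_nonzero_point[of "q * r" "{}"] by blast
  then show thesis using that[of "?l t"] q r by simp
qed

lemma polyfun_det: "det \<in> polyfun"
  unfolding det_3[abs_def] by (intro polyfun_diff polyfun.add polyfun.mult polyfun.entry)

text \<open>The property holds on a nonempty basic open set of the space of all matrices.
  Invertibility is itself generic, so \<open>generic_iff_zariski_open\<close> can pass to open
  subsets of the general linear group.\<close>

definition generic :: "('k::field ^ 3 ^ 3 \<Rightarrow> bool) \<Rightarrow> bool"
  where "generic P \<longleftrightarrow> (\<exists>p\<in>polyfun. (\<exists>g. p g \<noteq> 0) \<and> (\<forall>g. p g \<noteq> 0 \<longrightarrow> P g))"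

lemma generic_conj:
  fixes P Q :: "'k::field_char_0 ^ 3 ^ 3 \<Rightarrow> bool"
  assumes "generic P" "generic Q"
  shows "generic (\<lambda>g. P g \<and> Q g)"
proof -
  obtain p a where p: "p \<in> polyfun" "p a \<noteq> 0" "\<And>g. p g \<noteq> 0 \<Longrightarrow> P g" using assms(1) by (auto simp: generic_def)
  obtain q b where q: "q \<in> polyfun" "q b \<noteq> 0" "\<And>g. q g \<noteq> 0 \<Longrightarrow> Q g" using assms(2) by (auto simp: generic_def)
  obtain c where "p c \<noteq> 0" "q c \<noteq> 0" using polyfun_common_nonzero[OF p(1) q(1) p(2) q(2)] by blast
  then show ?thesis unfolding generic_def using p q polyfun.mult[OF p(1) q(1)]
    by (intro bexI[of _ "\<lambda>g. p g * q g"]) auto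
qed

lemma generic_ball:
  fixes P :: "'x \<Rightarrow> 'k::field_char_0 ^ 3 ^ 3 \<Rightarrow> bool"
  assumes "finite A" "\<And>x. x \<in> A \<Longrightarrow> generic (P x)"
  shows "generic (\<lambda>g. \<forall>x\<in>A. P x g)"
  using assms
proof (induction A rule: finite_induct)
  case empty
  show ?case using polyfun.const[of "1::'k"] by (auto simp: generic_def intro!: bexI[of _ "\<lambda>_. 1"])
next
  case (insert x A) then show ?case using generic_conj[of "P x" "\<lambda>g. \<forall>x\<in>A. P x g"] by simp
qed

lemma generic_mono: "generic P \<Longrightarrow> (\<And>g. P g \<Longrightarrow> Q g) \<Longrightarrow> generic Q"
  by (auto simp: generic_def)

lemma generic_ex: "generic P \<Longrightarrow> \<exists>g. P g"
  by (auto simp: generic_def)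

lemma generic_invertible: "generic (invertible :: 'k::field_char_0 ^ 3 ^ 3 \<Rightarrow> bool)"
  unfolding generic_def
  by (intro bexI[OF _ polyfun_det]) (auto simp: invertible_det_nz intro: exI[of _ "mat 1"])

lemma generic_iff_zariski_open:
  fixes P :: "'k::field_char_0 ^ 3 ^ 3 \<Rightarrow> bool"
  shows "generic P \<longleftrightarrow> (\<exists>U. zariski_open_GL3 U \<and> U \<noteq> {} \<and> (\<forall>g\<in>U. P g))"
proof
  assume "generic P"
  then obtain p where p: "p \<in> polyfun" "\<exists>g. p g \<noteq> 0" "\<And>g. p g \<noteq> 0 \<Longrightarrow> P g" by (auto simp: generic_def)
  obtain e where e: "p = eval_entries e" using polyfun_imp_eval_entries[OF p(1)] by blast
  let ?U = "{g. invertible g \<and> (\<exists>p\<in>{e}. eval_entries p g \<noteq> 0)}"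
  have "generic (\<lambda>g. p g \<noteq> 0)" using p by (auto simp: generic_def)
  from generic_ex[OF generic_conj[OF generic_invertible this]] have "?U \<noteq> {}" using e by auto
  moreover have "zariski_open_GL3 ?U" unfolding zariski_open_GL3_def by blast
  ultimately show "\<exists>U. zariski_open_GL3 U \<and> U \<noteq> {} \<and> (\<forall>g\<in>U. P g)" using p(3) e by blast
next
  assume "\<exists>U. zariski_open_GL3 U \<and> U \<noteq> {} \<and> (\<forall>g\<in>U. P g)"
  then obtain S where S: "{g. invertible g \<and> (\<exists>p\<in>S. eval_entries p g \<noteq> 0)} \<noteq> {}"
    "\<And>g. invertible g \<Longrightarrow> \<exists>p\<in>S. eval_entries p g \<noteq> 0 \<Longrightarrow> P g"
    unfolding zariski_open_GL3_def by blast
  then obtain g p where "p \<in> S" "eval_entries p g \<noteq> 0" by blast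
  then have "generic (\<lambda>g. eval_entries p g \<noteq> 0)" using polyfun_eval_entries unfolding generic_def by blast
  from generic_mono[OF generic_conj[OF generic_invertible this]] show "generic P"
    using S(2) \<open>p \<in> S\<close> by blast
qed

section \<open>Leading monomials\<close>

lemma revlex_transp: "transp revlex_less"
  by (auto simp: transp_def revlex_less_def)

lemma revlex_asymp: "asymp revlex_less"
  by (auto simp: asymp_on_def revlex_less_def)

lemma revlex_trans: "revlex_less u v \<Longrightarrow> revlex_less v w \<Longrightarrow> revlex_less u w"
  by (auto simp: revlex_less_def)

lemma revlex_irrefl [simp]: "\<not> revlex_less u u"
  by (auto simp: revlex_less_def)

lemma revlex_total: "u \<noteq> v \<Longrightarrow> revlex_less u v \<or> revlex_less v u"
  by (auto simp: revlex_less_def vec_eq_iff forall_3 mdeg_sum3)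

lemma revlex_add: "revlex_less (a + u) (a + v) \<longleftrightarrow> revlex_less u v"
  by (auto simp: revlex_less_def mdeg_add)

lemma is_lead_monomialD:
  "is_lead_monomial f m \<Longrightarrow> lk f m \<noteq> 0"
  "is_lead_monomial f m \<Longrightarrow> lk f l \<noteq> 0 \<Longrightarrow> l = m \<or> revlex_less l m"
  by (auto simp: is_lead_monomial_def in_keys_iff)

lemma is_lead_monomialI:
  "lk f m \<noteq> 0 \<Longrightarrow> (\<And>l. lk f l \<noteq> 0 \<Longrightarrow> l = m \<or> revlex_less l m) \<Longrightarrow> is_lead_monomial f m"
  by (auto simp: is_lead_monomial_def in_keys_iff)

lemma lead_exists:
  assumes "f \<noteq> 0"
  obtains m where "is_lead_monomial f m"
proof -
  have "Poly_Mapping.keys f \<noteq> {}" using assms by simp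
  from Finite_Set.bex_max_element[OF finite_keys asymp_on_subset[OF revlex_asymp subset_UNIV]
      transp_on_subset[OF revlex_transp subset_UNIV] this]
  obtain m where m: "m \<in> Poly_Mapping.keys f" "\<forall>x\<in>Poly_Mapping.keys f. x \<noteq> m \<longrightarrow> \<not> revlex_less m x"
    by blast
  then have "is_lead_monomial f m" unfolding is_lead_monomial_def using revlex_total by blast
  then show thesis by (rule that)
qed

definition leads :: "'k::zero mpoly3 set \<Rightarrow> mon set"
  where "leads J = {m. \<exists>f\<in>J. is_lead_monomial f m}"

lemma leads_rcomp: "J \<subseteq> rcomp d \<Longrightarrow> leads J \<subseteq> {m. int (mdeg m) = d}"
  using is_lead_monomialD(1) by (fastforce simp: leads_def rcomp_def)

lemma finite_int_mdeg: "finite {m. int (mdeg m) = d}"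
  by (rule finite_subset[OF _ finite_mdeg[of "nat d"]]) auto

lemma finite_leads: "J \<subseteq> rcomp d \<Longrightarrow> finite (leads J)"
  by (rule finite_subset[OF leads_rcomp finite_int_mdeg])

lemma rvec_sum_mem:
  "rvec.subspace J \<Longrightarrow> (\<And>i. i \<in> A \<Longrightarrow> f i \<in> J) \<Longrightarrow> (\<Sum>i\<in>A. rscale (c i) (f i)) \<in> J"
  by (intro rvec.subspace_sum rvec.subspace_scale)

text \<open>A basis is independent already in the columns \<open>leads S\<close>, since a nonzero
  combination has its leading monomial there. Conversely, elements chosen with distinct leading
  monomials form a triangular system.\<close>

lemma dim_eq_card_leads:
  assumes sub: "rvec.subspace S" and S: "S \<subseteq> rcomp d"
  shows "rvec.dim S = card (leads S)"
proof (rule antisym)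
  have fin: "rvec.fin_subspace S" by (rule rvec.fin_subspace_subset[OF fin_rcomp sub S])
  obtain B where B: "finite B" "B \<subseteq> S" "rvec.independent B" "rvec.span B = S" "card B = rvec.dim S"
    by (rule rvec.fin_subspace_basis[OF fin])
  have "indep_on (leads S) B (\<lambda>f m. lk f m)"
    unfolding indep_on_def
  proof (intro allI impI)
    fix c assume c: "\<forall>m\<in>leads S. (\<Sum>f\<in>B. c f * lk f m) = 0"
    let ?g = "\<Sum>f\<in>B. rscale (c f) f"
    have g: "?g \<in> S" using B(2) by (intro rvec_sum_mem[OF sub]) auto
    have "?g = 0"
    proof (rule ccontr)
      assume "?g \<noteq> 0"
      then obtain m where m: "is_lead_monomial ?g m" by (rule lead_exists)
      then have "m \<in> leads S" using g by (auto simp: leads_def)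
      then show False using c is_lead_monomialD(1)[OF m] by (simp add: lookup_sum)
    qed
    then show "\<forall>f\<in>B. c f = 0" using B(1,3) rvec.independentD[of B B c] by auto
  qed
  from indep_on_card_le[OF B(1) finite_leads[OF S] this] show "rvec.dim S \<le> card (leads S)"
    using B(5) by simp
next
  have fin: "rvec.fin_subspace S" by (rule rvec.fin_subspace_subset[OF fin_rcomp sub S])
  have "\<forall>m\<in>leads S. \<exists>f. f \<in> S \<and> is_lead_monomial f m" by (auto simp: leads_def)
  then obtain F where F: "\<And>m. m \<in> leads S \<Longrightarrow> F m \<in> S" "\<And>m. m \<in> leads S \<Longrightarrow> is_lead_monomial (F m) m"
    by (auto simp: bchoice_iff)
  have ind: "indep_on UNIV (leads S) (\<lambda>m. lk (F m))"
  proof (rule indep_on_triangular[where L = "\<lambda>m. m" and lt = revlex_less])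
    show "lk (F m) m \<noteq> 0" if "m \<in> leads S" for m using is_lead_monomialD(1)[OF F(2)[OF that]] .
    show "l = m \<or> revlex_less l m" if "m \<in> leads S" "lk (F m) l \<noteq> 0" for m l
      using is_lead_monomialD(2)[OF F(2)[OF that(1)] that(2)] .
  qed (simp_all add: finite_leads[OF S] revlex_transp revlex_asymp)
  have inj: "inj_on F (leads S)"
  proof (rule inj_onI)
    fix a b assume ab: "a \<in> leads S" "b \<in> leads S" "F a = F b"
    then have "is_lead_monomial (F a) b" using F(2)[of b] by simp
    then show "a = b" using F(2)[OF ab(1)] is_lead_monomialD revlex_trans revlex_irrefl by metis
  qed
  have "rvec.independent (F ` leads S)"
  proof (rule rvec.independent_if_scalars_zero)
    show "finite (F ` leads S)" using finite_leads[OF S] by simp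
    fix c x assume c: "(\<Sum>x\<in>F ` leads S. rscale (c x) x) = 0" and x: "x \<in> F ` leads S"
    have "(\<Sum>m\<in>leads S. c (F m) * lk (F m) l) = 0" for l
      using arg_cong[OF c, of "\<lambda>f. lk f l"] by (simp add: lookup_sum sum.reindex[OF inj])
    then have "\<forall>m\<in>leads S. c (F m) = 0"
      using ind[unfolded indep_on_def, rule_format, of "\<lambda>m. c (F m)"] by simp
    then show "c x = 0" using x by auto
  qed
  from rvec.fin_subspace_independent(2)[OF fin this] show "card (leads S) \<le> rvec.dim S"
    using F(1) card_image[OF inj] by auto
qed

text \<open>For a space of forms, the number of leading monomials in such an upper segment is the
  rank of the coefficient matrix in these columns.\<close>

definition revlex_above :: "mon \<Rightarrow> mon set"
  where "revlex_above u = {m. mdeg m = mdeg u \<and> \<not> revlex_less m u}"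

lemma finite_revlex_above: "finite (revlex_above u)"
  by (rule finite_subset[OF _ finite_mdeg[of "mdeg u"]]) (auto simp: revlex_above_def)

lemma revlex_above_self: "u \<in> revlex_above u"
  by (simp add: revlex_above_def)

text \<open>If a combination has a nonzero coefficient in the upper segment, its leading monomial
  lies there too. So independence in all columns of the segment gives independence in those that are
  leading monomials, and rows cannot outnumber columns.\<close>

lemma card_leads_ge:
  assumes sub: "rvec.subspace J" and A: "finite A"
    and f: "\<And>i. i \<in> A \<Longrightarrow> f i \<in> J" "\<And>i. i \<in> A \<Longrightarrow> f i \<in> rcomp (int (mdeg u))"
    and ind: "indep_on (revlex_above u) A (\<lambda>i. lk (f i))"
  shows "card A \<le> card (leads J \<inter> revlex_above u)"
proof (rule indep_on_card_le[OF A])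
  show "finite (leads J \<inter> revlex_above u)" using finite_revlex_above by blast
  show "indep_on (leads J \<inter> revlex_above u) A (\<lambda>i. lk (f i))"
    unfolding indep_on_def
  proof (intro allI impI)
    fix c assume c: "\<forall>m\<in>leads J \<inter> revlex_above u. (\<Sum>i\<in>A. c i * lk (f i) m) = 0"
    let ?g = "\<Sum>i\<in>A. rscale (c i) (f i)"
    have g: "?g \<in> J" "?g \<in> rcomp (int (mdeg u))"
      using f by (auto intro!: rvec_sum_mem sub subspace_rcomp)
    have "lk ?g m = 0" if m: "m \<in> revlex_above u" for m
    proof (rule ccontr)
      assume "lk ?g m \<noteq> 0"
      then have "?g \<noteq> 0" by auto
      then obtain l where l: "is_lead_monomial ?g l" by (rule lead_exists)
      have "m = l \<or> revlex_less m l" using is_lead_monomialD(2)[OF l \<open>lk ?g m \<noteq> 0\<close>] .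
      moreover have "mdeg l = mdeg u" using g(2) is_lead_monomialD(1)[OF l] by (auto simp: rcomp_def)
      ultimately have "l \<in> revlex_above u" using m revlex_trans by (auto simp: revlex_above_def)
      moreover have "l \<in> leads J" using l g(1) by (auto simp: leads_def)
      ultimately have "(\<Sum>i\<in>A. c i * lk (f i) l) = 0" using c by blast
      then show False using is_lead_monomialD(1)[OF l] by (simp add: lookup_sum)
    qed
    then have "\<forall>m\<in>revlex_above u. (\<Sum>i\<in>A. c i * lk (f i) m) = 0" by (simp add: lookup_sum)
    then show "\<forall>i\<in>A. c i = 0" using ind by (simp add: indep_on_def)
  qed
qed

lemma lookup_single_mult_nonzero:
  fixes f :: "'k::field mpoly3"
  assumes "lk (Poly_Mapping.single a c * f) k \<noteq> 0"
  obtains k' where "k = a + k'" "lk f k' \<noteq> 0"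
proof -
  obtain m where "m \<in> Poly_Mapping.keys f" "(c * lk f m when a + m = k) \<noteq> 0"
    using assms unfolding lookup_single_mult by (meson sum.neutral)
  then show thesis using that[of m] by (auto simp: when_def in_keys_iff split: if_splits)
qed

lemma lead_single_mult:
  fixes f :: "'k::field mpoly3"
  assumes "is_lead_monomial f m" "c \<noteq> 0"
  shows "is_lead_monomial (Poly_Mapping.single a c * f) (a + m)"
proof (rule is_lead_monomialI)
  show "lk (Poly_Mapping.single a c * f) (a + m) \<noteq> 0" using is_lead_monomialD(1)[OF assms(1)] assms(2) by simp
  fix l assume "lk (Poly_Mapping.single a c * f) l \<noteq> 0"
  then obtain k where "l = a + k" "lk f k \<noteq> 0" by (rule lookup_single_mult_nonzero)
  then show "l = a + m \<or> revlex_less l (a + m)" using is_lead_monomialD(2)[OF assms(1)] by (auto simp: revlex_add)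
qed

lemma leads_add:
  fixes J :: "'k::field mpoly3 set"
  assumes "ideal.subspace J" "m \<in> leads J"
  shows "a + m \<in> leads J"
proof -
  obtain f where f: "f \<in> J" "is_lead_monomial f m" using assms(2) by (auto simp: leads_def)
  have "Poly_Mapping.single a 1 * f \<in> J" by (rule ideal.subspace_scale[OF assms(1) f(1)])
  then show ?thesis using lead_single_mult[OF f(2), of 1 a] by (auto simp: leads_def)
qed

lemma lead_rpart:
  fixes f :: "'k::field mpoly3"
  assumes "is_lead_monomial f m"
  shows "is_lead_monomial (rpart (int (mdeg m)) f) m"
  using is_lead_monomialD[OF assms] by (intro is_lead_monomialI) (auto simp: when_def split: if_splits)

lemma leads_graded:
  fixes J :: "'k::field mpoly3 set"
  assumes "\<And>f d. f \<in> J \<Longrightarrow> rpart d f \<in> J"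
  shows "leads (J \<inter> rcomp (int d)) = {m \<in> leads J. mdeg m = d}"
proof (intro equalityI subsetI)
  fix m assume "m \<in> leads (J \<inter> rcomp (int d))"
  then show "m \<in> {m \<in> leads J. mdeg m = d}"
    using leads_rcomp[of "J \<inter> rcomp (int d)" "int d"] by (auto simp: leads_def)
next
  fix m assume m: "m \<in> {m \<in> leads J. mdeg m = d}"
  then obtain f where f: "f \<in> J" "is_lead_monomial f m" by (auto simp: leads_def)
  have "rpart (int d) f \<in> J \<inter> rcomp (int d)" using assms f(1) rpart_V by auto
  moreover have "is_lead_monomial (rpart (int d) f) m" using lead_rpart[OF f(2)] m by simp
  ultimately show "m \<in> leads (J \<inter> rcomp (int d))" unfolding leads_def by blast
qed

definition monomial_span :: "mon set \<Rightarrow> 'k::zero mpoly3 set"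
  where "monomial_span G = {f. \<forall>m. lk f m \<noteq> 0 \<longrightarrow> m \<in> G}"

lemma subspace_monomial_span:
  assumes "\<And>a m. m \<in> G \<Longrightarrow> a + m \<in> G"
  shows "ideal.subspace (monomial_span G :: 'k::field mpoly3 set)"
  unfolding ideal.subspace_def
proof (intro conjI ballI allI)
  show "0 \<in> (monomial_span G :: 'k mpoly3 set)" by (simp add: monomial_span_def)
  fix f :: "'k mpoly3" assume f: "f \<in> monomial_span G"
  show "f + h \<in> monomial_span G" if h: "h \<in> monomial_span G" for h
    unfolding monomial_span_def
  proof (intro CollectI allI impI)
    fix m assume "lk (f + h) m \<noteq> 0"
    then show "m \<in> G" using f h by (cases "lk f m = 0") (simp_all add: monomial_span_def lookup_add)
  qed
  show "r * f \<in> monomial_span G" for r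
    unfolding monomial_span_def
  proof (intro CollectI allI impI)
    fix m assume "lk (r * f) m \<noteq> 0"
    then obtain a b where "m = a + b" "b \<in> Poly_Mapping.keys f"
      using keys_mult[of r f] by (auto simp: in_keys_iff[symmetric])
    then show "m \<in> G" using f assms by (simp add: monomial_span_def in_keys_iff)
  qed
qed

lemma span_monomials:
  assumes "\<And>a m. m \<in> G \<Longrightarrow> a + m \<in> G"
  shows "ideal.span {Poly_Mapping.single m 1 | m. m \<in> G} = (monomial_span G :: 'k::field mpoly3 set)"
proof (rule antisym)
  show "ideal.span {Poly_Mapping.single m 1 | m. m \<in> G} \<subseteq> (monomial_span G :: 'k mpoly3 set)"
    by (rule ideal.span_minimal[OF _ subspace_monomial_span[OF assms]])
      (auto simp: monomial_span_def lookup_single when_def split: if_splits)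
  show "(monomial_span G :: 'k mpoly3 set) \<subseteq> ideal.span {Poly_Mapping.single m 1 | m. m \<in> G}"
  proof
    fix f :: "'k mpoly3" assume f: "f \<in> monomial_span G"
    have "(\<Sum>m\<in>Poly_Mapping.keys f. Const (lk f m) * Poly_Mapping.single m 1) \<in>
        ideal.span {Poly_Mapping.single m 1 | m. m \<in> G}"
      using f by (intro ideal.span_sum ideal.span_scale ideal.span_base) (auto simp: monomial_span_def in_keys_iff)
    also have "(\<Sum>m\<in>Poly_Mapping.keys f. Const (lk f m) * Poly_Mapping.single m 1) =
        (\<Sum>m\<in>Poly_Mapping.keys f. Poly_Mapping.single m (lk f m))"
      by (simp add: Const_def mult_single)
    also have "\<dots> = f" by (rule sum_single_lookup[symmetric])
    finally show "f \<in> ideal.span {Poly_Mapping.single m 1 | m. m \<in> G}" .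
  qed
qed

lemma initial_ideal_eq:
  assumes "ideal.subspace J"
  shows "initial_ideal J = monomial_span (leads J)"
  unfolding initial_ideal_def
  by (subst span_monomials[symmetric, OF leads_add[OF assms]]) (simp_all add: leads_def)

section \<open>Linear substitutions\<close>

definition linear_form :: "'k::field ^ 3 ^ 3 \<Rightarrow> 3 \<Rightarrow> 'k mpoly3"
  where "linear_form g j = (\<Sum>i\<in>UNIV. Const (g $ i $ j) * Var i)"

definition mon_subst :: "'k::field ^ 3 ^ 3 \<Rightarrow> mon \<Rightarrow> 'k mpoly3"
  where "mon_subst g m = (\<Prod>j\<in>UNIV. linear_form g j ^ (m $ j))"

lemma linear_subst_superset:
  assumes "finite A" "Poly_Mapping.keys f \<subseteq> A"
  shows "linear_subst g f = (\<Sum>m\<in>A. Const (lk f m) * mon_subst g m)"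
  unfolding linear_subst_def mon_subst_def linear_form_def
  using assms by (intro sum.mono_neutral_left) (auto simp: in_keys_iff)

lemma linear_subst_single: "linear_subst g (Poly_Mapping.single m c) = Const c * mon_subst g m"
  using linear_subst_superset[of "{m}" "Poly_Mapping.single m c" g] by simp

lemma linear_subst_add: "linear_subst g (f + h) = linear_subst g f + linear_subst g h"
  using linear_subst_superset[OF finite_UnI[OF finite_keys[of f] finite_keys[of h]] keys_add, of g]
    linear_subst_superset[OF finite_UnI[OF finite_keys[of f] finite_keys[of h]] Un_upper1, of g]
    linear_subst_superset[OF finite_UnI[OF finite_keys[of f] finite_keys[of h]] Un_upper2, of g]
  by (simp add: lookup_add Const_add distrib_right sum.distrib)

lemma linear_subst_0 [simp]: "linear_subst g 0 = 0"
  by (simp add: linear_subst_def)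

lemma linear_subst_sum: "linear_subst g (sum f A) = (\<Sum>x\<in>A. linear_subst g (f x))"
  by (induction A rule: infinite_finite_induct) (auto simp: linear_subst_add)

lemma mon_subst_add: "mon_subst g (a + b) = mon_subst g a * mon_subst g b"
  by (simp add: mon_subst_def power_add prod.distrib)

lemma mon_subst_0 [simp]: "mon_subst g 0 = 1"
  by (simp add: mon_subst_def)

lemma mon_subst_axis: "mon_subst g (axis j 1) = linear_form g j"
proof -
  have "mon_subst g (axis j 1) = (\<Prod>l\<in>UNIV. if l = j then linear_form g l else 1)"
    unfolding mon_subst_def by (intro prod.cong) (auto simp: axis_def)
  then show ?thesis by (simp add: prod.delta)
qed

lemma linear_subst_mult: "linear_subst g (f * h) = linear_subst g f * linear_subst g h"
proof -
  have 1: "linear_subst g (Poly_Mapping.single a c * Poly_Mapping.single b d) =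
      linear_subst g (Poly_Mapping.single a c) * linear_subst g (Poly_Mapping.single b d)" for a b c d
    by (simp add: mult_single linear_subst_single mon_subst_add Const_mult)
  have "linear_subst g (f * h) = linear_subst g ((\<Sum>m\<in>Poly_Mapping.keys f. Poly_Mapping.single m (lk f m)) *
      (\<Sum>m\<in>Poly_Mapping.keys h. Poly_Mapping.single m (lk h m)))"
    by (simp only: sum_single_lookup[symmetric])
  also have "\<dots> = linear_subst g (\<Sum>m\<in>Poly_Mapping.keys f. Poly_Mapping.single m (lk f m)) *
      linear_subst g (\<Sum>m\<in>Poly_Mapping.keys h. Poly_Mapping.single m (lk h m))"
    by (simp only: sum_product linear_subst_sum 1)
  finally show ?thesis by (simp only: sum_single_lookup[symmetric])
qed

lemma linear_subst_Const [simp]: "linear_subst g (Const c) = Const c"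
  using linear_subst_single[of g 0 c] by (simp add: Const_def)

lemma linear_subst_Var [simp]: "linear_subst g (Var j) = linear_form g j"
  using linear_subst_single[of g "axis j 1" 1] by (simp add: Var_def mon_subst_axis[unfolded One_nat_def])

lemma linear_subst_1 [simp]: "linear_subst g 1 = 1"
  using linear_subst_Const[of g 1] by simp

lemma linear_subst_power: "linear_subst g (f ^ n) = linear_subst g f ^ n"
  by (induction n) (auto simp: linear_subst_mult)

lemma linear_subst_prod: "linear_subst g (prod f A) = (\<Prod>x\<in>A. linear_subst g (f x))"
  by (induction A rule: infinite_finite_induct) (auto simp: linear_subst_mult)

lemma Const_sum: "Const (sum f A) = (\<Sum>x\<in>A. Const (f x))"
  by (induction A rule: infinite_finite_induct) (auto simp: Const_add)

lemma linear_subst_linear_form: "linear_subst g (linear_form h j) = linear_form (g ** h) j"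
proof -
  have "linear_subst g (linear_form h j) = (\<Sum>i\<in>UNIV. Const (h $ i $ j) * (\<Sum>l\<in>UNIV. Const (g $ l $ i) * Var l))"
    by (simp add: linear_form_def[of h] linear_subst_sum linear_subst_mult linear_form_def[of g])
  also have "\<dots> = (\<Sum>l\<in>UNIV. \<Sum>i\<in>UNIV. Const (g $ l $ i * h $ i $ j) * Var l)"
    by (subst sum.swap, simp only: sum_distrib_left Const_mult mult_ac)
  also have "\<dots> = linear_form (g ** h) j"
    by (simp add: linear_form_def matrix_matrix_mult_def Const_sum sum_distrib_right)
  finally show ?thesis .
qed

lemma linear_subst_compose: "linear_subst g (linear_subst h f) = linear_subst (g ** h) f"
proof -
  have 1: "linear_subst g (mon_subst h m) = mon_subst (g ** h) m" for m
    by (simp add: mon_subst_def linear_subst_prod linear_subst_power linear_subst_linear_form)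
  have "linear_subst g (linear_subst h f) =
      linear_subst g (\<Sum>m\<in>Poly_Mapping.keys f. Const (lk f m) * mon_subst h m)"
    using linear_subst_superset[OF finite_keys subset_refl, of h f] by simp
  also have "\<dots> = (\<Sum>m\<in>Poly_Mapping.keys f. Const (lk f m) * mon_subst (g ** h) m)"
    by (simp add: linear_subst_sum linear_subst_mult 1)
  also have "\<dots> = linear_subst (g ** h) f"
    using linear_subst_superset[OF finite_keys subset_refl, of "g ** h" f] by simp
  finally show ?thesis .
qed

lemma linear_form_mat_1 [simp]: "linear_form (mat 1) j = Var j"
proof -
  have "linear_form (mat 1) j = (\<Sum>i\<in>UNIV. if i = j then Var i else 0)"
    unfolding linear_form_def by (intro sum.cong) (auto simp: mat_def)
  then show ?thesis by simp
qed

lemma prod_UNIV_3: "(\<Prod>j\<in>UNIV. f j) = f 1 * f 2 * f (3 :: 3)"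
  unfolding UNIV_3 by (simp add: mult.assoc)

lemma Var_power: "Var j ^ n = Poly_Mapping.single (axis j n) (1 :: 'k::field)"
proof (induction n)
  case 0
  have "axis j 0 = (0 :: mon)" by (simp add: vec_eq_iff axis_def)
  then show ?case by (simp only: power_0 single_one)
next
  case (Suc n)
  have "axis j 1 + axis j n = (axis j (Suc n) :: mon)" by (simp add: vec_eq_iff axis_def)
  then show ?case using Suc by (simp add: Var_def mult_single)
qed

lemma prod_Var: "(\<Prod>j\<in>UNIV. Var j ^ (m $ j)) = Poly_Mapping.single m (1 :: 'k::field)"
proof -
  have "axis 1 (m $ 1) + axis 2 (m $ 2) + axis 3 (m $ 3) = m"
    by (simp add: vec_eq_iff forall_3 axis_def)
  then show ?thesis by (simp add: prod_UNIV_3 Var_power mult_single)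
qed

lemma linear_subst_mat_1 [simp]: "linear_subst (mat 1) f = f"
proof -
  have "linear_subst (mat 1) f = (\<Sum>m\<in>Poly_Mapping.keys f. Const (lk f m) * Poly_Mapping.single m 1)"
    using linear_subst_superset[OF finite_keys subset_refl, of "mat 1" f] by (simp add: mon_subst_def prod_Var)
  also have "\<dots> = (\<Sum>m\<in>Poly_Mapping.keys f. Poly_Mapping.single m (lk f m))"
    by (simp add: Const_def mult_single)
  also have "\<dots> = f" by (rule sum_single_lookup[symmetric])
  finally show ?thesis .
qed

lemma Const_rcomp: "Const c \<in> rcomp 0"
  by (auto simp: rcomp_def Const_def lookup_single when_def split: if_splits)

lemma rcomp_sum: "(\<And>x. x \<in> A \<Longrightarrow> f x \<in> rcomp d) \<Longrightarrow> (sum f A :: 'k::field mpoly3) \<in> rcomp d"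
  by (intro rvec.subspace_sum subspace_rcomp)

lemma linear_form_rcomp: "linear_form g j \<in> rcomp 1"
  unfolding linear_form_def
  by (intro rcomp_sum) (use rcomp_mult[OF Const_rcomp Var_rcomp] in simp)

lemma rcomp_power: "f \<in> rcomp d \<Longrightarrow> f ^ n \<in> rcomp (int n * d)" for f :: "'k::field mpoly3"
proof (induction n)
  case 0
  have "(1 :: 'k mpoly3) \<in> rcomp 0" using Const_rcomp[of "1 :: 'k"] by (simp only: Const_1)
  then show ?case by simp
next
  case (Suc n) then show ?case using rcomp_mult[of f d "f ^ n" "int n * d"] by (simp add: algebra_simps)
qed

lemma mon_subst_rcomp: "mon_subst g m \<in> rcomp (int (mdeg m))"
proof -
  have "linear_form g j ^ (m $ j) \<in> rcomp (int (m $ j))" for j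
    using rcomp_power[OF linear_form_rcomp, of g j "m $ j"] by simp
  from rcomp_mult[OF rcomp_mult[OF this[of 1] this[of 2]] this[of 3]]
  show ?thesis by (simp add: mon_subst_def prod_UNIV_3 mdeg_sum3)
qed

lemma rpart_linear_subst: "rpart d (linear_subst g f) = linear_subst g (rpart d f)"
proof -
  have "rpart d (Const (lk f m) * mon_subst g m) = Const (lk (rpart d f) m) * mon_subst g m" for m
  proof -
    have "Const (lk f m) * mon_subst g m \<in> rcomp (int (mdeg m))"
      using rcomp_mult[OF Const_rcomp mon_subst_rcomp, of "lk f m" g m] by simp
    from rpart_id[OF this] rpart_other[OF this, of d] show ?thesis
      by (cases "d = int (mdeg m)") auto
  qed
  moreover have "linear_subst g f = (\<Sum>m\<in>Poly_Mapping.keys f. Const (lk f m) * mon_subst g m)"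
    by (rule linear_subst_superset) auto
  moreover have "linear_subst g (rpart d f) = (\<Sum>m\<in>Poly_Mapping.keys f. Const (lk (rpart d f) m) * mon_subst g m)"
    by (rule linear_subst_superset) (auto simp: in_keys_iff)
  ultimately show ?thesis by (simp add: rpart_sum_distrib)
qed

lemma linear_subst_rcomp: "f \<in> rcomp d \<Longrightarrow> linear_subst g f \<in> rcomp d"
  using rpart_linear_subst[of d g f] rpart_V[of d "linear_subst g f"] by (simp add: rpart_id)

text \<open>The property passes through multiplication by the linear forms, one factor at a time,
  which avoids a multinomial expansion.\<close>

lemma linear_subst_coeff_polyfun:
  fixes f :: "'k::field mpoly3"
  shows "(\<lambda>g. lk (linear_subst g f) m) \<in> polyfun"
proof -
  define good where "good F \<longleftrightarrow> (\<forall>m. (\<lambda>g. lk (F g) m) \<in> polyfun)" for F :: "'k::field ^ 3 ^ 3 \<Rightarrow> 'k mpoly3"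
  have 1: "good (\<lambda>g. linear_form g j * F g)" if "good F" for F j
    unfolding good_def
  proof
    fix m
    have "(\<lambda>g. \<Sum>i\<in>UNIV. g $ i $ j * (if m $ i = 0 then 0 else lk (F g) (m - axis i 1))) \<in> polyfun"
    proof (intro polyfun_sum polyfun.mult polyfun.entry)
      fix i
      show "(\<lambda>g. if m $ i = 0 then 0 else lk (F g) (m - axis i 1)) \<in> polyfun"
        using that by (cases "m $ i = 0") (simp_all add: good_def polyfun.const)
    qed
    moreover have "lk (linear_form g j * F g) m =
        (\<Sum>i\<in>UNIV. g $ i $ j * (if m $ i = 0 then 0 else lk (F g) (m - axis i 1)))" for g
      by (simp only: linear_form_def sum_distrib_right lookup_sum mult.assoc lookup_Const_mult lookup_Var_mult)
    ultimately show "(\<lambda>g. lk (linear_form g j * F g) m) \<in> polyfun" by simp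
  qed
  have 2: "good (\<lambda>g. linear_form g j ^ n * F g)" if "good F" for F j n
    using that
  proof (induction n)
    case (Suc n)
    from 1[OF Suc.IH[OF Suc.prems], of j] show ?case by (simp only: power_Suc mult.assoc)
  qed simp
  have "good (\<lambda>g. 1)" by (auto simp: good_def polyfun.const)
  then have "good (\<lambda>g. linear_form g 1 ^ (m $ 1) * (linear_form g 2 ^ (m $ 2) * (linear_form g 3 ^ (m $ 3) * 1)))"
    for m :: mon by (intro 2)
  then have 3: "good (\<lambda>g. mon_subst g m)" for m
    by (simp only: mon_subst_def prod_UNIV_3 mult.assoc mult_1_right)
  have "lk (linear_subst g f) m = (\<Sum>a\<in>Poly_Mapping.keys f. lk f a * lk (mon_subst g a) m)" for g
    by (simp add: linear_subst_superset[OF finite_keys subset_refl] lookup_sum)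
  moreover have "(\<lambda>g. \<Sum>a\<in>Poly_Mapping.keys f. lk f a * lk (mon_subst g a) m) \<in> polyfun"
  proof (intro polyfun_sum polyfun.mult polyfun.const)
    fix a show "(\<lambda>g. lk (mon_subst g a :: 'k mpoly3) m) \<in> polyfun" using 3[of a] unfolding good_def by blast
  qed
  ultimately show ?thesis by simp
qed

lemma invertible_linear_subst:
  assumes "invertible g"
  shows "\<exists>g'. (\<forall>f. linear_subst g' (linear_subst g f) = f) \<and>
    (\<forall>f. linear_subst g (linear_subst g' f) = f) \<and> invertible g'"
proof -
  obtain g' where "g ** g' = mat 1" "g' ** g = mat 1" using assms by (auto simp: invertible_def)
  then show ?thesis by (intro exI[of _ g']) (auto simp: linear_subst_compose invertible_def)
qed

lemma subspace_linear_subst: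
  assumes "invertible g" "ideal.subspace I"
  shows "ideal.subspace (linear_subst g ` I)"
  unfolding ideal.subspace_def
proof (intro conjI ballI allI)
  obtain g' where g': "\<forall>f. linear_subst g (linear_subst g' f) = f"
    using invertible_linear_subst[OF assms(1)] by blast
  show "0 \<in> linear_subst g ` I" using ideal.subspace_0[OF assms(2)] linear_subst_0 by (metis imageI)
  fix x assume x: "x \<in> linear_subst g ` I"
  show "x + y \<in> linear_subst g ` I" if "y \<in> linear_subst g ` I" for y
    using x that ideal.subspace_add[OF assms(2)] by (auto simp flip: linear_subst_add)
  show "r * x \<in> linear_subst g ` I" for r
  proof -
    obtain f where f: "f \<in> I" "x = linear_subst g f" using x by auto
    have "r * x = linear_subst g (linear_subst g' r * f)" by (simp add: f(2) linear_subst_mult g')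
    then show ?thesis using ideal.subspace_scale[OF assms(2) f(1)] by blast
  qed
qed

lemma subspace_ideal_rvec: "ideal.subspace J \<Longrightarrow> rvec.subspace J"
  by (auto simp: ideal.subspace_def rvec.subspace_def rscale_def)

lemma linear_linear_subst: "Vector_Spaces.linear rscale rscale (linear_subst g)"
  unfolding Vector_Spaces.linear_iff
  by (auto simp: linear_subst_add linear_subst_mult rscale_def intro: rvec.vector_space_axioms)

lemma linear_subst_image_rcomp:
  assumes "invertible g"
  shows "linear_subst g ` I \<inter> rcomp d = linear_subst g ` (I \<inter> rcomp d)"
proof -
  obtain g' where g': "\<forall>f. linear_subst g' (linear_subst g f) = f"
    using invertible_linear_subst[OF assms(1)] by blast
  have "f \<in> rcomp d" if "linear_subst g f \<in> rcomp d" for f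
    using linear_subst_rcomp[OF that, of g'] g' by simp
  then show ?thesis using linear_subst_rcomp by blast
qed

lemma dim_linear_subst:
  assumes "invertible g" "rvec.subspace S" "S \<subseteq> rcomp d"
  shows "rvec.dim (linear_subst g ` S) = rvec.dim S"
proof -
  interpret p: vec_pair rscale "rscale :: 'a \<Rightarrow> _" ..
  obtain g' where g': "\<forall>f. linear_subst g' (linear_subst g f) = f"
    using invertible_linear_subst[OF assms(1)] by blast
  have "f = 0" if "linear_subst g f = 0" for f
    using g'[rule_format, of f] that by simp
  then show ?thesis
    by (intro p.dim_image_inj linear_linear_subst rvec.fin_subspace_subset[OF fin_rcomp assms(2,3)])
qed

section \<open>Generic initial ideals\<close>

lemma lead_single: "is_lead_monomial (Poly_Mapping.single m (1::'k::field)) m"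
  by (rule is_lead_monomialI) (auto simp: lookup_single when_def split: if_splits)

lemma exists_submonomial:
  assumes "N \<le> mdeg m"
  obtains a m0 :: mon where "m = a + m0" "mdeg m0 = N"
proof -
  have "\<exists>a m0. m = a + m0 \<and> mdeg m0 = N"
    using assms
  proof (induction "mdeg m - N" arbitrary: m)
    case 0
    then show ?case by (intro exI[of _ 0] exI[of _ m]) simp
  next
    case (Suc k)
    then have "mdeg m \<noteq> 0" by linarith
    then obtain i where i: "m $ i \<noteq> 0" by (auto simp: mdeg_def)
    have m: "m = axis i 1 + (m - axis i 1)" using i by (auto simp: vec_eq_iff axis_def)
    have deg: "mdeg m = 1 + mdeg (m - axis i 1)"
      using arg_cong[OF m, of mdeg] by (simp add: mdeg_add)
    have "k = mdeg (m - axis i 1) - N" "N \<le> mdeg (m - axis i 1)" using Suc(2,3) deg by linarith+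
    then obtain a m0 where "m - axis i 1 = a + m0" "mdeg m0 = N" using Suc(1) by blast
    then show ?case using m by (intro exI[of _ "axis i 1 + a"] exI[of _ m0]) (simp add: add.assoc)
  qed
  then show thesis using that by blast
qed

text \<open>The form in which the Artinian hypothesis is used: all forms of degree \<open>N\<close>,
  hence of every higher degree, lie in the ideal. Only finitely many degrees then impose conditions
  on a generic matrix.\<close>

locale cofinite_ideal =
  fixes I :: "'k::field_char_0 mpoly3 set" and N :: nat
  assumes hom: "homogeneous_ideal I" and top: "rcomp (int N) \<subseteq> I"
begin

abbreviation moved :: "'k ^ 3 ^ 3 \<Rightarrow> 'k mpoly3 set"
  where "moved g \<equiv> linear_subst g ` I"

lemma moved_ideal: "invertible g \<Longrightarrow> ideal.subspace (moved g)"
  by (intro subspace_linear_subst homogeneous_ideal_subspace hom)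

lemma moved_rpart: "f \<in> moved g \<Longrightarrow> rpart d f \<in> moved g"
  using homogeneous_ideal_rpart[OF hom] by (auto simp: rpart_linear_subst)

lemma moved_rcomp: "invertible g \<Longrightarrow> moved g \<inter> rcomp d = linear_subst g ` (I \<inter> rcomp d)"
  by (rule linear_subst_image_rcomp)

lemma moved_top:
  assumes g: "invertible g" and m: "N \<le> mdeg m"
  shows "m \<in> leads (moved g)"
proof -
  obtain a m0 where a: "m = a + m0" "mdeg m0 = N" by (rule exists_submonomial[OF m])
  obtain g' where g': "\<forall>f. linear_subst g (linear_subst g' f) = f"
    using invertible_linear_subst[OF g] by blast
  have "Poly_Mapping.single m0 1 \<in> rcomp (int N)"
    using a(2) by (auto simp: rcomp_def lookup_single when_def split: if_splits)
  then have "linear_subst g' (Poly_Mapping.single m0 1) \<in> I" using linear_subst_rcomp top by blast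
  then have "Poly_Mapping.single m0 1 \<in> moved g" using g' by (metis imageI)
  then have "m0 \<in> leads (moved g)" unfolding leads_def using lead_single by blast
  then show ?thesis using leads_add[OF moved_ideal[OF g]] a(1) by simp
qed

lemma moved_lead:
  assumes "invertible g" "m \<in> leads (moved g)"
  obtains f where "f \<in> I" "f \<in> rcomp (int (mdeg m))" "is_lead_monomial (linear_subst g f) m"
proof -
  have "m \<in> leads (moved g \<inter> rcomp (int (mdeg m)))"
    using leads_graded[of "moved g" "mdeg m", OF moved_rpart] assms(2) by simp
  then show thesis unfolding moved_rcomp[OF assms(1)] using that by (auto simp: leads_def)
qed

definition count :: "'k ^ 3 ^ 3 \<Rightarrow> mon \<Rightarrow> nat"
  where "count g u = card (leads (moved g) \<inter> revlex_above u)"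

text \<open>One matrix has to be best for all \<open>u\<close> at once. That such matrices exist is
  not evident from \<open>count_max\<close>, which may give a different matrix for each
  \<open>u\<close>, but follows from genericity of each maximum.\<close>

definition optimal :: "'k ^ 3 ^ 3 \<Rightarrow> bool"
  where "optimal g \<longleftrightarrow> invertible g \<and> (\<forall>h u. invertible h \<longrightarrow> count h u \<le> count g u)"

lemma count_max:
  obtains g where "invertible g" "\<And>h. invertible h \<Longrightarrow> count h u \<le> count g u"
proof -
  have "count h u < Suc (card (revlex_above u))" for h
    unfolding count_def by (simp add: less_Suc_eq_le card_mono[OF finite_revlex_above])
  moreover have "invertible (mat 1 :: 'k ^ 3 ^ 3)" by (simp add: invertible_det_nz)
  ultimately have "\<exists>g. invertible g \<and> (\<forall>h. invertible h \<longrightarrow> count h u \<le> count g u)"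
    using ex_has_greatest_nat[of invertible "mat 1" "\<lambda>h. count h u" "Suc (card (revlex_above u))"] by blast
  then show thesis using that by blast
qed

text \<open>The maximal count is attained at some \<open>g0\<close> and witnessed there by
  independent coefficient rows. These stay independent on an open set, where the count can then be
  no smaller.\<close>

lemma generic_count_max: "generic (\<lambda>g. invertible g \<and> (\<forall>h. invertible h \<longrightarrow> count h u \<le> count g u))"
proof -
  obtain g0 where g0: "invertible g0" and max: "\<And>h. invertible h \<Longrightarrow> count h u \<le> count g0 u"
    by (rule count_max[of u]) blast
  define A where "A = leads (moved g0) \<inter> revlex_above u"
  have finA: "finite A" unfolding A_def using finite_revlex_above by blast
  \<comment> \<open>The witnesses are taken in \<open>I\<close> before substitution, so that the
    same forms can be moved by a varying matrix.\<close>
  have "\<exists>f. f \<in> I \<and> f \<in> rcomp (int (mdeg u)) \<and> is_lead_monomial (linear_subst g0 f) v" if "v \<in> A" for v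
  proof -
    have v: "v \<in> leads (moved g0)" "mdeg v = mdeg u" using that by (auto simp: A_def revlex_above_def)
    obtain f where "f \<in> I" "f \<in> rcomp (int (mdeg v))" "is_lead_monomial (linear_subst g0 f) v"
      by (rule moved_lead[OF g0 v(1)])
    then show ?thesis using v(2) by auto
  qed
  then have "\<forall>v\<in>A. \<exists>f. f \<in> I \<and> f \<in> rcomp (int (mdeg u)) \<and> is_lead_monomial (linear_subst g0 f) v"
    by blast
  from bchoice[OF this] obtain F where F: "\<forall>v\<in>A. F v \<in> I \<and> F v \<in> rcomp (int (mdeg u)) \<and>
      is_lead_monomial (linear_subst g0 (F v)) v" by blast
  have ind: "indep_on (revlex_above u) A (\<lambda>v m. lk (linear_subst g0 (F v)) m)"
  proof (rule indep_on_triangular[where L = "\<lambda>v. v" and lt = revlex_less])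
    show "lk (linear_subst g0 (F v)) v \<noteq> 0" if "v \<in> A" for v
      using is_lead_monomialD(1) F that by blast
    show "m = v \<or> revlex_less m v" if "v \<in> A" "lk (linear_subst g0 (F v)) m \<noteq> 0" for v m
      using is_lead_monomialD(2)[OF _ that(2)] F that(1) by blast
  qed (use finA in \<open>auto simp: A_def revlex_transp revlex_asymp\<close>)
  obtain p where p: "p \<in> polyfun" "p g0 \<noteq> 0"
    "\<forall>g. p g \<noteq> 0 \<longrightarrow> indep_on (revlex_above u) A (\<lambda>v m. lk (linear_subst g (F v)) m)"
    using indep_on_open[OF polyfun.const polyfun.mult polyfun_diff finA linear_subst_coeff_polyfun ind] by blast
  have le: "count h u \<le> count g u" if g: "invertible g" "p g \<noteq> 0" and h: "invertible h" for g h
  proof -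
    have "card A \<le> card (leads (moved g) \<inter> revlex_above u)"
    proof (rule card_leads_ge[OF subspace_ideal_rvec[OF moved_ideal[OF g(1)]] finA])
      show "linear_subst g (F v) \<in> moved g" if "v \<in> A" for v using F that by blast
      show "linear_subst g (F v) \<in> rcomp (int (mdeg u))" if "v \<in> A" for v
        using F that linear_subst_rcomp by blast
      show "indep_on (revlex_above u) A (\<lambda>v. lk (linear_subst g (F v)))" using p(3) g(2) by blast
    qed
    then show ?thesis using max[OF h] by (simp add: count_def A_def)
  qed
  have "generic (\<lambda>g. p g \<noteq> 0)" unfolding generic_def using p(1,2) by blast
  from generic_conj[OF generic_invertible this] show ?thesis
    by (rule generic_mono) (use le in blast)
qed

text \<open>In degrees from \<open>N\<close> on every monomial is a leading monomial and the count
  is as large as possible, so finitely many generic conditions remain.\<close>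

lemma generic_optimal: "generic optimal"
proof -
  have "{u. mdeg u < N} = (\<Union>n<N. {u. mdeg u = n})" by auto
  then have "finite {u. mdeg u < N}" using finite_mdeg by simp
  from generic_ball[OF this generic_count_max]
  have "generic (\<lambda>g. \<forall>u\<in>{u. mdeg u < N}. invertible g \<and> (\<forall>h. invertible h \<longrightarrow> count h u \<le> count g u))" .
  from generic_conj[OF generic_invertible this] show ?thesis
  proof (rule generic_mono)
    fix g assume g: "invertible g \<and> (\<forall>u\<in>{u. mdeg u < N}. invertible g \<and> (\<forall>h. invertible h \<longrightarrow> count h u \<le> count g u))"
    have "count h u \<le> count g u" if h: "invertible h" for h u
    proof (cases "mdeg u < N")
      case True then show ?thesis using g h by blast
    next
      case False
      then have "revlex_above u \<subseteq> leads (moved g)"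
        using moved_top g by (auto simp: revlex_above_def)
      then have "leads (moved g) \<inter> revlex_above u = revlex_above u" by blast
      then show ?thesis unfolding count_def by (simp add: card_mono[OF finite_revlex_above])
    qed
    then show "optimal g" using g by (simp add: optimal_def)
  qed
qed

text \<open>All counts of two optimal matrices agree. At the largest monomial of some degree where
  the sets of leading monomials differ, the counts would differ by one.\<close>

lemma optimal_leads_unique:
  assumes "optimal g" "optimal h"
  shows "leads (moved g) = leads (moved h)"
proof (rule ccontr)
  assume "leads (moved g) \<noteq> leads (moved h)"
  then obtain m where m: "(m \<in> leads (moved g)) \<noteq> (m \<in> leads (moved h))" by blast
  define E where "E = {x. mdeg x = mdeg m \<and> (x \<in> leads (moved g)) \<noteq> (x \<in> leads (moved h))}"
  have finE: "finite E" by (rule finite_subset[OF _ finite_mdeg[of "mdeg m"]]) (auto simp: E_def)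
  have "E \<noteq> {}" using m by (auto simp: E_def)
  from Finite_Set.bex_max_element[OF finE asymp_on_subset[OF revlex_asymp subset_UNIV]
      transp_on_subset[OF revlex_transp subset_UNIV] this]
  obtain u where u: "u \<in> E" "\<forall>x\<in>E. x \<noteq> u \<longrightarrow> \<not> revlex_less u x" by blast
  have "x \<notin> E" if "x \<in> revlex_above u - {u}" for x
    using u that revlex_total[of x u] by (auto simp: revlex_above_def E_def)
  then have same: "leads (moved g) \<inter> (revlex_above u - {u}) = leads (moved h) \<inter> (revlex_above u - {u})"
    using u(1) by (auto simp: E_def revlex_above_def)
  have c: "count k u = card (leads (moved k) \<inter> (revlex_above u - {u})) + (if u \<in> leads (moved k) then 1 else 0)" for k
  proof -
    have "leads (moved k) \<inter> revlex_above u =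
        (leads (moved k) \<inter> (revlex_above u - {u})) \<union> (if u \<in> leads (moved k) then {u} else {})"
      using revlex_above_self by auto
    then show ?thesis unfolding count_def
      by (simp add: card_insert_if finite_revlex_above)
  qed
  have "count g u = count h u" using assms by (auto simp: optimal_def intro!: antisym)
  then show False using c[of g] c[of h] same u(1) by (auto simp: E_def split: if_splits)
qed

text \<open>The definite description in \<open>gin\<close> is justified by genericity of the optimal
  matrices; any other candidate holds on an open set that contains an optimal matrix.\<close>

lemma gin_eq:
  assumes g: "optimal g"
  shows "gin I = monomial_span (leads (moved g))"
proof -
  have in_eq: "initial_ideal (moved h) = monomial_span (leads (moved g))" if "optimal h" for h
    using initial_ideal_eq[OF moved_ideal, of h] optimal_leads_unique[OF that g] that
    by (simp add: optimal_def)
  show ?thesis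
    unfolding gin_def
  proof (rule the_equality)
    have "generic (\<lambda>h. initial_ideal (moved h) = monomial_span (leads (moved g)))"
      by (rule generic_mono[OF generic_optimal]) (rule in_eq)
    then show "\<exists>U. zariski_open_GL3 U \<and> U \<noteq> {} \<and> (\<forall>h\<in>U. initial_ideal (moved h) = monomial_span (leads (moved g)))"
      by (simp only: generic_iff_zariski_open)
  next
    fix K assume "\<exists>U. zariski_open_GL3 U \<and> U \<noteq> {} \<and> (\<forall>h\<in>U. initial_ideal (moved h) = K)"
    then have "generic (\<lambda>h. initial_ideal (moved h) = K)" by (simp only: generic_iff_zariski_open)
    from generic_ex[OF generic_conj[OF this generic_optimal]]
    show "K = monomial_span (leads (moved g))" using in_eq by auto
  qed
qed

end

section \<open>Strong stability\<close>

definition shear :: "3 \<Rightarrow> 3 \<Rightarrow> 'k::field \<Rightarrow> 'k ^ 3 ^ 3"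
  where "shear i j t = (\<chi> a b. (if a = b then 1 else if a = i \<and> b = j then t else 0))"

lemma det_shear: "i \<noteq> j \<Longrightarrow> det (shear i j t) = 1"
  using exhaust_3[of i] exhaust_3[of j] by (auto simp: det_3 shear_def)

lemma linear_form_shear:
  assumes "i \<noteq> j"
  shows "linear_form (shear i j t) l = (if l = j then Var j + Const t * Var i else Var l)"
proof -
  have "linear_form (shear i j t) l =
      (\<Sum>a\<in>UNIV. (if a = l then Var l else 0) + (if a = i \<and> l = j then Const t * Var i else 0))"
    unfolding linear_form_def using assms by (intro sum.cong) (auto simp: shear_def)
  then show ?thesis by (simp add: sum.distrib)
qed

text \<open>An algebraic first-order Taylor expansion at t = 0: \<open>b\<close> is the derivative,
  and the remainder is t^2 times a polynomial in each coefficient.\<close>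

definition expands :: "('k::field \<Rightarrow> 'k mpoly3) \<Rightarrow> 'k mpoly3 \<Rightarrow> 'k mpoly3 \<Rightarrow> bool"
  where "expands F a b \<longleftrightarrow> (\<forall>w. \<exists>q. \<forall>t. lk (F t) w = lk a w + t * lk b w + t * t * poly q t)"

lemma expands_Var: "expands F a b \<Longrightarrow> expands (\<lambda>t. Var l * F t) (Var l * a) (Var l * b)"
  unfolding expands_def
proof
  fix w assume e: "\<forall>w. \<exists>q. \<forall>t. lk (F t) w = lk a w + t * lk b w + t * t * poly q t"
  show "\<exists>q. \<forall>t. lk (Var l * F t) w = lk (Var l * a) w + t * lk (Var l * b) w + t * t * poly q t"
  proof (cases "w $ l = 0")
    case True then show ?thesis by (intro exI[of _ 0]) (simp add: lookup_Var_mult)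
  next
    case False
    obtain q where "\<forall>t. lk (F t) (w - axis l 1) = lk a (w - axis l 1) + t * lk b (w - axis l 1) + t * t * poly q t"
      using e by blast
    then show ?thesis using False by (intro exI[of _ q]) (simp add: lookup_Var_mult)
  qed
qed

text \<open>The product rule. The remainder gathers the old remainder times x_j, the new mixed term
  x_i b, and t times the old remainder times x_i.\<close>

lemma expands_shear:
  assumes "expands F a b"
  shows "expands (\<lambda>t. (Var j + Const t * Var i) * F t) (Var j * a) (Var j * b + Var i * a)"
  unfolding expands_def
proof
  fix w
  obtain q where q: "\<forall>t. lk (Var j * F t) w = lk (Var j * a) w + t * lk (Var j * b) w + t * t * poly q t"
    using expands_Var[OF assms, of j] unfolding expands_def by blast
  obtain r where r: "\<forall>t. lk (Var i * F t) w = lk (Var i * a) w + t * lk (Var i * b) w + t * t * poly r t"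
    using expands_Var[OF assms, of i] unfolding expands_def by blast
  have "lk ((Var j + Const t * Var i) * F t) w = lk (Var j * a) w + t * lk (Var j * b + Var i * a) w +
      t * t * poly (q + [:lk (Var i * b) w:] + [:0, 1:] * r) t" for t
  proof -
    have F: "lk ((Var j + Const t * Var i) * F t) w = lk (Var j * F t) w + t * lk (Var i * F t) w"
      by (simp only: distrib_right lookup_add mult.assoc lookup_Const_mult)
    have P: "poly (q + [:lk (Var i * b) w:] + [:0, 1:] * r) t = poly q t + lk (Var i * b) w + t * poly r t"
      by simp
    show ?thesis unfolding F P lookup_add q[rule_format] r[rule_format] by algebra
  qed
  then show "\<exists>q. \<forall>t. lk ((Var j + Const t * Var i) * F t) w =
      lk (Var j * a) w + t * lk (Var j * b + Var i * a) w + t * t * poly q t" by blast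
qed

lemma mon_induct:
  fixes m :: mon
  assumes "P 0" "\<And>m l. P m \<Longrightarrow> P (axis l 1 + m)"
  shows "P m"
proof (induction "mdeg m" arbitrary: m)
  case 0
  then have "m = 0" by (auto simp: mdeg_sum3 vec_eq_iff forall_3)
  then show ?case using assms(1) by simp
next
  case (Suc k)
  then have "mdeg m \<noteq> 0" by linarith
  then obtain i where i: "m $ i \<noteq> 0" by (auto simp: mdeg_def)
  have m: "m = axis i 1 + (m - axis i 1)" using i by (auto simp: vec_eq_iff axis_def)
  have "mdeg m = 1 + mdeg (m - axis i 1)" using arg_cong[OF m, of mdeg] by (simp add: mdeg_add)
  then have "P (m - axis i 1)" using Suc by simp
  from assms(2)[OF this, of i] show ?case using m by simp
qed

text \<open>The derivative is that of the derivation x_i d/dx_j on a monomial. If x_j does not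
  divide \<open>m\<close>, the exponent difference truncates, but the coefficient is 0.\<close>

lemma mon_subst_shear_expands:
  assumes ij: "i \<noteq> j"
  shows "expands (\<lambda>t. mon_subst (shear i j t) m) (Poly_Mapping.single m 1)
    (Poly_Mapping.single (m - axis j 1 + axis i 1) (of_nat (m $ j)))"
proof (induction m rule: mon_induct)
  case 1
  show ?case by (auto simp: expands_def intro!: exI[of _ 0])
next
  case (2 m l)
  have step: "mon_subst (shear i j t) (axis l 1 + m) = linear_form (shear i j t) l * mon_subst (shear i j t) m"
    for t by (simp only: mon_subst_add mon_subst_axis)
  have V: "Var l' * Poly_Mapping.single a c = Poly_Mapping.single (axis l' 1 + a) (c :: 'a)" for l' a c
    by (simp add: Var_def mult_single)
  show ?case
  proof (cases "l = j")
    case False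
    have "axis l 1 + (m - axis j 1 + axis i 1) = axis l 1 + m - axis j 1 + axis i 1" if "m $ j \<noteq> 0"
      using that False by (auto simp: vec_eq_iff axis_def)
    moreover have "(axis l 1 + m) $ j = m $ j" using False by (simp add: axis_def)
    ultimately have "Var l * Poly_Mapping.single (m - axis j 1 + axis i 1) (of_nat (m $ j) :: 'a) =
        Poly_Mapping.single (axis l 1 + m - axis j 1 + axis i 1) (of_nat ((axis l 1 + m) $ j))"
      unfolding V by (cases "m $ j = 0") simp_all
    then show ?thesis using expands_Var[OF 2, of l] False
      unfolding step linear_form_shear[OF ij] V by simp
  next
    case True
    have *: "axis j 1 + (m - axis j 1 + axis i 1) = axis i 1 + m" if "m $ j \<noteq> 0"
      using that by (auto simp: vec_eq_iff axis_def)
    have "axis j 1 + m - axis j 1 + axis i 1 = axis i 1 + m" by (simp add: add.commute)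
    moreover have "(axis j 1 + m) $ j = m $ j + 1" by (simp add: axis_def)
    moreover have "Poly_Mapping.single (axis j 1 + (m - axis j 1 + axis i 1)) (of_nat (m $ j) :: 'a) =
        Poly_Mapping.single (axis i 1 + m) (of_nat (m $ j))"
      using * by (cases "m $ j = 0") simp_all
    ultimately have "Var j * Poly_Mapping.single (m - axis j 1 + axis i 1) (of_nat (m $ j) :: 'a) +
        Var i * Poly_Mapping.single m 1 =
        Poly_Mapping.single (axis j 1 + m - axis j 1 + axis i 1) (of_nat ((axis j 1 + m) $ j))"
      unfolding V by (simp only: single_add[symmetric] of_nat_add of_nat_1)
    then show ?thesis using expands_shear[OF 2, of j i] True
      unfolding step linear_form_shear[OF ij] V by simp
  qed
qed

lemma lookup_shear_derivative:
  assumes "i \<noteq> j"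
  shows "lk (Poly_Mapping.single (m - axis j 1 + axis i 1) (of_nat (m $ j))) w =
    (if w $ i \<noteq> 0 \<and> m = w - axis i 1 + axis j 1 then of_nat (w $ j + 1) else (0 :: 'k::field))"
proof (cases "m $ j = 0")
  case True
  then have "m \<noteq> w - axis i 1 + axis j 1" by (auto simp: axis_def vec_eq_iff intro!: exI[of _ j])
  then show ?thesis using True by simp
next
  case False
  have "m - axis j 1 + axis i 1 = w \<longleftrightarrow> w $ i \<noteq> 0 \<and> m = w - axis i 1 + axis j 1"
  proof
    assume "m - axis j 1 + axis i 1 = w"
    then have w: "w = m - axis j 1 + axis i 1" by simp
    show "w $ i \<noteq> 0 \<and> m = w - axis i 1 + axis j 1"
      unfolding w using False by (auto simp: axis_def vec_eq_iff)
  next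
    assume "w $ i \<noteq> 0 \<and> m = w - axis i 1 + axis j 1"
    then show "m - axis j 1 + axis i 1 = w" by (auto simp: axis_def vec_eq_iff)
  qed
  moreover have "m $ j = w $ j + 1" if "m = w - axis i 1 + axis j 1"
    using that assms by (simp add: axis_def)
  ultimately show ?thesis by (auto simp: lookup_single when_def)
qed

text \<open>The linear term is the coefficient at \<open>w\<close> of x_i df/dx_j. It stems from the
  single monomial x_j w / x_i, whose exponent of x_j is w_j + 1.\<close>

lemma linear_subst_shear_expands:
  fixes f :: "'k::field mpoly3"
  assumes ij: "i \<noteq> j"
  shows "\<exists>q. \<forall>t. lk (linear_subst (shear i j t) f) w = lk f w +
    t * (if w $ i = 0 then 0 else of_nat (w $ j + 1) * lk f (w - axis i 1 + axis j 1)) + t * t * poly q t"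
proof -
  let ?d = "\<lambda>m. Poly_Mapping.single (m - axis j 1 + axis i 1) (of_nat (m $ j) :: 'k)"
  have "\<forall>m. \<exists>q. \<forall>t :: 'k. lk (mon_subst (shear i j t) m) w =
      lk (Poly_Mapping.single m 1) w + t * lk (?d m) w + t * t * poly q t"
    using mon_subst_shear_expands[OF ij] unfolding expands_def by blast
  from choice[OF this] obtain q where q: "\<forall>m (t :: 'k). lk (mon_subst (shear i j t) m) w =
      lk (Poly_Mapping.single m 1) w + t * lk (?d m) w + t * t * poly (q m) t" by blast
  have 1: "(\<Sum>m\<in>Poly_Mapping.keys f. lk f m * lk (Poly_Mapping.single m 1) w) = lk f w"
    by (simp add: lookup_single when_def if_distrib sum.delta' in_keys_iff cong: if_cong)
  have 2: "(\<Sum>m\<in>Poly_Mapping.keys f. lk f m * lk (?d m) w) =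
      (if w $ i = 0 then 0 else of_nat (w $ j + 1) * lk f (w - axis i 1 + axis j 1))"
  proof -
    have "(\<Sum>m\<in>Poly_Mapping.keys f. lk f m * lk (?d m) w) =
        (\<Sum>m\<in>Poly_Mapping.keys f. if m = w - axis i 1 + axis j 1 then
          (if w $ i = 0 then 0 else of_nat (w $ j + 1) * lk f m) else 0)"
      unfolding lookup_shear_derivative[OF ij] by (intro sum.cong) auto
    also have "\<dots> = (if w $ i = 0 then 0 else of_nat (w $ j + 1) * lk f (w - axis i 1 + axis j 1))"
      by (subst sum.delta) (auto simp: in_keys_iff)
    finally show ?thesis .
  qed
  have "lk (linear_subst (shear i j t) f) w = lk f w +
      t * (if w $ i = 0 then 0 else of_nat (w $ j + 1) * lk f (w - axis i 1 + axis j 1)) +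
      t * t * poly (\<Sum>m\<in>Poly_Mapping.keys f. smult (lk f m) (q m)) t" for t
  proof -
    have "lk (linear_subst (shear i j t) f) w =
        (\<Sum>m\<in>Poly_Mapping.keys f. lk f m * lk (mon_subst (shear i j t) m) w)"
      by (simp add: linear_subst_superset[OF finite_keys subset_refl] lookup_sum)
    also have "\<dots> = (\<Sum>m\<in>Poly_Mapping.keys f. lk f m * lk (Poly_Mapping.single m 1) w) +
        t * (\<Sum>m\<in>Poly_Mapping.keys f. lk f m * lk (?d m) w) +
        t * t * (\<Sum>m\<in>Poly_Mapping.keys f. lk f m * poly (q m) t)"
      unfolding q[rule_format] sum_distrib_left sum.distrib[symmetric]
      by (intro sum.cong refl) algebra
    finally show ?thesis unfolding 1 2 by (simp add: poly_sum)
  qed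
  then show ?thesis by blast
qed

lemma poly_quadratic_expansion:
  "poly ([:c:] + [:0, d:] + [:0, 0, 1:] * q) t = c + t * d + t * t * poly q t" for c :: "'k::field"
  unfolding poly_add poly_mult poly_pCons poly_0 by algebra

context cofinite_ideal
begin

text \<open>
  If \<open>u' = x\<^sub>i u / x\<^sub>j\<close> were not a leading monomial, a general shear \<open>x\<^sub>j \<mapsto> x\<^sub>j + t x\<^sub>i\<close> would keep the leading
  monomials above \<open>u'\<close> and create one more: the linear coefficient in \<open>t\<close> of the element with leading
  monomial \<open>u\<close> has leading monomial \<open>u'\<close>, since the exponent of \<open>x\<^sub>j\<close> in \<open>u\<close> is not zero in \<open>k\<close>.
\<close>

lemma optimal_stable:
  assumes g: "optimal g" and u: "u \<in> leads (moved g)" and uj: "u $ j \<noteq> 0"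
    and ij: "revlex_less (axis j 1) (axis i 1)"
  shows "u - axis j 1 + axis i 1 \<in> leads (moved g)"
proof (rule ccontr)
  let ?v = "u - axis j 1 + axis i 1"
  assume nv: "?v \<notin> leads (moved g)"
  have neq: "i \<noteq> j" using ij by auto
  have invg: "invertible g" using g by (simp add: optimal_def)
  have uv: "u + axis i 1 = ?v + axis j 1" using uj by (auto simp: vec_eq_iff axis_def)
  have degv: "mdeg ?v = mdeg u" using arg_cong[OF uv, of mdeg] by (simp add: mdeg_add)
  have u_less: "revlex_less u ?v"
  proof -
    have "revlex_less (u - axis j 1 + axis j 1) ?v" using ij by (simp only: revlex_add)
    moreover have "u - axis j 1 + axis j 1 = u" using uj by (auto simp: vec_eq_iff axis_def)
    ultimately show ?thesis by simp
  qed
  \<comment> \<open>\<open>?v\<close> is not in \<open>B\<close>, so independent rows indexed by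
    \<open>insert ?v B\<close> in another moved ideal would beat the count of \<open>g\<close> at
    \<open>?v\<close>.\<close>
  define B where "B = leads (moved g) \<inter> revlex_above ?v"
  have finB: "finite B" unfolding B_def using finite_revlex_above by blast
  have "\<forall>b\<in>B. \<exists>f. f \<in> moved g \<and> f \<in> rcomp (int (mdeg ?v)) \<and> is_lead_monomial f b"
  proof
    fix b assume "b \<in> B"
    then have b: "b \<in> leads (moved g)" "mdeg b = mdeg ?v" by (auto simp: B_def revlex_above_def)
    obtain f where "f \<in> I" "f \<in> rcomp (int (mdeg b))" "is_lead_monomial (linear_subst g f) b"
      by (rule moved_lead[OF invg b(1)])
    then show "\<exists>f. f \<in> moved g \<and> f \<in> rcomp (int (mdeg ?v)) \<and> is_lead_monomial f b"
      using b(2) linear_subst_rcomp by (intro exI[of _ "linear_subst g f"]) simp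
  qed
  from bchoice[OF this] obtain F where F: "\<forall>b\<in>B. F b \<in> moved g \<and> F b \<in> rcomp (int (mdeg ?v)) \<and>
    is_lead_monomial (F b) b" by blast
  obtain f0 where f0: "f0 \<in> I" "f0 \<in> rcomp (int (mdeg u))" "is_lead_monomial (linear_subst g f0) u"
    by (rule moved_lead[OF invg u])
  define f where "f = linear_subst g f0"
  have f: "f \<in> moved g" "f \<in> rcomp (int (mdeg ?v))" "is_lead_monomial f u"
    using f0 linear_subst_rcomp degv by (auto simp: f_def)
  let ?lin = "\<lambda>h w. if w $ i = 0 then 0 else of_nat (w $ j + 1) * lk h (w - axis i 1 + axis j 1)"
  have "\<forall>x :: 'k mpoly3 \<times> mon. \<exists>q. \<forall>t. lk (linear_subst (shear i j t) (fst x)) (snd x) = lk (fst x) (snd x) +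
      t * ?lin (fst x) (snd x) + t * t * poly q t"
    using linear_subst_shear_expands[OF neq] by blast
  from choice[OF this] obtain q where q: "\<forall>(x :: 'k mpoly3 \<times> mon) t. lk (linear_subst (shear i j t) (fst x)) (snd x) =
      lk (fst x) (snd x) + t * ?lin (fst x) (snd x) + t * t * poly (q x) t" by blast
  \<comment> \<open>The rows of the sheared elements as polynomials in t. The row of
    \<open>f\<close> is divided by t: \<open>f\<close> has no coefficients from \<open>?v\<close>
    upwards, so its sheared coefficients there are divisible by t. At t = 0 the rows are those of
    the \<open>F b\<close> and of the derivative of \<open>f\<close>.\<close>
  define R where "R b w = (if b = ?v then [:?lin f w:] + [:0, 1:] * q (f, w)
      else [:lk (F b) w:] + [:0, ?lin (F b) w:] + [:0, 0, 1:] * q (F b, w))" for b w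
  have vB: "?v \<notin> B" using nv by (simp add: B_def)
  have f_above: "lk f w = 0" if "w \<in> revlex_above ?v" for w
  proof (rule ccontr)
    assume "lk f w \<noteq> 0"
    then have "w = u \<or> revlex_less w u" using is_lead_monomialD(2)[OF f(3)] by blast
    then have "revlex_less w ?v" using u_less revlex_trans by blast
    then show False using that by (simp add: revlex_above_def)
  qed
  have R_v: "lk (linear_subst (shear i j t) f) w = t * poly (R ?v w) t" if "w \<in> revlex_above ?v" for t w
  proof -
    have "lk (linear_subst (shear i j t) f) w = lk f w + t * ?lin f w + t * t * poly (q (f, w)) t"
      using q[rule_format, of t "(f, w)"] by simp
    moreover have "poly (R ?v w) t = ?lin f w + t * poly (q (f, w)) t" by (simp add: R_def)
    ultimately show ?thesis using f_above[OF that] by algebra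
  qed
  have R_b: "lk (linear_subst (shear i j t) (F b)) w = poly (R b w) t" if "b \<in> B" for b t w
  proof -
    have "b \<noteq> ?v" using that vB by blast
    then have "R b w = [:lk (F b) w:] + [:0, ?lin (F b) w:] + [:0, 0, 1:] * q (F b, w)"
      by (simp only: R_def if_False)
    then have "poly (R b w) t = lk (F b) w + t * ?lin (F b) w + t * t * poly (q (F b, w)) t"
      by (simp only: poly_quadratic_expansion)
    then show ?thesis using q[rule_format, of t "(F b, w)"] by simp
  qed
  have R0_v: "poly (R ?v w) 0 = ?lin f w" for w by (simp add: R_def)
  have R0_b: "poly (R b w) 0 = lk (F b) w" if "b \<in> B" for b w
    using that vB by (auto simp: R_def)
  have ind0: "indep_on (revlex_above ?v) (insert ?v B) (\<lambda>b w. poly (R b w) 0)"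
  proof (rule indep_on_triangular[where L = "\<lambda>b. b" and lt = revlex_less])
    \<comment> \<open>Characteristic 0 enters here: the coefficient of the derivative at
      \<open>?v\<close> is the exponent of x_j in \<open>u\<close> times the leading coefficient of
      \<open>f\<close>.\<close>
    have "?v $ i \<noteq> 0" "?v - axis i 1 + axis j 1 = u" using uj by (auto simp: vec_eq_iff axis_def)
    then have v0: "poly (R ?v ?v) 0 \<noteq> 0"
      unfolding R0_v using is_lead_monomialD(1)[OF f(3)] of_nat_neq_0[of "?v $ j", where 'a = 'k] by simp
    show "poly (R b b) 0 \<noteq> 0" if "b \<in> insert ?v B" for b
    proof (cases "b = ?v")
      case False
      then have "b \<in> B" using that by blast
      then show ?thesis using R0_b[of b b] F is_lead_monomialD(1) by auto
    qed (use v0 in simp)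
    show "w = b \<or> revlex_less w b"
      if b: "b \<in> insert ?v B" and w: "w \<in> revlex_above ?v" and nz: "poly (R b w) 0 \<noteq> 0" for b w
    proof (cases "b = ?v")
      case False
      then have "b \<in> B" using b by blast
      then show ?thesis using R0_b[of b w] nz F is_lead_monomialD(2) by auto
    next
      case True
      \<comment> \<open>A coefficient of the derivative at some w > ?v would come from the monomial
        x_j w / x_i of \<open>f\<close>, which exceeds the leading monomial
        \<open>u\<close>.\<close>
      have "w = ?v"
      proof (rule ccontr)
        assume "w \<noteq> ?v"
        then have less: "revlex_less ?v w" using w revlex_total by (auto simp: revlex_above_def)
        have nz': "w $ i \<noteq> 0" "lk f (w - axis i 1 + axis j 1) \<noteq> 0"
          using nz unfolding True R0_v by (auto split: if_splits)
        have "axis i 1 + (w - axis i 1 + axis j 1) = axis j 1 + w"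
          using nz'(1) by (auto simp: vec_eq_iff axis_def)
        moreover have "revlex_less (axis j 1 + ?v) (axis j 1 + w)" using less by (simp only: revlex_add)
        moreover have "axis j 1 + ?v = axis i 1 + u" using uv by (simp only: add.commute)
        ultimately have "revlex_less (axis i 1 + u) (axis i 1 + (w - axis i 1 + axis j 1))" by simp
        then have "revlex_less u (w - axis i 1 + axis j 1)" by (simp only: revlex_add)
        then show False
          using is_lead_monomialD(2)[OF f(3) nz'(2)] revlex_trans revlex_irrefl by blast
      qed
      then show ?thesis using True by simp
    qed
  qed (use finB revlex_transp revlex_asymp revlex_above_self in \<open>auto simp: B_def\<close>)
  let ?P = "{f. \<exists>q. f = poly q} :: ('k \<Rightarrow> 'k) set"
  have P1: "(\<lambda>_. 1) \<in> ?P" by (auto intro!: exI[of _ 1])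
  have P2: "(\<lambda>x. f x * h x) \<in> ?P" if "f \<in> ?P" "h \<in> ?P" for f h
    using that by (auto simp flip: poly_mult)
  have P3: "(\<lambda>x. f x - h x) \<in> ?P" if "f \<in> ?P" "h \<in> ?P" for f h
    using that by (auto simp flip: poly_diff)
  have P4: "poly (R b w) \<in> ?P" for b w by blast
  obtain p where p: "p \<in> ?P" "p 0 \<noteq> 0"
    "\<forall>t. p t \<noteq> 0 \<longrightarrow> indep_on (revlex_above ?v) (insert ?v B) (\<lambda>b w. poly (R b w) t)"
    using indep_on_open[OF P1 P2 P3 finite.insertI[OF finB] P4 ind0] by blast
  then obtain p' where p': "p = poly p'" by blast
  then have "p' \<noteq> 0" using p(2) by auto
  \<comment> \<open>Besides keeping the rows independent, t must be nonzero to undo the division by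
    t in the row of \<open>f\<close>.\<close>
  then obtain t where t: "p t \<noteq> 0" "t \<noteq> 0"
    using poly_nonzero_point[of p' "{0}"] p' by auto
  let ?h = "shear i j t"
  have invh: "invertible ?h" using det_shear[OF neq, of t] by (simp add: invertible_det_nz)
  have invhg: "invertible (?h ** g)" using invh invg invertible_mult by blast
  have moved_h: "linear_subst ?h x \<in> moved (?h ** g)" if "x \<in> moved g" for x
    using that by (auto simp: linear_subst_compose)
  define H where "H b = (if b = ?v then Const (1 / t) * linear_subst ?h f else linear_subst ?h (F b))" for b
  have H_lk: "lk (H b) w = poly (R b w) t" if "b \<in> insert ?v B" "w \<in> revlex_above ?v" for b w
  proof (cases "b = ?v")
    case True then show ?thesis using R_v[OF that(2), of t] t(2) by (simp add: H_def)
  next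
    case False then show ?thesis using R_b[of b t w] that by (simp add: H_def)
  qed
  have "card (insert ?v B) \<le> card (leads (moved (?h ** g)) \<inter> revlex_above ?v)"
  proof (rule card_leads_ge[OF subspace_ideal_rvec[OF moved_ideal[OF invhg]] finite.insertI[OF finB]])
    show "H b \<in> moved (?h ** g)" if "b \<in> insert ?v B" for b
      using that moved_h f(1) F ideal.subspace_scale[OF moved_ideal[OF invhg]] by (auto simp: H_def)
    show "H b \<in> rcomp (int (mdeg ?v))" if "b \<in> insert ?v B" for b
    proof (cases "b = ?v")
      case True
      have "rscale (1 / t) (linear_subst ?h f) \<in> rcomp (int (mdeg ?v))"
        by (intro rvec.subspace_scale[OF subspace_rcomp] linear_subst_rcomp f(2))
      then show ?thesis unfolding H_def rscale_def using True by simp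
    next
      case False
      then show ?thesis using that F linear_subst_rcomp by (auto simp: H_def)
    qed
    show "indep_on (revlex_above ?v) (insert ?v B) (\<lambda>b. lk (H b))"
      unfolding indep_on_def
    proof (intro allI impI ballI)
      fix c b
      assume c: "\<forall>w\<in>revlex_above ?v. (\<Sum>b\<in>insert ?v B. c b * lk (H b) w) = 0" and b: "b \<in> insert ?v B"
      have "(\<Sum>b\<in>insert ?v B. c b * poly (R b w) t) = 0" if w: "w \<in> revlex_above ?v" for w
      proof -
        have "(\<Sum>b\<in>insert ?v B. c b * poly (R b w) t) = (\<Sum>b\<in>insert ?v B. c b * lk (H b) w)"
          by (intro sum.cong refl) (simp only: H_lk[OF _ w])
        then show ?thesis using c w by (simp only:)
      qed
      then show "c b = 0" using indep_onD[OF p(3)[rule_format, OF t(1)]] b by blast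
    qed
  qed
  also have "\<dots> \<le> count g ?v" using g invhg by (simp add: optimal_def count_def[symmetric])
  also have "\<dots> = card B" by (simp add: count_def B_def)
  finally show False using vB finB by simp
qed

end

section \<open>Betti numbers of strongly stable monomial ideals\<close>

lemma rvec_subspace_monomial_span: "rvec.subspace (monomial_span G :: 'k::field mpoly3 set)"
  unfolding rvec.subspace_def
proof (intro conjI ballI allI)
  show "0 \<in> (monomial_span G :: 'k mpoly3 set)" by (simp add: monomial_span_def)
  fix f :: "'k mpoly3" assume f: "f \<in> monomial_span G"
  show "f + h \<in> monomial_span G" if h: "h \<in> monomial_span G" for h
    unfolding monomial_span_def
  proof (intro CollectI allI impI)
    fix m assume "lk (f + h) m \<noteq> 0"
    then show "m \<in> G" using f h by (cases "lk f m = 0") (simp_all add: monomial_span_def lookup_add)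
  qed
  show "rscale c f \<in> monomial_span G" for c using f by (simp add: monomial_span_def)
qed

lemma rvec_subspace_Int: "rvec.subspace A \<Longrightarrow> rvec.subspace B \<Longrightarrow> rvec.subspace (A \<inter> B)"
  by (auto simp: rvec.subspace_def)

lemma single_rcomp: "int (mdeg m) = d \<Longrightarrow> Poly_Mapping.single m c \<in> rcomp d"
  by (auto simp: rcomp_def lookup_single when_def split: if_splits)

lemma dim_monomials:
  "rvec.dim (monomial_span G \<inter> rcomp d :: 'k::field mpoly3 set) = card {m \<in> G. int (mdeg m) = d}"
proof -
  have "leads (monomial_span G \<inter> rcomp d :: 'k mpoly3 set) = {m \<in> G. int (mdeg m) = d}"
  proof (intro equalityI subsetI)
    fix m assume "m \<in> leads (monomial_span G \<inter> rcomp d :: 'k mpoly3 set)"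
    then obtain f :: "'k mpoly3" where f: "f \<in> monomial_span G" "f \<in> rcomp d" "is_lead_monomial f m"
      by (auto simp: leads_def)
    have "lk f m \<noteq> 0" using is_lead_monomialD(1)[OF f(3)] .
    then show "m \<in> {m \<in> G. int (mdeg m) = d}" using f(1,2) by (simp add: monomial_span_def rcomp_def)
  next
    fix m assume m: "m \<in> {m \<in> G. int (mdeg m) = d}"
    then have "Poly_Mapping.single m (1::'k) \<in> monomial_span G \<inter> rcomp d"
      using single_rcomp[of m d] by (auto simp: monomial_span_def lookup_single when_def)
    then show "m \<in> leads (monomial_span G \<inter> rcomp d :: 'k mpoly3 set)"
      unfolding leads_def using lead_single by blast
  qed
  moreover have "rvec.dim (monomial_span G \<inter> rcomp d :: 'k mpoly3 set) =
      card (leads (monomial_span G \<inter> rcomp d :: 'k mpoly3 set))"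
    by (intro dim_eq_card_leads[where d = d] rvec_subspace_Int rvec_subspace_monomial_span subspace_rcomp) auto
  ultimately show ?thesis by simp
qed

lemma homogeneous_ideal_monomial_span:
  assumes "\<And>a m. m \<in> G \<Longrightarrow> a + m \<in> G"
  shows "homogeneous_ideal (monomial_span G :: 'k::field mpoly3 set)"
  unfolding homogeneous_ideal_def
proof (rule exI[of _ "{Poly_Mapping.single m (1::'k) | m. m \<in> G}"], intro conjI ballI)
  show "monomial_span G = ideal.span {Poly_Mapping.single m (1::'k) | m. m \<in> G}"
    by (rule span_monomials[OF assms, symmetric])
  fix f assume "f \<in> {Poly_Mapping.single m (1::'k) | m. m \<in> G}"
  then show "\<exists>d. homogeneous d f" by (auto simp: homogeneous_def)
qed

lemma socle_monomial_span:
  "R.socle (\<lambda>d. monomial_span G \<inter> rcomp d) d =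
    (monomial_span {m. \<forall>j. axis j 1 + m \<in> G} \<inter> rcomp d :: 'k::field mpoly3 set)"
proof -
  have "(\<forall>j. Var j * f \<in> monomial_span G \<inter> rcomp (d + 1)) \<longleftrightarrow> f \<in> monomial_span {m. \<forall>j. axis j 1 + m \<in> G}"
    if f: "f \<in> rcomp d" for f :: "'k mpoly3"
  proof
    assume a: "\<forall>j. Var j * f \<in> monomial_span G \<inter> rcomp (d + 1)"
    have "axis j 1 + m \<in> G" if "lk f m \<noteq> 0" for j m
    proof -
      have "lk (Var j * f) (m + axis j 1) \<noteq> 0" using that by simp
      then have "m + axis j 1 \<in> G" using a unfolding monomial_span_def by blast
      then show ?thesis by (simp only: add.commute)
    qed
    then show "f \<in> monomial_span {m. \<forall>j. axis j 1 + m \<in> G}" by (simp add: monomial_span_def)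
  next
    assume a: "f \<in> monomial_span {m. \<forall>j. axis j 1 + m \<in> G}"
    show "\<forall>j. Var j * f \<in> monomial_span G \<inter> rcomp (d + 1)"
    proof
      fix j
      have "m \<in> G" if nz: "lk (Var j * f) m \<noteq> 0" for m
      proof -
        obtain k where "m = axis j 1 + k" "lk f k \<noteq> 0"
          by (rule lookup_single_mult_nonzero[OF nz[unfolded Var_def]])
        then show ?thesis using a by (simp add: monomial_span_def)
      qed
      then show "Var j * f \<in> monomial_span G \<inter> rcomp (d + 1)"
        using R.X_V[OF f] by (simp add: monomial_span_def)
    qed
  qed
  then show ?thesis unfolding R.socle_def by blast
qed

definition multiples :: "mon set \<Rightarrow> mon set"
  where "multiples G = {axis j 1 + a | j a. a \<in> G}"

lemma koszul1_monomial_span: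
  "koszul1 (\<lambda>i f. Var i * f) ` cube (monomial_span G \<inter> rcomp (d - 1)) =
    (monomial_span (multiples G) \<inter> rcomp d :: 'k::field mpoly3 set)"
    (is "?L = ?R")
proof (intro equalityI subsetI)
  fix y assume "y \<in> ?L"
  then obtain t where t: "t \<in> cube (monomial_span G \<inter> rcomp (d - 1))" "y = koszul1 (\<lambda>i f. Var i * f) t"
    by blast
  have V: "Var j * f \<in> monomial_span (multiples G)" if "f \<in> monomial_span G" for j and f :: "'k mpoly3"
    unfolding monomial_span_def
  proof (intro CollectI allI impI)
    fix m assume nz: "lk (Var j * f) m \<noteq> 0"
    obtain k where "m = axis j 1 + k" "lk f k \<noteq> 0"
      by (rule lookup_single_mult_nonzero[OF nz[unfolded Var_def]])
    then show "m \<in> multiples G" using that by (auto simp: monomial_span_def multiples_def)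
  qed
  have "y \<in> monomial_span (multiples G)"
    using t(1) unfolding t(2) koszul1_def
    by (intro rvec.subspace_add[OF rvec_subspace_monomial_span] V) auto
  moreover have "t \<in> cube (rcomp (d - 1))" using t(1) by auto
  ultimately show "y \<in> ?R" using R.koszul1_V[of t d] t(2) by simp
next
  fix f assume f: "f \<in> ?R"
  interpret A31: vec_pair "cube_scale rscale" "rscale :: 'k \<Rightarrow> _" by (rule R.vec_pairs)
  have finK: "rvec.fin_subspace (monomial_span G \<inter> rcomp (d - 1) :: 'k mpoly3 set)"
    by (rule rvec.fin_subspace_subset[OF fin_rcomp[of "d - 1"]
          rvec_subspace_Int[OF rvec_subspace_monomial_span subspace_rcomp]]) blast
  have sub: "rvec.subspace ?L"
    by (rule rvec.fin_subspace_subspace[OF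
          A31.fin_subspace_image[OF R.linear_koszul1 rvec.dim_cube(1)[OF finK]]])
  have single: "Poly_Mapping.single m c \<in> ?L" if m: "m \<in> multiples G" "int (mdeg m) = d" for m and c :: 'k
  proof -
    obtain j a where a: "m = axis j 1 + a" "a \<in> G" using m(1) by (auto simp: multiples_def)
    have "int (mdeg a) = d - 1" using m(2) a(1) by (simp add: mdeg_add)
    then have s: "Poly_Mapping.single a c \<in> monomial_span G \<inter> rcomp (d - 1)"
      using a(2) single_rcomp[of a "d - 1" c] by (auto simp: monomial_span_def lookup_single when_def split: if_splits)
    have z: "0 \<in> monomial_span G \<inter> (rcomp (d - 1) :: 'k mpoly3 set)"
      using rvec.subspace_0[OF rvec_subspace_monomial_span] rvec.subspace_0[OF subspace_rcomp] by blast
    let ?t = "(if j = 1 then Poly_Mapping.single a c else 0, if j = 2 then Poly_Mapping.single a c else 0,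
        if j = 3 then Poly_Mapping.single a c else 0)"
    have t1: "?t \<in> cube (monomial_span G \<inter> rcomp (d - 1))" using s z by simp
    have "koszul1 (\<lambda>i f. Var i * f) ?t = Var j * Poly_Mapping.single a c"
      using exhaust_3[of j] by (auto simp: koszul1_def)
    also have "\<dots> = Poly_Mapping.single m c"
      by (simp add: Var_def mult_single a(1))
    finally show ?thesis using imageI[OF t1, of "koszul1 (\<lambda>i f. Var i * f)"] by (simp only:)
  qed
  have "(\<Sum>m\<in>Poly_Mapping.keys f. Poly_Mapping.single m (lk f m)) \<in> ?L"
    using f by (intro rvec.subspace_sum[OF sub] single) (auto simp: monomial_span_def rcomp_def in_keys_iff)
  then show "f \<in> ?L" by (simp only: sum_single_lookup[symmetric])
qed

text \<open>\<open>betti_values\<close> involves three dimensions in each degree, and for monomial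
  ideals each of them counts monomials.\<close>

lemma betti_monomial_span:
  assumes "\<And>a m. m \<in> G \<Longrightarrow> a + m \<in> G" "\<And>a m. m \<in> H \<Longrightarrow> a + m \<in> H"
    and c: "\<And>d. card {m \<in> G. mdeg m = d} = card {m \<in> H. mdeg m = d}"
    and s: "\<And>d. card {m. (\<forall>j. axis j 1 + m \<in> G) \<and> mdeg m = d} = card {m. (\<forall>j. axis j 1 + m \<in> H) \<and> mdeg m = d}"
    and m: "\<And>d. card {m \<in> multiples G. mdeg m = d} = card {m \<in> multiples H. mdeg m = d}"
  shows "betti (monomial_span G :: 'k::field mpoly3 set) = betti (monomial_span H :: 'k mpoly3 set)"
proof -
  have int: "card {m \<in> A. int (mdeg m) = d} = card {m \<in> B. int (mdeg m) = d}"
    if "\<And>d. card {m \<in> A. mdeg m = d} = card {m \<in> B. mdeg m = d}" for A B d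
  proof (cases "d < 0")
    case True
    then have e: "{m \<in> A. int (mdeg m) = d} = {}" "{m \<in> B. int (mdeg m) = d} = {}" by auto
    show ?thesis by (simp only: e)
  next
    case False
    then have "int (mdeg m) = d \<longleftrightarrow> mdeg m = nat d" for m :: mon by auto
    then show ?thesis using that by simp
  qed
  let ?K = "monomial_span G :: 'k mpoly3 set" and ?L = "monomial_span H :: 'k mpoly3 set"
  have h: "hdim ?K d = hdim ?L d" for d using int[OF c] by (simp only: dim_monomials)
  have g: "gmu ?K d = gmu ?L d" for d
    using int[OF m] by (simp only: R.mu_def koszul1_monomial_span dim_monomials)
  have "card {m \<in> {m. \<forall>j. axis j 1 + m \<in> G}. mdeg m = d} = card {m \<in> {m. \<forall>j. axis j 1 + m \<in> H}. mdeg m = d}" for d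
    using s[of d] by simp
  from int[OF this] have so: "gsocle ?K d = gsocle ?L d" for d
    by (simp only: socle_monomial_span dim_monomials)
  note v = betti_values[OF homogeneous_ideal_monomial_span[OF assms(1)], where 'k = 'k]
    and w = betti_values[OF homogeneous_ideal_monomial_span[OF assms(2)], where 'k = 'k]
  have b: "betti ?K q i = betti ?L q i" for q i
  proof -
    consider "q = 0" | "q = Suc 0" | "q = Suc (Suc 0)" | p where "q = Suc (Suc (Suc p))"
      by (metis not0_implies_Suc)
    then show ?thesis
    proof cases
      case 1 then show ?thesis using v(1)[of i] w(1)[of i] h g by simp
    next
      case 2 then show ?thesis using v(2)[of i] w(2)[of i] h g so by simp
    next
      case 3 then show ?thesis using v(3)[of i] w(3)[of i] h so by simp
    next
      case 4 then show ?thesis using v(4)[of _ i] w(4)[of _ i] by simp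
    qed
  qed
  show ?thesis by (intro ext b)
qed

text \<open>That x_i comes before x_j is expressed by comparing the variables as monomials, since in
  the index type 3 equals 0.\<close>

locale strongly_stable =
  fixes G :: "mon set"
  assumes up: "m \<in> G \<Longrightarrow> a + m \<in> G"
    and stable: "u \<in> G \<Longrightarrow> u $ j \<noteq> 0 \<Longrightarrow> revlex_less (axis j 1) (axis i 1) \<Longrightarrow> u - axis j 1 + axis i 1 \<in> G"
begin

lemma stable':
  assumes "axis j 1 + a \<in> G" "revlex_less (axis j 1) (axis i 1)"
  shows "axis i 1 + a \<in> G"
proof -
  have "(axis j 1 + a) $ j \<noteq> 0" by (simp add: axis_def)
  from stable[OF assms(1) this assms(2)] show ?thesis by (simp add: add.commute)
qed

end

lemma revlex_axis: "revlex_less (axis 2 1) (axis 1 1)" "revlex_less (axis 3 1) (axis 1 1)"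
  "revlex_less (axis 3 1) (axis 2 1)"
  by (auto simp: revlex_less_def axis_def mdeg_axis[unfolded axis_def])

context strongly_stable
begin

text \<open>Multiplication by x_3 is the bijection: by stability, x_3 m in \<open>G\<close> already
  forces x_1 m and x_2 m into \<open>G\<close>.\<close>

lemma socle_card:
  "card {m. (\<forall>j. axis j 1 + m \<in> G) \<and> mdeg m = d} = card {m \<in> G. mdeg m = Suc d \<and> m $ 3 \<noteq> 0}"
proof (rule bij_betw_same_card[of "\<lambda>m. axis 3 1 + m"], rule bij_betw_imageI)
  show "inj_on (\<lambda>m. axis 3 1 + m) {m. (\<forall>j. axis j 1 + m \<in> G) \<and> mdeg m = d}" by simp
  show "(\<lambda>m. axis 3 1 + m) ` {m. (\<forall>j. axis j 1 + m \<in> G) \<and> mdeg m = d} =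
      {m \<in> G. mdeg m = Suc d \<and> m $ 3 \<noteq> 0}"
  proof (intro equalityI subsetI)
    fix m assume "m \<in> (\<lambda>m. axis 3 1 + m) ` {m. (\<forall>j. axis j 1 + m \<in> G) \<and> mdeg m = d}"
    then show "m \<in> {m \<in> G. mdeg m = Suc d \<and> m $ 3 \<noteq> 0}" by (auto simp: mdeg_add axis_def mdeg_axis[unfolded axis_def])
  next
    fix m assume m: "m \<in> {m \<in> G. mdeg m = Suc d \<and> m $ 3 \<noteq> 0}"
    then have e: "m = axis 3 1 + (m - axis 3 1)" by (auto simp: vec_eq_iff axis_def)
    then have e3: "axis 3 1 + (m - axis 3 1) \<in> G" using m by simp
    have "axis j 1 + (m - axis 3 1) \<in> G" for j
      using exhaust_3[of j] stable'[OF e3, of 1] stable'[OF e3, of 2] revlex_axis e3 by auto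
    moreover have "mdeg (m - axis 3 1) = d" using m arg_cong[OF e, of mdeg] by (simp add: mdeg_add)
    ultimately show "m \<in> (\<lambda>m. axis 3 1 + m) ` {m. (\<forall>j. axis j 1 + m \<in> G) \<and> mdeg m = d}"
      using e by blast
  qed
qed

text \<open>Stability allows all other variables to be exchanged for x_1, one at a time, without
  changing the degree.\<close>

lemma power_in:
  assumes "a \<in> G"
  shows "axis 1 (mdeg a) \<in> G"
  using assms
proof (induction "a $ 2 + a $ 3" arbitrary: a rule: less_induct)
  case less
  show ?case
  proof (cases "a $ 2 = 0 \<and> a $ 3 = 0")
    case True
    then have "a = axis 1 (mdeg a)" by (simp add: vec_eq_iff forall_3 axis_def mdeg_sum3)
    then show ?thesis using less.prems by simp
  next
    case False
    then obtain j where j: "j \<in> {2, 3}" "a $ j \<noteq> 0" by blast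
    let ?b = "a - axis j 1 + axis 1 1"
    have lt: "revlex_less (axis j 1) (axis 1 1)" using j(1) revlex_axis by auto
    have "a + axis 1 1 = ?b + axis j 1" using j(2) by (auto simp: vec_eq_iff axis_def)
    then have deg: "mdeg ?b = mdeg a" using mdeg_add[of a "axis 1 1"] mdeg_add[of ?b "axis j 1"] by simp
    have "?b $ 2 + ?b $ 3 < a $ 2 + a $ 3" using j by (auto simp: axis_def)
    from less.hyps[OF this stable[OF less.prems j(2) lt]] show ?thesis by (simp only: deg)
  qed
qed

text \<open>Each multiple is written as x_l b with x_l the last variable dividing it; stability
  keeps \<open>b\<close> in \<open>G\<close>. For x_3 every \<open>b\<close> in degree
  \<open>d\<close> occurs, for x_2 those free of x_3, and for x_1 only the power of x_1, which is
  present as soon as \<open>G\<close> has a monomial of degree \<open>d\<close>.\<close>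

lemma multiples_card:
  "card {m \<in> multiples G. mdeg m = Suc d} = card {m \<in> G. mdeg m = d} +
    (card {m \<in> G. mdeg m = d} - card {m \<in> G. mdeg m = d \<and> m $ 3 \<noteq> 0}) +
    (if card {m \<in> G. mdeg m = d} = 0 then 0 else 1)"
proof -
  let ?G = "{m \<in> G. mdeg m = d}"
  let ?A3 = "(\<lambda>m. axis 3 1 + m) ` ?G"
  let ?A2 = "(\<lambda>m. axis 2 1 + m) ` {m \<in> ?G. m $ 3 = 0}"
  let ?A1 = "if ?G = {} then {} else {axis 1 (Suc d) :: mon}"
  have fin: "finite ?G" by (rule finite_subset[OF _ finite_mdeg[of d]]) auto
  have eq: "{m \<in> multiples G. mdeg m = Suc d} = ?A3 \<union> ?A2 \<union> ?A1"
  proof (intro equalityI subsetI)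
    fix m assume "m \<in> {m \<in> multiples G. mdeg m = Suc d}"
    then obtain j a where a: "m = axis j 1 + a" "a \<in> G" "mdeg m = Suc d" by (auto simp: multiples_def)
    have dega: "mdeg a = d" using a(1,3) by (simp add: mdeg_add)
    \<comment> \<open>If m = x_j a and a later variable x_l divides \<open>m\<close>, then m / x_l
      arises from \<open>a\<close> by exchanging x_l for x_j.\<close>
    have move: "\<exists>b\<in>?G. m = axis l 1 + b" if l: "m $ l \<noteq> 0" and lt: "j = l \<or> revlex_less (axis l 1) (axis j 1)" for l
    proof (cases "j = l")
      case True then show ?thesis using a dega by auto
    next
      case False
      then have lt: "revlex_less (axis l 1) (axis j 1)" and al: "a $ l \<noteq> 0" using lt l a(1) by (auto simp: axis_def)
      have "a - axis l 1 + axis j 1 \<in> G" by (rule stable[OF a(2) al lt])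
      moreover have m: "m = axis l 1 + (a - axis l 1 + axis j 1)" unfolding a(1) using al by (auto simp: vec_eq_iff axis_def)
      moreover have "mdeg (a - axis l 1 + axis j 1) = d" using arg_cong[OF m, of mdeg] a(3) by (simp add: mdeg_add)
      ultimately show ?thesis by blast
    qed
    consider "m $ 3 \<noteq> 0" | "m $ 3 = 0" "m $ 2 \<noteq> 0" | "m $ 3 = 0" "m $ 2 = 0" by blast
    then show "m \<in> ?A3 \<union> ?A2 \<union> ?A1"
    proof cases
      case 1
      have "j = 3 \<or> revlex_less (axis 3 1) (axis j 1)" using exhaust_3[of j] revlex_axis by auto
      from move[OF 1 this] show ?thesis by blast
    next
      case 2
      have "j \<noteq> 3" using 2(1) a(1) by (auto simp: axis_def)
      then have "j = 2 \<or> revlex_less (axis 2 1) (axis j 1)" using exhaust_3[of j] revlex_axis by auto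
      from move[OF 2(2) this] obtain b where b: "b \<in> ?G" "m = axis 2 1 + b" by blast
      then have "b $ 3 = 0" using 2(1) by (simp add: axis_def)
      then show ?thesis using b by blast
    next
      case 3
      then have "m = axis 1 (Suc d)" using a(3) by (simp add: vec_eq_iff forall_3 axis_def mdeg_sum3)
      then show ?thesis using a(2) dega by auto
    qed
  next
    fix m assume m: "m \<in> ?A3 \<union> ?A2 \<union> ?A1"
    have "\<exists>j. \<exists>a\<in>?G. m = axis j 1 + a"
    proof (cases "m \<in> ?A3 \<union> ?A2")
      case True then show ?thesis by blast
    next
      case False
      then have m1: "m = axis 1 (Suc d)" and ne: "?G \<noteq> {}" using m by (auto split: if_splits)
      then obtain a where "a \<in> G" "mdeg a = d" by blast
      then have "axis 1 d \<in> ?G" using power_in[of a] by auto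
      moreover have "m = axis 1 1 + axis 1 d" using m1 by (simp add: vec_eq_iff axis_def)
      ultimately show ?thesis by blast
    qed
    then show "m \<in> {m \<in> multiples G. mdeg m = Suc d}" by (auto simp: multiples_def mdeg_add)
  qed
  have d1: "?A3 \<inter> ?A2 = {}" by (auto simp: axis_def vec_eq_iff dest: arg_cong[where f = "\<lambda>m. m $ 3"])
  have d2: "(?A3 \<union> ?A2) \<inter> ?A1 = {}"
  proof -
    have "(axis 1 (Suc d) :: mon) $ 3 = 0" "(axis 1 (Suc d) :: mon) $ 2 = 0" by (simp_all add: axis_def)
    moreover have "m $ 3 \<noteq> 0" if "m \<in> ?A3" for m using that by (auto simp: axis_def)
    moreover have "m $ 2 \<noteq> 0" if "m \<in> ?A2" for m using that by (auto simp: axis_def)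
    ultimately show ?thesis by (auto split: if_splits)
  qed
  have "card {m \<in> multiples G. mdeg m = Suc d} = card ?A3 + card ?A2 + card ?A1"
  proof -
    have "finite {m \<in> ?G. m $ 3 = 0}" by (rule finite_subset[OF _ fin]) auto
    then have f: "finite ?A3" "finite ?A2" "finite ?A1" using fin by simp_all
    have "card (?A3 \<union> ?A2 \<union> ?A1) = card (?A3 \<union> ?A2) + card ?A1"
      by (rule card_Un_disjoint[OF finite_UnI[OF f(1,2)] f(3) d2])
    also have "card (?A3 \<union> ?A2) = card ?A3 + card ?A2" by (rule card_Un_disjoint[OF f(1,2) d1])
    finally show ?thesis unfolding eq .
  qed
  moreover have "card ?A3 = card ?G" by (rule card_image) simp
  moreover have "card ?A2 = card {m \<in> ?G. m $ 3 = 0}" by (rule card_image) simp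
  moreover have "{m \<in> ?G. m $ 3 = 0} = ?G - {m \<in> G. mdeg m = d \<and> m $ 3 \<noteq> 0}" by blast
  then have "card {m \<in> ?G. m $ 3 = 0} = card ?G - card {m \<in> G. mdeg m = d \<and> m $ 3 \<noteq> 0}"
    using fin by (simp only:) (rule card_Diff_subset, auto intro: finite_subset[OF _ fin])
  moreover have "card ?A1 = (if card ?G = 0 then 0 else 1)" using fin by simp
  ultimately show ?thesis by simp
qed

end

lemma betti_strongly_stable:
  assumes "strongly_stable G" "strongly_stable H"
    and c: "\<And>d. card {m \<in> G. mdeg m = d} = card {m \<in> H. mdeg m = d}"
    and c3: "\<And>d. card {m \<in> G. mdeg m = Suc d \<and> m $ 3 \<noteq> 0} = card {m \<in> H. mdeg m = Suc d \<and> m $ 3 \<noteq> 0}"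
  shows "betti (monomial_span G :: 'k::field mpoly3 set) = betti (monomial_span H :: 'k mpoly3 set)"
proof (rule betti_monomial_span)
  interpret G: strongly_stable G by fact
  interpret H: strongly_stable H by fact
  show "a + m \<in> G" if "m \<in> G" for a m using G.up[OF that] .
  show "a + m \<in> H" if "m \<in> H" for a m using H.up[OF that] .
  show "card {m \<in> G. mdeg m = d} = card {m \<in> H. mdeg m = d}" for d by (rule c)
  show "card {m. (\<forall>j. axis j 1 + m \<in> G) \<and> mdeg m = d} = card {m. (\<forall>j. axis j 1 + m \<in> H) \<and> mdeg m = d}" for d
    by (simp only: G.socle_card H.socle_card c3)
  \<comment> \<open>\<open>c3\<close> covers the degrees from 1 on; in degree 0 no monomial is
    divisible by x_3.\<close>
  have z: "{m \<in> A. mdeg m = 0 \<and> m $ 3 \<noteq> 0} = {}" for A by (auto simp: mdeg_sum3)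
  have c3': "card {m \<in> G. mdeg m = d \<and> m $ 3 \<noteq> 0} = card {m \<in> H. mdeg m = d \<and> m $ 3 \<noteq> 0}" for d
    by (cases d) (simp_all only: z c3)
  have z': "{m \<in> multiples A. mdeg m = 0} = {}" for A by (auto simp: multiples_def mdeg_add)
  show "card {m \<in> multiples G. mdeg m = d} = card {m \<in> multiples H. mdeg m = d}" for d
    by (cases d) (simp_all only: z' G.multiples_card H.multiples_card c c3')
qed

section \<open>The weak Lefschetz property\<close>

text \<open>Modulo the degree \<open>d\<close> part of \<open>I\<close> this is the kernel of
  multiplication by \<open>L\<close> on the quotient ring, so maximal rank becomes a statement about
  its dimension.\<close>

definition colon :: "'k::field mpoly3 set \<Rightarrow> 'k mpoly3 \<Rightarrow> int \<Rightarrow> 'k mpoly3 set"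
  where "colon I L d = {h \<in> rcomp d. L * h \<in> I}"

abbreviation rdim :: "'k::field itself \<Rightarrow> int \<Rightarrow> int"
  where "rdim (t :: 'k itself) d \<equiv> int (rvec.dim (rcomp d :: 'k mpoly3 set))"

lemma subspace_colon:
  assumes "ideal.subspace I"
  shows "rvec.subspace (colon I L d)"
proof (rule rvec.subspaceI)
  show "0 \<in> colon I L d"
    using ideal.subspace_0[OF assms] rvec.subspace_0[OF subspace_rcomp] by (simp add: colon_def)
  show "x + y \<in> colon I L d" if "x \<in> colon I L d" "y \<in> colon I L d" for x y
    using that
    by (auto simp: colon_def distrib_left intro: ideal.subspace_add[OF assms] rvec.subspace_add[OF subspace_rcomp])
  show "rscale c x \<in> colon I L d" if x: "x \<in> colon I L d" for c x
  proof -
    have "L * rscale c x = Const c * (L * x)" unfolding rscale_def by (rule mult.left_commute)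
    also have "\<dots> \<in> I" by (rule ideal.subspace_scale[OF assms]) (use x in \<open>simp add: colon_def\<close>)
    finally show ?thesis using x rvec.subspace_scale[OF subspace_rcomp, of x d c] by (simp add: colon_def)
  qed
qed

lemma fin_colon: "ideal.subspace I \<Longrightarrow> rvec.fin_subspace (colon I L d)"
  by (rule rvec.fin_subspace_subset[OF fin_rcomp[of d] subspace_colon]) (auto simp: colon_def)

lemma fin_ideal_rcomp: "ideal.subspace I \<Longrightarrow> rvec.fin_subspace (I \<inter> rcomp d)"
  by (rule rvec.fin_subspace_subset[OF fin_rcomp[of d] rvec_subspace_Int[OF subspace_ideal_rvec subspace_rcomp]]) auto

text \<open>Rank-nullity for (h, p) -> L h - p, which avoids quotient spaces: the kernel projects
  isomorphically onto the colon space, and the image is L R_d + I_(d+1).\<close>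

lemma colon_dim:
  fixes I :: "'k::field mpoly3 set"
  assumes I: "ideal.subspace I" and L: "L \<in> rcomp 1"
  shows "rdim TYPE('k) d + hdim I (d + 1) = int (rvec.dim (colon I L d)) +
    int (rvec.dim ((\<lambda>p. L * fst p - snd p) ` (rcomp d \<times> (I \<inter> rcomp (d + 1)))))"
proof -
  interpret p: vec_pair rscale "rscale :: 'k \<Rightarrow> _" ..
  interpret P: vec "prod_scale rscale rscale :: 'k \<Rightarrow> 'k mpoly3 \<times> 'k mpoly3 \<Rightarrow> _"
    by (rule vec_prod_scale) (rule rvec.vec_axioms)+
  interpret Q: vec_pair "prod_scale rscale rscale :: 'k \<Rightarrow> 'k mpoly3 \<times> 'k mpoly3 \<Rightarrow> _" "rscale :: 'k \<Rightarrow> _" ..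
  let ?S = "rcomp d \<times> (I \<inter> rcomp (d + 1))"
  let ?f = "\<lambda>p. L * fst p - snd p"
  have fin: "P.fin_subspace ?S" by (rule p.dim_prod(1)[OF fin_rcomp fin_ideal_rcomp[OF I]])
  have dim: "P.dim ?S = rvec.dim (rcomp d :: 'k mpoly3 set) + rvec.dim (I \<inter> rcomp (d + 1))"
    by (rule p.dim_prod(2)[OF fin_rcomp fin_ideal_rcomp[OF I]])
  have lin: "Vector_Spaces.linear (prod_scale rscale rscale) rscale ?f"
    unfolding Vector_Spaces.linear_iff
    by (auto simp: P.vector_space_axioms rvec.vector_space_axioms rscale_def distrib_left
        right_diff_distrib mult.left_commute)
  have lin_fst: "Vector_Spaces.linear (prod_scale rscale rscale) rscale (fst :: 'k mpoly3 \<times> 'k mpoly3 \<Rightarrow> _)"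
    unfolding Vector_Spaces.linear_iff
    by (auto simp: P.vector_space_axioms rvec.vector_space_axioms)
  let ?N = "{p \<in> ?S. ?f p = 0}"
  have "L * h \<in> rcomp (d + 1)" if "h \<in> rcomp d" for h
    using rcomp_mult[OF L that] by (simp add: add.commute)
  then have "fst ` ?N = colon I L d" by (force simp: colon_def image_iff)
  moreover have "rvec.dim (fst ` ?N) = P.dim ?N"
  proof (rule Q.dim_image_inj[OF lin_fst])
    show "P.fin_subspace ?N"
      by (rule P.fin_subspace_subset[OF fin Q.subspace_kernel_on[OF lin P.fin_subspace_subspace[OF fin]]]) auto
    show "p = 0" if "p \<in> ?N" "fst p = 0" for p
      using that by (cases p) (simp add: zero_prod_def)
  qed
  ultimately show ?thesis using Q.rank_nullity[OF lin fin] dim by simp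
qed

lemma ideal_subset_colon: "ideal.subspace I \<Longrightarrow> I \<inter> rcomp d \<subseteq> colon I L d"
  using ideal.subspace_scale by (auto simp: colon_def)

lemma colon_image_subset:
  fixes I :: "'k::field mpoly3 set"
  assumes "L \<in> rcomp 1"
  shows "(\<lambda>p. L * fst p - snd p) ` (rcomp d \<times> (I \<inter> rcomp (d + 1))) \<subseteq> rcomp (d + 1)"
proof -
  have "L * h \<in> rcomp (d + 1)" if "h \<in> rcomp d" for h
    using rcomp_mult[OF assms that] by (simp add: add.commute)
  then show ?thesis by (auto intro!: rvec.subspace_diff[OF subspace_rcomp])
qed

text \<open>The first bound holds since I_d lies in the colon space, the second since the image in
  \<open>colon_dim\<close> lies in R_(d+1). Equality in them means injectivity and surjectivity of
  multiplication by \<open>L\<close>, respectively.\<close>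

lemma colon_dim_ge:
  fixes I :: "'k::field mpoly3 set"
  assumes I: "ideal.subspace I" and L: "L \<in> rcomp 1"
  shows "int (rvec.dim (colon I L d)) \<ge> max (hdim I d) (rdim TYPE('k) d + hdim I (d + 1) - rdim TYPE('k) (d + 1))"
proof -
  interpret p: vec_pair rscale "rscale :: 'k \<Rightarrow> _" ..
  interpret P: vec "prod_scale rscale rscale :: 'k \<Rightarrow> 'k mpoly3 \<times> 'k mpoly3 \<Rightarrow> _"
    by (rule vec_prod_scale) (rule rvec.vec_axioms)+
  interpret Q: vec_pair "prod_scale rscale rscale :: 'k \<Rightarrow> 'k mpoly3 \<times> 'k mpoly3 \<Rightarrow> _" "rscale :: 'k \<Rightarrow> _" ..
  have lin: "Vector_Spaces.linear (prod_scale rscale rscale) rscale (\<lambda>p. L * fst p - snd p)"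
    unfolding Vector_Spaces.linear_iff
    by (auto simp: P.vector_space_axioms rvec.vector_space_axioms rscale_def distrib_left
        right_diff_distrib mult.left_commute)
  have "rvec.subspace ((\<lambda>p. L * fst p - snd p) ` (rcomp d \<times> (I \<inter> rcomp (d + 1))))"
    by (rule rvec.fin_subspace_subspace[OF Q.fin_subspace_image[OF lin p.dim_prod(1)[OF fin_rcomp fin_ideal_rcomp[OF I]]]])
  from rvec.fin_subspace_dim_mono[OF fin_rcomp this colon_image_subset[OF L]]
    rvec.fin_subspace_dim_mono[OF fin_colon[OF I]
      rvec.fin_subspace_subspace[OF fin_ideal_rcomp[OF I]] ideal_subset_colon[OF I], of d L]
  show ?thesis using colon_dim[OF I L, of d] by linarith
qed

section \<open>Maximal rank as a dimension formula\<close>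

lemma residue_class_eq_iff:
  assumes "ideal.subspace I"
  shows "residue_class I f = residue_class I h \<longleftrightarrow> f - h \<in> I"
proof
  assume "residue_class I f = residue_class I h"
  moreover have "f \<in> residue_class I f" using ideal.subspace_0[OF assms] by (simp add: residue_class_def)
  ultimately show "f - h \<in> I" by (simp add: residue_class_def)
next
  assume a: "f - h \<in> I"
  have "x - f \<in> I \<longleftrightarrow> x - h \<in> I" for x
  proof
    assume "x - f \<in> I"
    from ideal.subspace_add[OF assms this a] show "x - h \<in> I" by simp
  next
    assume "x - h \<in> I"
    from ideal.subspace_diff[OF assms this a] show "x - f \<in> I" by simp
  qed
  then show "residue_class I f = residue_class I h" by (simp add: residue_class_def)
qed

lemma quotient_mult_residue:
  assumes "ideal.subspace I"
  shows "quotient_mult I L (residue_class I h) = residue_class I (L * h)"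
proof -
  have "residue_class I (L * f) = residue_class I (L * h)" if "f \<in> residue_class I h" for f
  proof -
    have "L * f - L * h \<in> I"
      using ideal.subspace_scale[OF assms, of "f - h" L] that by (simp add: residue_class_def right_diff_distrib)
    then show ?thesis by (simp add: residue_class_eq_iff[OF assms])
  qed
  moreover have "h \<in> residue_class I h" using ideal.subspace_0[OF assms] by (simp add: residue_class_def)
  ultimately show ?thesis unfolding quotient_mult_def by blast
qed

text \<open>Injectivity makes the first lower bound of \<open>colon_dim_ge\<close> an equality,
  surjectivity the second; either way the maximum is attained.\<close>

lemma maximal_rank_colon_dim:
  fixes I :: "'k::field mpoly3 set"
  assumes I: "ideal.subspace I" and L: "homogeneous 1 L"
    and rank: "inj_on (quotient_mult I L) (quotient_component I d) \<or>
      quotient_mult I L ` quotient_component I d = quotient_component I (Suc d)"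
  shows "int (rvec.dim (colon I L (int d))) =
    max (hdim I (int d)) (rdim TYPE('k) (int d) + hdim I (int d + 1) - rdim TYPE('k) (int d + 1))"
proof -
  have L': "L \<in> rcomp 1" using L by (simp add: homogeneous_iff_rcomp)
  note ge = colon_dim_ge[OF I L', of "int d"]
  from rank show ?thesis
  proof
    assume inj: "inj_on (quotient_mult I L) (quotient_component I d)"
    have "colon I L (int d) \<subseteq> I \<inter> rcomp (int d)"
    proof
      fix h assume h: "h \<in> colon I L (int d)"
      have "quotient_mult I L (residue_class I h) = quotient_mult I L (residue_class I 0)"
        using h by (simp add: quotient_mult_residue[OF I] residue_class_eq_iff[OF I] colon_def)
      moreover have "residue_class I h \<in> quotient_component I d" "residue_class I 0 \<in> quotient_component I d"
        using h rvec.subspace_0[OF subspace_rcomp] by (auto simp: quotient_component_def homogeneous_iff_rcomp colon_def)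
      ultimately have "residue_class I h = residue_class I 0" using inj by (auto dest: inj_onD)
      then show "h \<in> I \<inter> rcomp (int d)" using h by (simp add: residue_class_eq_iff[OF I] colon_def)
    qed
    then have "colon I L (int d) = I \<inter> rcomp (int d)" using ideal_subset_colon[OF I] by blast
    then show ?thesis using ge by simp
  next
    assume surj: "quotient_mult I L ` quotient_component I d = quotient_component I (Suc d)"
    have "rcomp (int d + 1) \<subseteq> (\<lambda>p. L * fst p - snd p) ` (rcomp (int d) \<times> (I \<inter> rcomp (int d + 1)))"
    proof
      fix y :: "'k mpoly3" assume y: "y \<in> rcomp (int d + 1)"
      then have "residue_class I y \<in> quotient_component I (Suc d)"
        by (auto simp: quotient_component_def homogeneous_iff_rcomp add.commute)
      then obtain h where h: "h \<in> rcomp (int d)" "residue_class I y = quotient_mult I L (residue_class I h)"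
        unfolding surj[symmetric] by (auto simp: quotient_component_def homogeneous_iff_rcomp)
      then have "residue_class I (L * h) = residue_class I y" by (simp add: quotient_mult_residue[OF I])
      then have "L * h - y \<in> I" by (simp add: residue_class_eq_iff[OF I])
      moreover have "L * h - y \<in> rcomp (int d + 1)"
        using rvec.subspace_diff[OF subspace_rcomp _ y, of "L * h"] rcomp_mult[OF L' h(1)] by (simp add: add.commute)
      ultimately have "(h, L * h - y) \<in> rcomp (int d) \<times> (I \<inter> rcomp (int d + 1))" using h(1) by simp
      then show "y \<in> (\<lambda>p. L * fst p - snd p) ` (rcomp (int d) \<times> (I \<inter> rcomp (int d + 1)))"
        by (rule rev_image_eqI) simp
    qed
    then have "(\<lambda>p. L * fst p - snd p) ` (rcomp (int d) \<times> (I \<inter> rcomp (int d + 1))) = rcomp (int d + 1)"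
      using colon_image_subset[OF L'] by blast
    then show ?thesis using colon_dim[OF I L', of "int d"] ge by simp
  qed
qed

lemma rcomp_1_eq_linear_form:
  fixes L :: "'k::field mpoly3"
  assumes "L \<in> rcomp 1"
  shows "L = (\<Sum>i\<in>UNIV. Const (lk L (axis i 1)) * Var i)"
proof (rule poly_mapping_eqI)
  fix m
  have Var: "lk (Const c * Var i) m = (if m = axis i 1 then c else 0)" for c :: 'k and i
  proof -
    have "Const c * Var i = Poly_Mapping.single (axis i 1) c" by (simp add: Const_def Var_def mult_single)
    then show ?thesis by (auto simp: lookup_single when_def)
  qed
  show "lk L m = lk (\<Sum>i\<in>UNIV. Const (lk L (axis i 1)) * Var i) m"
  proof (cases "\<exists>i. m = axis i 1")
    case True
    then obtain i where i: "m = axis i 1" by blast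
    have "(axis i 1 = (axis j 1 :: mon)) \<longleftrightarrow> j = i" for j by (auto simp: axis_eq_axis)
    then show ?thesis unfolding lookup_sum Var by (simp add: i)
  next
    case False
    have "mdeg m \<noteq> 1"
    proof
      assume "mdeg m = 1"
      obtain i where i: "m $ i \<noteq> 0" using \<open>mdeg m = 1\<close> by (force simp: mdeg_def)
      then have e: "m = axis i 1 + (m - axis i 1)" by (auto simp: vec_eq_iff axis_def)
      have "mdeg m = 1 + mdeg (m - axis i 1)" using arg_cong[OF e, of mdeg] by (simp only: mdeg_add mdeg_axis)
      then have "mdeg (m - axis i 1) = 0" using \<open>mdeg m = 1\<close> by linarith
      then have "m - axis i 1 = 0" by (auto simp: mdeg_sum3 vec_eq_iff forall_3)
      then show False using e False by auto
    qed
    then have "lk L m = 0" using assms by (auto simp: rcomp_def)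
    then show ?thesis unfolding lookup_sum Var using False by simp
  qed
qed

lemma exists_invertible_linear_form:
  fixes L :: "'k::field mpoly3"
  assumes L: "L \<in> rcomp 1" "L \<noteq> 0"
  obtains h where "invertible h" "linear_form h 3 = L"
proof -
  let ?c = "\<lambda>i. lk L (axis i 1)"
  have "\<exists>i. ?c i \<noteq> 0"
  proof (rule ccontr)
    assume "\<not> (\<exists>i. ?c i \<noteq> 0)"
    then have "(\<Sum>i\<in>UNIV. Const (?c i) * Var i) = 0" by simp
    from trans[OF rcomp_1_eq_linear_form[OF L(1)] this] show False using L(2) by blast
  qed
  then obtain i where i: "?c i \<noteq> 0" by blast
  \<comment> \<open>The last column holds the coefficients of \<open>L\<close>. If i is not 3,
    column i is the third unit vector, so that the rest of the matrix complements row i; the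
    determinant is the i-th coefficient up to sign.\<close>
  define h where "h = (\<chi> a b. if b = 3 then ?c a else if i = b then (if a = 3 then 1 else 0) else (if a = b then 1 else 0))"
  have "det h \<noteq> 0" using i exhaust_3[of i] by (auto simp: det_3 h_def)
  moreover have "linear_form h 3 = (\<Sum>i\<in>UNIV. Const (?c i) * Var i)"
    by (simp add: linear_form_def h_def)
  then have "linear_form h 3 = L" by (rule trans[OF _ rcomp_1_eq_linear_form[OF L(1), symmetric]])
  ultimately show thesis using that by (simp add: invertible_det_nz)
qed

section \<open>Leading monomials divisible by the last variable\<close>

context cofinite_ideal
begin

lemmas I_ideal = homogeneous_ideal_subspace[OF hom]

lemma card_leads_degree:
  assumes "invertible g"
  shows "card {m \<in> leads (moved g). mdeg m = d} = rvec.dim (I \<inter> rcomp (int d))"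
proof -
  have sub: "rvec.subspace (moved g \<inter> rcomp (int d))"
    by (intro rvec_subspace_Int subspace_ideal_rvec moved_ideal assms subspace_rcomp)
  have "card {m \<in> leads (moved g). mdeg m = d} = card (leads (moved g \<inter> rcomp (int d)))"
    using leads_graded[of "moved g" d, OF moved_rpart] by simp
  also have "\<dots> = rvec.dim (moved g \<inter> rcomp (int d))"
    by (rule dim_eq_card_leads[OF sub, symmetric]) blast
  also have "\<dots> = rvec.dim (I \<inter> rcomp (int d))"
    unfolding moved_rcomp[OF assms]
    by (rule dim_linear_subst[OF assms rvec_subspace_Int[OF subspace_ideal_rvec[OF I_ideal] subspace_rcomp]]) blast
  finally show ?thesis .
qed

text \<open>In the reverse lexicographic order, the leading monomial of a form is divisible by \<open>x\<^sub>3\<close> only if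
  the form is.\<close>

lemma card_leads_x3:
  assumes g: "invertible g" and L: "linear_subst g L = Var 3"
  shows "card {m \<in> leads (moved g). mdeg m = Suc d \<and> m $ 3 \<noteq> 0} = rvec.dim (colon I L (int d))"
proof -
  interpret p: vec_pair rscale "rscale :: 'k \<Rightarrow> _" ..
  \<comment> \<open>The elements of degree d + 1 of the moved ideal that are divisible by
    x_3.\<close>
  let ?S = "(\<lambda>h. Var 3 * h) ` colon (moved g) (Var 3) (int d)"
  have J: "ideal.subspace (moved g)" by (rule moved_ideal[OF g])
  have S_rcomp: "?S \<subseteq> rcomp (int d + 1)" using R.X_V by (auto simp: colon_def)
  have sub: "rvec.subspace ?S"
    by (rule rvec.fin_subspace_subspace[OF p.fin_subspace_image[OF R.linear_X fin_colon[OF J]]])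
  have "leads ?S = {m \<in> leads (moved g). mdeg m = Suc d \<and> m $ 3 \<noteq> 0}"
  proof (intro equalityI subsetI)
    fix m assume "m \<in> leads ?S"
    then obtain h where h: "h \<in> colon (moved g) (Var 3) (int d)" "is_lead_monomial (Var 3 * h) m"
      by (auto simp: leads_def)
    have nz: "lk (Var 3 * h) m \<noteq> 0" by (rule is_lead_monomialD(1)[OF h(2)])
    have "m $ 3 \<noteq> 0" using nz lookup_Var_mult[of 3 h m] by (cases "m $ 3 = 0") simp_all
    moreover have "mdeg m = Suc d"
    proof -
      have "Var 3 * h \<in> rcomp (int d + 1)" using S_rcomp h(1) by blast
      then have "int (mdeg m) = int d + 1" using nz by (simp add: rcomp_def)
      then show ?thesis by linarith
    qed
    moreover have "m \<in> leads (moved g)" using h by (auto simp: leads_def colon_def)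
    ultimately show "m \<in> {m \<in> leads (moved g). mdeg m = Suc d \<and> m $ 3 \<noteq> 0}" by simp
  next
    fix m assume m: "m \<in> {m \<in> leads (moved g). mdeg m = Suc d \<and> m $ 3 \<noteq> 0}"
    then have "m \<in> leads (moved g \<inter> rcomp (int (Suc d)))"
      using leads_graded[of "moved g" "Suc d", OF moved_rpart] by simp
    then obtain f where f: "f \<in> moved g" "f \<in> rcomp (int (Suc d))" "is_lead_monomial f m"
      by (auto simp: leads_def)
    have x3: "l $ 3 \<noteq> 0" if l: "lk f l \<noteq> 0" for l
    proof -
      have "l = m \<or> revlex_less l m" by (rule is_lead_monomialD(2)[OF f(3) l])
      moreover have "mdeg l = Suc d" using f(2) l by (auto simp: rcomp_def)
      ultimately show ?thesis using m by (auto simp: revlex_less_def)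
    qed
    have "f - Var 3 * divide_Var 3 f = 0"
    proof (rule poly_mapping_eqI)
      fix k show "lk (f - Var 3 * divide_Var 3 f) k = lk 0 k"
        unfolding lookup_Var_free_part using x3[of k] by (cases "lk f k = 0") simp_all
    qed
    then have e: "f = Var 3 * divide_Var 3 f" by simp
    have "divide_Var 3 f \<in> rcomp (int d)" using R.D_V[OF f(2), of 3] by simp
    then have "divide_Var 3 f \<in> colon (moved g) (Var 3) (int d)" using f(1) e by (simp add: colon_def)
    then have "f \<in> ?S" using e by blast
    then show "m \<in> leads ?S" using f(3) unfolding leads_def by blast
  qed
  then have "card {m \<in> leads (moved g). mdeg m = Suc d \<and> m $ 3 \<noteq> 0} = rvec.dim ?S"
    using dim_eq_card_leads[OF sub S_rcomp] by simp
  also have "\<dots> = rvec.dim (colon (moved g) (Var 3) (int d))"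
    by (rule p.dim_image_inj[OF R.linear_X fin_colon[OF J] R.X_inj])
  also have "colon (moved g) (Var 3) (int d) = linear_subst g ` colon I L (int d)"
  proof -
    obtain g' where g': "\<forall>f. linear_subst g' (linear_subst g f) = f" "\<forall>f. linear_subst g (linear_subst g' f) = f"
      using invertible_linear_subst[OF g] by blast
    have "h \<in> linear_subst g ` colon I L (int d)" if h: "h \<in> colon (moved g) (Var 3) (int d)" for h
    proof -
      obtain f where f: "f \<in> I" "Var 3 * h = linear_subst g f" using h by (auto simp: colon_def)
      have "linear_subst g (L * linear_subst g' h) = linear_subst g f"
        using f(2) g' by (simp add: linear_subst_mult L)
      then have "L * linear_subst g' h = f" using g'(1) by metis
      then have "linear_subst g' h \<in> colon I L (int d)"
        using f(1) h linear_subst_rcomp[of h "int d" g'] by (simp add: colon_def)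
      then have "linear_subst g (linear_subst g' h) \<in> linear_subst g ` colon I L (int d)" by (rule imageI)
      then show ?thesis using g'(2) by simp
    qed
    moreover have "linear_subst g h \<in> colon (moved g) (Var 3) (int d)" if h: "h \<in> colon I L (int d)" for h
    proof -
      have "Var 3 * linear_subst g h = linear_subst g (L * h)" by (simp add: linear_subst_mult L)
      then show ?thesis using h linear_subst_rcomp[of h "int d" g] by (auto simp: colon_def)
    qed
    ultimately show ?thesis by blast
  qed
  also have "rvec.dim (linear_subst g ` colon I L (int d)) = rvec.dim (colon I L (int d))"
    by (rule dim_linear_subst[OF g subspace_colon[OF I_ideal], where d1 = "int d"]) (auto simp: colon_def)
  finally show ?thesis .
qed

text \<open>The monomials of degree \<open>d\<close> that are at least x_2^d are exactly those free
  of x_3. So maximising this count is the same as minimising the number of leading monomials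
  divisible by x_3.\<close>

lemma count_x2:
  assumes "invertible g"
  shows "count g (axis 2 d) + card {m \<in> leads (moved g). mdeg m = d \<and> m $ 3 \<noteq> 0} = rvec.dim (I \<inter> rcomp (int d))"
proof -
  have "leads (moved g) \<inter> revlex_above (axis 2 d) = {m \<in> leads (moved g). mdeg m = d \<and> m $ 3 = 0}"
    by (auto simp: revlex_above_def revlex_less_def axis_def mdeg_axis[unfolded axis_def] mdeg_sum3)
  then have "count g (axis 2 d) = card {m \<in> leads (moved g). mdeg m = d \<and> m $ 3 = 0}"
    by (simp add: count_def)
  moreover have "card {m \<in> leads (moved g). mdeg m = d} =
      card ({m \<in> leads (moved g). mdeg m = d \<and> m $ 3 = 0} \<union> {m \<in> leads (moved g). mdeg m = d \<and> m $ 3 \<noteq> 0})"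
    by (rule arg_cong[where f = card]) auto
  moreover have "\<dots> = card {m \<in> leads (moved g). mdeg m = d \<and> m $ 3 = 0} +
      card {m \<in> leads (moved g). mdeg m = d \<and> m $ 3 \<noteq> 0}"
    by (intro card_Un_disjoint finite_subset[OF _ finite_mdeg[of d]]) auto
  ultimately show ?thesis using card_leads_degree[OF assms, of d] by linarith
qed

text \<open>The lower bound of \<open>colon_dim_ge\<close> holds for every linear form. It is
  attained for the Lefschetz form, which some matrix moves to x_3, and by \<open>count_x2\<close> an
  optimal matrix does at least as well.\<close>

lemma optimal_card_x3:
  assumes g: "optimal g" and wl: "weak_Lefschetz I"
  shows "int (card {m \<in> leads (moved g). mdeg m = Suc d \<and> m $ 3 \<noteq> 0}) =
    max (hdim I (int d)) (rdim TYPE('k) (int d) + hdim I (int d + 1) - rdim TYPE('k) (int d + 1))" (is "_ = ?M")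
proof -
  have invg: "invertible g" using g by (simp add: optimal_def)
  obtain g' where g': "\<forall>f. linear_subst g (linear_subst g' f) = f"
    using invertible_linear_subst[OF invg] by blast
  let ?Lg = "linear_subst g' (Var 3)"
  have Lg: "linear_subst g ?Lg = Var 3" "?Lg \<in> rcomp 1" using g' linear_subst_rcomp[OF Var_rcomp] by (blast, blast)
  have eq_g: "card {m \<in> leads (moved g). mdeg m = Suc d \<and> m $ 3 \<noteq> 0} = rvec.dim (colon I ?Lg (int d))"
    by (rule card_leads_x3[OF invg Lg(1)])
  have ge: "int (rvec.dim (colon I ?Lg (int d))) \<ge> ?M" by (rule colon_dim_ge[OF I_ideal Lg(2)])
  obtain L where L: "homogeneous 1 L" and rank: "inj_on (quotient_mult I L) (quotient_component I d) \<or>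
      quotient_mult I L ` quotient_component I d = quotient_component I (Suc d)"
    using wl unfolding weak_Lefschetz_def by blast
  have dimL: "int (rvec.dim (colon I L (int d))) = ?M" by (rule maximal_rank_colon_dim[OF I_ideal L rank])
  have L1: "L \<in> rcomp 1" using L by (simp add: homogeneous_iff_rcomp)
  show ?thesis
  proof (cases "L = 0")
    \<comment> \<open>\<open>weak_Lefschetz\<close> admits the zero form. Its colon space is all of
      R_d and contains the one of \<open>?Lg\<close>, which gives the upper bound directly.\<close>
    case True
    have "colon I ?Lg (int d) \<subseteq> colon I L (int d)"
      using True ideal.subspace_0[OF I_ideal] by (auto simp: colon_def)
    from rvec.fin_subspace_dim_mono[OF fin_colon[OF I_ideal] subspace_colon[OF I_ideal] this]
    show ?thesis using eq_g ge dimL by linarith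
  next
    case False
    obtain h where h: "invertible h" "linear_form h 3 = L"
      by (rule exists_invertible_linear_form[OF L1 False])
    obtain h' where h': "\<forall>f. linear_subst h' (linear_subst h f) = f" "invertible h'"
      using invertible_linear_subst[OF h(1)] by blast
    have "linear_subst h' L = Var 3" using h'(1) h(2) linear_subst_Var by metis
    from card_leads_x3[OF h'(2) this]
    have "int (card {m \<in> leads (moved h'). mdeg m = Suc d \<and> m $ 3 \<noteq> 0}) = ?M" using dimL by simp
    moreover have "count h' (axis 2 (Suc d)) \<le> count g (axis 2 (Suc d))"
      using g h'(2) by (simp add: optimal_def)
    ultimately show ?thesis
      using count_x2[OF invg, of "Suc d"] count_x2[OF h'(2), of "Suc d"] eq_g ge by linarith
  qed
qed

lemma optimal_strongly_stable:
  assumes "optimal g"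
  shows "strongly_stable (leads (moved g))"
proof
  have "invertible g" using assms by (simp add: optimal_def)
  then show "a + m \<in> leads (moved g)" if "m \<in> leads (moved g)" for a m
    by (intro leads_add moved_ideal that)
  show "u - axis j 1 + axis i 1 \<in> leads (moved g)"
    if "u \<in> leads (moved g)" "u $ j \<noteq> 0" "revlex_less (axis j 1) (axis i 1)" for u i j
    by (rule optimal_stable[OF assms that])
qed

end

section \<open>Comparing two ideals\<close>

lemma betti_gin_eq:
  assumes "cofinite_ideal (I :: 'k::field_char_0 mpoly3 set) M" "cofinite_ideal (J :: 'k mpoly3 set) N"
    and wl: "weak_Lefschetz I" "weak_Lefschetz J"
    and hdim: "\<And>d. hdim I d = hdim J d"
  shows "betti (gin I) = betti (gin J)"
proof -
  interpret I: cofinite_ideal I M by fact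
  interpret J: cofinite_ideal J N by fact
  obtain g where g: "I.optimal g" using generic_ex[OF I.generic_optimal] by blast
  obtain h where h: "J.optimal h" using generic_ex[OF J.generic_optimal] by blast
  have inv: "invertible g" "invertible h" using g h by (simp_all add: I.optimal_def J.optimal_def)
  show ?thesis
    unfolding I.gin_eq[OF g] J.gin_eq[OF h]
  proof (rule betti_strongly_stable[OF I.optimal_strongly_stable[OF g] J.optimal_strongly_stable[OF h]])
    fix d
    show "card {m \<in> leads (I.moved g). mdeg m = d} = card {m \<in> leads (J.moved h). mdeg m = d}"
      using hdim[of "int d"] by (simp add: I.card_leads_degree[OF inv(1)] J.card_leads_degree[OF inv(2)])
    have "int (card {m \<in> leads (I.moved g). mdeg m = Suc d \<and> m $ 3 \<noteq> 0}) =
        int (card {m \<in> leads (J.moved h). mdeg m = Suc d \<and> m $ 3 \<noteq> 0})"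
      by (simp only: I.optimal_card_x3[OF g wl(1)] J.optimal_card_x3[OF h wl(2)] hdim)
    then show "card {m \<in> leads (I.moved g). mdeg m = Suc d \<and> m $ 3 \<noteq> 0} =
        card {m \<in> leads (J.moved h). mdeg m = Suc d \<and> m $ 3 \<noteq> 0}" by simp
  qed
qed

text \<open>The images in R/I of the powers of (x_1, x_2, x_3) form a descending chain, stationary
  from some \<open>N\<close> on. A form of degree \<open>N\<close> is then congruent modulo
  \<open>I\<close> to an element with terms of higher degree only, and the degree \<open>N\<close>
  part of the difference is the form itself.\<close>

lemma artinian_ideal_cofinite:
  fixes I :: "'k::field_char_0 mpoly3 set"
  assumes "artinian_ideal I"
  obtains N where "cofinite_ideal I N"
proof -
  have hom: "homogeneous_ideal I" and art: "artinian_quotient I" using assms by (auto simp: artinian_ideal_def)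
  have I: "ideal.subspace I" by (rule homogeneous_ideal_subspace[OF hom])
  define P where "P n = (monomial_span {m. n \<le> mdeg m} :: 'k mpoly3 set)" for n
  have P: "ideal.subspace (P n)" for n
    unfolding P_def by (rule subspace_monomial_span) (simp add: mdeg_add)
  have q: "quotient_ideal I (residue_class I ` P n)" for n
    unfolding quotient_ideal_def
  proof (intro conjI allI impI)
    show "residue_class I ` P n \<subseteq> range (residue_class I)" by blast
    show "residue_class I 0 \<in> residue_class I ` P n" using ideal.subspace_0[OF P] by blast
    fix f assume "residue_class I f \<in> residue_class I ` P n"
    then obtain f' where f': "f' \<in> P n" "f - f' \<in> I" by (auto simp: residue_class_eq_iff[OF I])
    show "residue_class I (f + h) \<in> residue_class I ` P n" if h: "residue_class I h \<in> residue_class I ` P n" for h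
    proof -
      obtain h' where h': "h' \<in> P n" "h - h' \<in> I" using h by (auto simp: residue_class_eq_iff[OF I])
      have "(f + h) - (f' + h') \<in> I" using ideal.subspace_add[OF I f'(2) h'(2)] by (simp add: algebra_simps)
      then have "residue_class I (f + h) = residue_class I (f' + h')" by (simp add: residue_class_eq_iff[OF I])
      then show ?thesis using ideal.subspace_add[OF P f'(1) h'(1)] by (rule image_eqI)
    qed
    show "residue_class I (r * f) \<in> residue_class I ` P n" for r
    proof -
      have "r * f - r * f' \<in> I" using ideal.subspace_scale[OF I f'(2), of r] by (simp add: right_diff_distrib)
      then have "residue_class I (r * f) = residue_class I (r * f')" by (simp add: residue_class_eq_iff[OF I])
      then show ?thesis using ideal.subspace_scale[OF P f'(1)] by (rule image_eqI)
    qed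
  qed
  have dec: "residue_class I ` P (Suc n) \<subseteq> residue_class I ` P n" for n
    by (rule image_mono) (auto simp: P_def monomial_span_def)
  from art[unfolded artinian_quotient_def, THEN spec, of "\<lambda>n. residue_class I ` P n"] q dec
  obtain N where N: "\<forall>n\<ge>N. residue_class I ` P n = residue_class I ` P N" by blast
  have "rcomp (int N) \<subseteq> I"
  proof
    fix h :: "'k mpoly3" assume h: "h \<in> rcomp (int N)"
    then have "h \<in> P N" by (auto simp: P_def monomial_span_def rcomp_def)
    then have "residue_class I h \<in> residue_class I ` P (Suc N)"
      using N[rule_format, of "Suc N"] by (metis imageI le_SucI order_refl)
    then obtain f where f: "f \<in> P (Suc N)" "h - f \<in> I" by (auto simp: residue_class_eq_iff[OF I])
    have "rpart (int N) f = 0"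
    proof (rule poly_mapping_eqI)
      fix m show "lk (rpart (int N) f) m = lk 0 m"
        using f(1) by (force simp: P_def monomial_span_def when_def)
    qed
    moreover have "rpart (int N) h = rpart (int N) (h - f) + rpart (int N) f"
      unfolding rpart_add[symmetric] by simp
    ultimately show "h \<in> I" using homogeneous_ideal_rpart[OF hom f(2), of "int N"] rpart_id[OF h] by simp
  qed
  then show thesis using that hom by (simp add: cofinite_ideal_def)
qed

text \<open>Containing all forms of degree \<open>N\<close> is a condition on the Hilbert function,
  so it passes from one ideal to the other.\<close>

lemma cofinite_ideal_transfer:
  fixes I J :: "'k::field_char_0 mpoly3 set"
  assumes "cofinite_ideal I N" "homogeneous_ideal J" and hdim: "\<And>d. hdim I d = hdim J d"
  shows "cofinite_ideal J N"
proof -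
  have J: "ideal.subspace J" by (rule homogeneous_ideal_subspace[OF assms(2)])
  have "I \<inter> rcomp (int N) = rcomp (int N)" using assms(1) by (auto simp: cofinite_ideal_def)
  then have "rvec.dim (rcomp (int N) :: 'k mpoly3 set) \<le> rvec.dim (J \<inter> rcomp (int N))"
    using hdim[of "int N"] by simp
  then have "J \<inter> rcomp (int N) = rcomp (int N)"
    by (intro rvec.fin_subspace_dim_eq[OF fin_rcomp] rvec_subspace_Int subspace_ideal_rvec J subspace_rcomp) auto
  then show ?thesis using assms(2) by (auto simp: cofinite_ideal_def)
qed

lemma betti_gin_determined:
  fixes I J :: "'k::field_char_0 mpoly3 set"
  assumes I: "artinian_ideal I" "weak_Lefschetz I" and J: "homogeneous_ideal J" "weak_Lefschetz J"
    and eq: "betti I = betti J"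
  shows "betti (gin I) = betti (gin J)"
proof -
  obtain N where N: "cofinite_ideal I N" by (rule artinian_ideal_cofinite[OF I(1)])
  have hom: "homogeneous_ideal I" using I(1) by (simp add: artinian_ideal_def)
  have hdim: "hdim I d = hdim J d" for d by (rule hdim_eq_if_betti_eq[OF hom J(1) eq])
  from betti_gin_eq[OF N cofinite_ideal_transfer[OF N J(1) hdim] I(2) J(2) hdim] show ?thesis .
qed

theorem corollary4p3:
  shows "(\<exists>\<Phi> :: (nat \<Rightarrow> nat \<Rightarrow> nat) \<Rightarrow> (nat \<Rightarrow> nat \<Rightarrow> nat).
            \<forall>I :: 'k::field_char_0 mpoly3 set.
              artinian_ideal I \<and> weak_Lefschetz I \<longrightarrow> betti (gin I) = \<Phi> (betti I)) \<and>
         (\<forall>(I :: 'k mpoly3 set) (J :: 'k mpoly3 set).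
              artinian_ideal I \<and> weak_Lefschetz I \<and>
              homogeneous_ideal J \<and> weak_Lefschetz J \<and>
              (\<forall>i j. betti I i j = betti J i j) \<longrightarrow>
              (\<forall>i j. betti (gin I) i j = betti (gin J) i j))"
proof (intro conjI allI impI)
  \<comment> \<open>\<open>S b\<close> represents all ideals of the required kind with Betti numbers
    \<open>b\<close>. The comparison of two ideals shows that the choice does not matter, so the
    Betti numbers of its generic initial ideal serve as the value at \<open>b\<close>.\<close>
  define S where "S b = (SOME I :: 'k mpoly3 set. artinian_ideal I \<and> weak_Lefschetz I \<and> betti I = b)" for b
  have "betti (gin I) = betti (gin (S (betti I)))"
    if I: "artinian_ideal I \<and> weak_Lefschetz I" for I :: "'k mpoly3 set"
  proof -
    have "artinian_ideal (S (betti I)) \<and> weak_Lefschetz (S (betti I)) \<and> betti (S (betti I)) = betti I"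
      unfolding S_def by (rule someI[of _ I]) (use I in simp)
    then show ?thesis using I by (intro betti_gin_determined) (simp_all add: artinian_ideal_def)
  qed
  then show "\<exists>\<Phi> :: (nat \<Rightarrow> nat \<Rightarrow> nat) \<Rightarrow> (nat \<Rightarrow> nat \<Rightarrow> nat). \<forall>I :: 'k mpoly3 set.
      artinian_ideal I \<and> weak_Lefschetz I \<longrightarrow> betti (gin I) = \<Phi> (betti I)"
    by (intro exI[of _ "\<lambda>b. betti (gin (S b))"]) blast
next
  fix I J :: "'k mpoly3 set" and i j
  assume a: "artinian_ideal I \<and> weak_Lefschetz I \<and> homogeneous_ideal J \<and> weak_Lefschetz J \<and>
    (\<forall>i j. betti I i j = betti J i j)"
  then have "betti I = betti J" by (intro ext) blast
  then have "betti (gin I) = betti (gin J)" using a by (intro betti_gin_determined) auto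
  then show "betti (gin I) i j = betti (gin J) i j" by simp
qed

end
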